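(* Let $(X,J)$ be an almost complex manifold of real dimension $4$ or $6$ (not necessarily compact) such that $J$ is maximally non-integrable at some point $x\in X$. Then the Dolbeault cohomology $H_{Dol}(X)=H_{Dol}(X,J)$ is infinite dimensional (as a complex vector space).
   Context: Let $(X,J)$ be an almost complex manifold of real dimension $2n$, $T^{1,0}X,T^{0,1}X\subset TX\otimes\mathbb{C}$ the $\pm i$-eigenbundles of $J$, $A^{1,0}_X$, $A^{0,1}_X$ their duals, $A^{p,q}_X=\Lambda^pA^{1,0}_X\otimes\Lambda^qA^{0,1}_X$, and $\mathcal{A}^{p,q}_X$ the space of smooth sections of $A^{p,q}_X$. The exterior derivative decomposes as $d=\bar\mu+\bar\partial+\partial+\mu$ with components of bidegrees $(-1,2),(0,1),(1,0),(2,-1)$ respectively. From $d^2=0$ one gets $\bar\mu^2=0$, $\bar\mu\bar\partial+\bar\partial\bar\mu=0$ and $\bar\mu\partial+\partial\bar\mu+\bar\partial^2=0$, so $\bar\partial$ induces a differential on $H_{\bar\mu}(\mathcal{A}_X^{\bullet,\bullet})=\ker\bar\mu/\operatorname{im}\bar\mu$, and the Dolbeault cohomology is $H_{Dol}(X,J):=H_{\bar\partial}(H_{\bar\mu}(\mathcal{A}_X^{\bullet,\bullet}))$. $J$ is maximally non-integrable at $x$ if the bundle map $\bar\mu:A^{1,0}_X\to A^{0,2}_X$ (the Nijenhuis tensor) has maximal complex rank $\min\{n,\binom n2\}$ at $x$ (i.e. is surjective at $x$ if $n=2$, an isomorphism at $x$ if $n=3$). *)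

theory Defs
  imports
    "HOL-Analysis.Analysis"
    "HOL-Combinatorics.Permutations"
    "HOL-Library.Function_Algebras"
    "HOL-Algebra.Module"
    "HOL-Algebra.AbelCoset"
begin

section \<open>Smooth maps and smooth manifolds\<close>

text \<open>Only used on open sets, where \<^term>\<open>f differentiable_on S\<close> and the
  derivative \<^term>\<open>frechet_derivative f (at x)\<close> fit together.\<close>

fun Ck_on :: "nat \<Rightarrow> 'a::euclidean_space set \<Rightarrow> ('a \<Rightarrow> 'b::euclidean_space) \<Rightarrow> bool" where
  "Ck_on 0 S f \<longleftrightarrow> continuous_on S f"
| "Ck_on (Suc k) S f \<longleftrightarrow>
     f differentiable_on S \<and> (\<forall>v. Ck_on k S (\<lambda>x. frechet_derivative f (at x) v))"

definition smooth_on :: "'a::euclidean_space set \<Rightarrow> ('a \<Rightarrow> 'b::euclidean_space) \<Rightarrow> bool" where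
  "smooth_on S f \<longleftrightarrow> (\<forall>k. Ck_on k S f)"

text \<open>A chart is a pair of its domain and its coordinate map.\<close>

type_synonym ('m, 'e) chart = "'m set \<times> ('m \<Rightarrow> 'e)"

definition target :: "('m, 'e) chart \<Rightarrow> 'e set" where
  "target c = snd c ` fst c"

definition overlap :: "('m, 'e) chart \<Rightarrow> ('m, 'e) chart \<Rightarrow> 'e set" where
  "overlap c c' = snd c ` (fst c \<inter> fst c')"

definition transition :: "('m, 'e) chart \<Rightarrow> ('m, 'e) chart \<Rightarrow> 'e \<Rightarrow> 'e" where
  "transition c c' = snd c' \<circ> inv_into (fst c) (snd c)"

text \<open>The dimension of the manifold is \<open>DIM('e)\<close>. The atlas need not be maximal.\<close>

definition smooth_manifold :: "'m topology \<Rightarrow> ('m, 'e::euclidean_space) chart set \<Rightarrow> bool" where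
  "smooth_manifold M A \<longleftrightarrow>
     Hausdorff_space M \<and> second_countable M \<and>
     (\<Union>c\<in>A. fst c) = topspace M \<and>
     (\<forall>c\<in>A. openin M (fst c) \<and> open (target c) \<and>
        homeomorphic_map (subtopology M (fst c)) (top_of_set (target c)) (snd c)) \<and>
     (\<forall>c\<in>A. \<forall>c'\<in>A. smooth_on (overlap c c') (transition c c'))"

section \<open>Almost complex structures\<close>

text \<open>Sections of tensor bundles are given by their local representatives in the charts
  of the atlas (with argument the point of the target of the chart), subject to the
  transformation law under the transition maps.\<close>

type_synonym ('m, 'e) endo_field = "('m, 'e) chart \<Rightarrow> 'e \<Rightarrow> 'e \<Rightarrow> 'e"

definition almost_complex_structure ::
  "('m, 'e::euclidean_space) chart set \<Rightarrow> ('m, 'e) endo_field \<Rightarrow> bool" where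
  "almost_complex_structure A J \<longleftrightarrow>
     (\<forall>c\<in>A. \<forall>y\<in>target c. linear (J c y) \<and> (\<forall>v. J c y (J c y v) = - v)) \<and>
     (\<forall>c\<in>A. \<forall>v. smooth_on (target c) (\<lambda>y. J c y v)) \<and>
     (\<forall>c\<in>A. \<forall>c'\<in>A. \<forall>y\<in>overlap c c'. \<forall>v.
        frechet_derivative (transition c c') (at y) (J c y v) =
        J c' (transition c c' y) (frechet_derivative (transition c c') (at y) v))"

section \<open>Complex-valued alternating forms and their types at a point\<close>

text \<open>In this section \<open>J\<close> is a complex structure on the real vector space \<open>'e\<close>.
  A complex-valued form of degree \<open>k\<close> is a function on lists of vectors that vanishes on
  lists of length different from \<open>k\<close>, so that forms of different degrees can be added.
  A complex-valued real-multilinear form on \<open>'e\<close> is the same as a complex multilinear form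
  on the complexification of \<open>'e\<close>, whose elements \<open>u + \<i> w\<close> are written \<open>(u, w)\<close>.\<close>

type_synonym 'e cform = "'e list \<Rightarrow> complex"

definition T01 :: "('e::euclidean_space \<Rightarrow> 'e) \<Rightarrow> ('e \<times> 'e) set" where
  "T01 J = {(u, w). (J u, J w) = (w, - u)}"

definition T10 :: "('e::euclidean_space \<Rightarrow> 'e) \<Rightarrow> ('e \<times> 'e) set" where
  "T10 J = {(u, w). (J u, J w) = (- w, u)}"

text \<open>The dual of the \<open>(1,0)\<close>-part consists of the covectors annihilating the \<open>(0,1)\<close>-part,
  and vice versa.\<close>

definition A10 :: "('e::euclidean_space \<Rightarrow> 'e) \<Rightarrow> ('e \<Rightarrow> complex) set" where
  "A10 J = {\<alpha>. linear \<alpha> \<and> (\<forall>(u, w)\<in>T01 J. \<alpha> u + \<i> * \<alpha> w = 0)}"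

definition A01 :: "('e::euclidean_space \<Rightarrow> 'e) \<Rightarrow> ('e \<Rightarrow> complex) set" where
  "A01 J = {\<alpha>. linear \<alpha> \<and> (\<forall>(u, w)\<in>T10 J. \<alpha> u + \<i> * \<alpha> w = 0)}"

definition wedge :: "('e \<Rightarrow> complex) list \<Rightarrow> 'e cform" where
  "wedge \<alpha>s vs =
     (if length vs = length \<alpha>s
      then \<Sum>\<pi> | \<pi> permutes {..<length \<alpha>s}.
             of_int (sign \<pi>) * (\<Prod>i<length \<alpha>s. (\<alpha>s ! i) (vs ! \<pi> i))
      else 0)"

definition cscale :: "complex \<Rightarrow> 'e cform \<Rightarrow> 'e cform" where
  "cscale a \<theta> = (\<lambda>vs. a * \<theta> vs)"

definition forms_at :: "('e::euclidean_space \<Rightarrow> 'e) \<Rightarrow> nat \<Rightarrow> nat \<Rightarrow> 'e cform set" where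
  "forms_at J p q = module.span cscale
     {wedge (\<alpha>s @ \<beta>s) | \<alpha>s \<beta>s. length \<alpha>s = p \<and> set \<alpha>s \<subseteq> A10 J \<and> length \<beta>s = q \<and> set \<beta>s \<subseteq> A01 J}"

text \<open>The component of bidegree \<open>(p,q)\<close> with respect to the decomposition of the exterior
  algebra as the direct sum of all \<^term>\<open>forms_at J r s\<close>.\<close>

definition pq_part :: "('e::euclidean_space \<Rightarrow> 'e) \<Rightarrow> nat \<Rightarrow> nat \<Rightarrow> 'e cform \<Rightarrow> 'e cform" where
  "pq_part J p q \<theta> = (THE \<eta>. \<eta> \<in> forms_at J p q \<and>
     \<theta> - \<eta> \<in> module.span cscale (\<Union>(r, s)\<in>- {(p, q)}. forms_at J r s))"

section \<open>Differential forms and the components of the exterior derivative\<close>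

type_synonym ('m, 'e) dform = "('m, 'e) chart \<Rightarrow> 'e \<Rightarrow> 'e cform"

text \<open>The smooth forms of bidegree \<open>(p,q)\<close>. The first condition makes the
  representation unique.\<close>

definition dforms :: "('m, 'e::euclidean_space) chart set \<Rightarrow> ('m, 'e) endo_field \<Rightarrow>
    nat \<Rightarrow> nat \<Rightarrow> ('m, 'e) dform set" where
  "dforms A J p q = {\<omega>.
     (\<forall>c y. \<not> (c \<in> A \<and> y \<in> target c) \<longrightarrow> \<omega> c y = 0) \<and>
     (\<forall>c\<in>A. \<forall>y\<in>target c. \<omega> c y \<in> forms_at (J c y) p q) \<and>
     (\<forall>c\<in>A. \<forall>vs. smooth_on (target c) (\<lambda>y. \<omega> c y vs)) \<and>
     (\<forall>c\<in>A. \<forall>c'\<in>A. \<forall>y\<in>overlap c c'. \<forall>vs.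
        \<omega> c y vs =
        \<omega> c' (transition c c' y) (map (frechet_derivative (transition c c') (at y)) vs))}"

text \<open>The exterior derivative in a chart, normalised so that
  \<open>d\<alpha>(u,v) = u(\<alpha>(v)) - v(\<alpha>(u))\<close> for constant vector fields \<open>u\<close>, \<open>v\<close>.\<close>

definition ext_deriv :: "('e::euclidean_space \<Rightarrow> 'e cform) \<Rightarrow> 'e \<Rightarrow> 'e cform" where
  "ext_deriv \<omega> y vs = (\<Sum>i<length vs. (- 1) ^ i *
     frechet_derivative (\<lambda>z. \<omega> z (take i vs @ drop (Suc i) vs)) (at y) (vs ! i))"

definition d_part :: "('m, 'e::euclidean_space) chart set \<Rightarrow> ('m, 'e) endo_field \<Rightarrow>
    nat \<Rightarrow> nat \<Rightarrow> ('m, 'e) dform \<Rightarrow> ('m, 'e) dform" where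
  "d_part A J r s \<omega> = (\<lambda>c y.
     if c \<in> A \<and> y \<in> target c then pq_part (J c y) r s (ext_deriv (\<omega> c) y) else 0)"

text \<open>\<open>mubar\<close> and \<open>dbar\<close> on forms of bidegree \<open>(p,q)\<close>; their values have bidegree
  \<open>(p-1,q+2)\<close> and \<open>(p,q+1)\<close>.\<close>

definition mubar :: "('m, 'e::euclidean_space) chart set \<Rightarrow> ('m, 'e) endo_field \<Rightarrow>
    nat \<Rightarrow> nat \<Rightarrow> ('m, 'e) dform \<Rightarrow> ('m, 'e) dform" where
  "mubar A J p q \<omega> = (if p = 0 then 0 else d_part A J (p - 1) (q + 2) \<omega>)"

definition dbar :: "('m, 'e::euclidean_space) chart set \<Rightarrow> ('m, 'e) endo_field \<Rightarrow>
    nat \<Rightarrow> nat \<Rightarrow> ('m, 'e) dform \<Rightarrow> ('m, 'e) dform" where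
  "dbar A J p q \<omega> = d_part A J p (q + 1) \<omega>"

section \<open>Maximal non-integrability\<close>

text \<open>The bundle map from \<open>(1,0)\<close>- to \<open>(0,2)\<close>-covectors that induces \<open>mubar\<close> on sections,
  on the fibre over the point with coordinate \<open>y\<close> in the chart \<open>c\<close>: extend the covector
  to a smooth form, apply \<open>mubar\<close> and evaluate. The value is independent of the extension
  since \<open>mubar\<close> is linear over the smooth functions.\<close>

definition mubar_at :: "('m, 'e::euclidean_space) chart set \<Rightarrow> ('m, 'e) endo_field \<Rightarrow>
    ('m, 'e) chart \<Rightarrow> 'e \<Rightarrow> 'e cform \<Rightarrow> 'e cform" where
  "mubar_at A J c y a =
     (THE b. \<exists>\<alpha>\<in>dforms A J 1 0. \<alpha> c y = a \<and> mubar A J 1 0 \<alpha> c y = b)"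

definition maximally_nonintegrable_at ::
  "('m, 'e::euclidean_space) chart set \<Rightarrow> ('m, 'e) endo_field \<Rightarrow> 'm \<Rightarrow> bool" where
  "maximally_nonintegrable_at A J x \<longleftrightarrow>
     (\<exists>c\<in>A. x \<in> fst c \<and>
        vector_space.dim cscale (mubar_at A J c (snd c x) ` forms_at (J c (snd c x)) 1 0) =
        min (DIM('e) div 2) ((DIM('e) div 2) choose 2))"

section \<open>Complex vector spaces and their quotients\<close>

text \<open>Complex vector spaces are represented by module records with scalars in \<open>complex\<close>;
  the fields \<open>mult\<close> and \<open>one\<close> of these records play no role.\<close>

definition quotient_space :: "(complex, 'v) module \<Rightarrow> 'v set \<Rightarrow> (complex, 'v set) module" where
  "quotient_space V W =
     \<lparr>carrier = (\<lambda>x. W +>\<^bsub>V\<^esub> x) ` carrier V, mult = undefined, one = undefined,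
      zero = W, add = set_add V, smult = (\<lambda>a C. \<Union>x\<in>C. W +>\<^bsub>V\<^esub> (a \<odot>\<^bsub>V\<^esub> x))\<rparr>"

definition direct_sum :: "('i \<Rightarrow> (complex, 'v) module) \<Rightarrow> (complex, 'i \<Rightarrow> 'v) module" where
  "direct_sum V =
     \<lparr>carrier = {f. (\<forall>i. f i \<in> carrier (V i)) \<and> finite {i. f i \<noteq> \<zero>\<^bsub>V i\<^esub>}},
      mult = undefined, one = undefined, zero = (\<lambda>i. \<zero>\<^bsub>V i\<^esub>),
      add = (\<lambda>f g i. f i \<oplus>\<^bsub>V i\<^esub> g i), smult = (\<lambda>a f i. a \<odot>\<^bsub>V i\<^esub> f i)\<rparr>"

inductive_set linear_span :: "(complex, 'v) module \<Rightarrow> 'v set \<Rightarrow> 'v set" for V S where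
  zero: "\<zero>\<^bsub>V\<^esub> \<in> linear_span V S"
| incl: "x \<in> S \<Longrightarrow> x \<in> linear_span V S"
| add: "x \<in> linear_span V S \<Longrightarrow> y \<in> linear_span V S \<Longrightarrow> x \<oplus>\<^bsub>V\<^esub> y \<in> linear_span V S"
| smult: "x \<in> linear_span V S \<Longrightarrow> a \<odot>\<^bsub>V\<^esub> x \<in> linear_span V S"

definition finite_dimensional :: "(complex, 'v) module \<Rightarrow> bool" where
  "finite_dimensional V \<longleftrightarrow>
     (\<exists>S. finite S \<and> S \<subseteq> carrier V \<and> carrier V \<subseteq> linear_span V S)"

section \<open>Dolbeault cohomology\<close>

definition ker_mubar :: "('m, 'e::euclidean_space) chart set \<Rightarrow> ('m, 'e) endo_field \<Rightarrow>
    nat \<Rightarrow> nat \<Rightarrow> ('m, 'e) dform set" where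
  "ker_mubar A J p q = {\<omega> \<in> dforms A J p q. mubar A J p q \<omega> = 0}"

definition im_mubar :: "('m, 'e::euclidean_space) chart set \<Rightarrow> ('m, 'e) endo_field \<Rightarrow>
    nat \<Rightarrow> nat \<Rightarrow> ('m, 'e) dform set" where
  "im_mubar A J p q =
     (if 2 \<le> q then mubar A J (p + 1) (q - 2) ` dforms A J (p + 1) (q - 2) else {0})"

definition ker_mubar_space :: "('m, 'e::euclidean_space) chart set \<Rightarrow> ('m, 'e) endo_field \<Rightarrow>
    nat \<Rightarrow> nat \<Rightarrow> (complex, ('m, 'e) dform) module" where
  "ker_mubar_space A J p q =
     \<lparr>carrier = ker_mubar A J p q, mult = undefined, one = undefined,
      zero = 0, add = (+), smult = (\<lambda>a \<omega> c y. cscale a (\<omega> c y))\<rparr>"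

definition H_mubar :: "('m, 'e::euclidean_space) chart set \<Rightarrow> ('m, 'e) endo_field \<Rightarrow>
    nat \<Rightarrow> nat \<Rightarrow> (complex, ('m, 'e) dform set) module" where
  "H_mubar A J p q = quotient_space (ker_mubar_space A J p q) (im_mubar A J p q)"

definition mubar_class :: "('m, 'e::euclidean_space) chart set \<Rightarrow> ('m, 'e) endo_field \<Rightarrow>
    nat \<Rightarrow> nat \<Rightarrow> ('m, 'e) dform \<Rightarrow> ('m, 'e) dform set" where
  "mubar_class A J p q \<omega> = im_mubar A J p q +>\<^bsub>ker_mubar_space A J p q\<^esub> \<omega>"

text \<open>Kernel and image of the differential \<open>[\<omega>] \<mapsto> [dbar \<omega>]\<close> induced on \<open>H_mubar\<close>.\<close>

definition ker_dbar :: "('m, 'e::euclidean_space) chart set \<Rightarrow> ('m, 'e) endo_field \<Rightarrow>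
    nat \<Rightarrow> nat \<Rightarrow> ('m, 'e) dform set set" where
  "ker_dbar A J p q = {mubar_class A J p q \<omega> | \<omega>. \<omega> \<in> ker_mubar A J p q \<and>
     mubar_class A J p (q + 1) (dbar A J p q \<omega>) = \<zero>\<^bsub>H_mubar A J p (q + 1)\<^esub>}"

definition im_dbar :: "('m, 'e::euclidean_space) chart set \<Rightarrow> ('m, 'e) endo_field \<Rightarrow>
    nat \<Rightarrow> nat \<Rightarrow> ('m, 'e) dform set set" where
  "im_dbar A J p q =
     (if 1 \<le> q
      then {mubar_class A J p q (dbar A J p (q - 1) \<omega>) | \<omega>. \<omega> \<in> ker_mubar A J p (q - 1)}
      else {\<zero>\<^bsub>H_mubar A J p q\<^esub>})"

definition H_Dol_pq :: "('m, 'e::euclidean_space) chart set \<Rightarrow> ('m, 'e) endo_field \<Rightarrow>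
    nat \<Rightarrow> nat \<Rightarrow> (complex, ('m, 'e) dform set set) module" where
  "H_Dol_pq A J p q =
     quotient_space (H_mubar A J p q\<lparr>carrier := ker_dbar A J p q\<rparr>) (im_dbar A J p q)"

definition H_Dol :: "('m, 'e::euclidean_space) chart set \<Rightarrow> ('m, 'e) endo_field \<Rightarrow>
    (complex, nat \<times> nat \<Rightarrow> ('m, 'e) dform set set) module" where
  "H_Dol A J = direct_sum (\<lambda>(p, q). H_Dol_pq A J p q)"

end

theory Submission
  imports Defs "HOL-Library.Multiset"
begin

text \<open>
  The argument takes place in bidegree \<open>(0,1)\<close> and is the same in both dimensions. Let
  \<open>n\<close> be the complex dimension. As \<open>n\<close> is 2 or 3, the maximal rank is \<open>n choose 2\<close>, the rank
  of the bundle of \<open>(0,2)\<close>-covectors, so maximal non-integrability says that \<open>mubar\<close> maps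
  \<open>(1,0)\<close>-covectors onto \<open>(0,2)\<close>-covectors at the given point, and then on a neighbourhood
  \<open>U\<close> of it. Therefore every \<open>(0,1)\<close>-form \<open>\<omega>\<close> with compact support in \<open>U\<close> represents a
  Dolbeault class: \<open>dbar \<omega>\<close> lies in the image of \<open>mubar\<close>
  (\<open>supported_01_forms_closed\<close>). Since no nonzero form of bidegree \<open>(0,1)\<close> is in the image of \<open>mubar\<close>,
  two such forms define the same class exactly when they differ by \<open>dbar f\<close> for a function \<open>f\<close>.

  That this leaves infinitely many classes follows by counting Taylor coefficients at the
  point. Let \<open>c k\<close> be the dimension of the space of \<open>k\<close>-jets of functions. The operator
  \<open>dbar\<close> has order one, so the \<open>k\<close>-jets of the forms \<open>dbar f\<close> span a space of dimension at
  most \<open>c (k + 1)\<close>. The \<open>k\<close>-jets of \<open>(0,1)\<close>-forms supported in \<open>U\<close> span a space of dimension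
  at least \<open>2 * c k\<close>, because there are two linearly independent \<open>(0,1)\<close>-covectors. If the
  cohomology had finite dimension \<open>N\<close>, then \<open>2 * c k \<le> N + c (k + 1)\<close> for all \<open>k\<close>, and \<open>c\<close>
  would grow exponentially as soon as it exceeds \<open>N\<close>. It does exceed \<open>N\<close>, because of the
  powers of one coordinate, but it is bounded by a polynomial in \<open>k\<close>, because partial derivatives
  commute (\<open>jet_spaces\<close>, \<open>no_exponential_below_polynomial\<close>).

  Three points need work before these two ideas apply. The component of a form in a bidegree is a definite
  description, so the sum of the spaces of forms of the different types has to be direct;
  the rotations \<open>cos t + sin t J\<close> separate the types (\<open>bidegrees_independent\<close>). Preimages
  under \<open>mubar\<close> must depend smoothly on the point, which is a smooth version of Nakayama's lemma
  (\<open>smooth_solution_near\<close>, \<open>mubar_onto_locally\<close>). Finally, forms are families of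
  local representatives in all charts at once, so that extending a form by zero from a chart
  requires the naturality of the exterior derivative under transition maps
  (\<open>d_covector_pullback\<close>, \<open>extend_form_in_dforms\<close>).
\<close>

section \<open>Calculus of smooth maps\<close>

text \<open>The directional derivative in the constant direction \<open>v\<close>, in the form in which it
  occurs in the definition of smoothness. It depends only on the germ of the map, whether or not the map is differentiable.\<close>

abbreviation pd :: "'a::euclidean_space \<Rightarrow> ('a \<Rightarrow> 'b::euclidean_space) \<Rightarrow> 'a \<Rightarrow> 'b" where
  "pd v f \<equiv> \<lambda>x. frechet_derivative f (at x) v"

lemma has_derivative_cong_open:
  assumes "open S" "x \<in> S" "\<And>y. y \<in> S \<Longrightarrow> f y = g y"
  shows "(f has_derivative f') (at x) \<longleftrightarrow> (g has_derivative f') (at x)"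
  using has_derivative_transform_within_open[of f f' x UNIV S g]
      has_derivative_transform_within_open[of g f' x UNIV S f] assms by auto

lemma frechet_derivative_cong_open:
  assumes "open S" "x \<in> S" "\<And>y. y \<in> S \<Longrightarrow> f y = g y"
  shows "frechet_derivative f (at x) = frechet_derivative g (at x)"
  using has_derivative_cong_open[OF assms] by (simp add: frechet_derivative_def)

lemma pd_works: "f differentiable at x \<Longrightarrow> (f has_derivative (\<lambda>v. pd v f x)) (at x)"
  by (simp add: frechet_derivative_works)

lemma pd_eq: "(f has_derivative f') (at x) \<Longrightarrow> pd v f x = f' v"
  by (metis frechet_derivative_at)

lemma differentiable_on_open:
  "open S \<Longrightarrow> f differentiable_on S \<longleftrightarrow> (\<forall>x\<in>S. f differentiable at x)"
  by (metis differentiable_on_def at_within_open)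

lemma linear_pd: "f differentiable at x \<Longrightarrow> linear (\<lambda>v. pd v f x)"
  using linear_frechet_derivative by blast

lemma Ck_on_cong:
  assumes "open S" "\<And>x. x \<in> S \<Longrightarrow> f x = g x"
  shows "Ck_on k S f \<longleftrightarrow> Ck_on k S g"
  using assms(2)
proof (induction k arbitrary: f g)
  case 0
  then show ?case by (simp cong: continuous_on_cong)
next
  case (Suc k)
  have pd: "pd v f x = pd v g x" if "x \<in> S" for x v
    using frechet_derivative_cong_open[OF assms(1) that, of f g] Suc.prems by simp
  have d: "f differentiable_on S \<longleftrightarrow> g differentiable_on S"
  proof -
    have "f differentiable at x \<longleftrightarrow> g differentiable at x" if "x \<in> S" for x
      using has_derivative_cong_open[OF assms(1) that, of f g] Suc.prems
      by (simp add: differentiable_def)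
    then show ?thesis by (simp add: differentiable_on_open[OF assms(1)])
  qed
  have "Ck_on k S (pd v f) \<longleftrightarrow> Ck_on k S (pd v g)" for v
    by (rule Suc.IH) (rule pd)
  then show ?case using d by simp
qed

lemma Ck_on_congI:
  "open S \<Longrightarrow> (\<And>x. x \<in> S \<Longrightarrow> f x = g x) \<Longrightarrow> Ck_on k S f \<Longrightarrow> Ck_on k S g"
  using Ck_on_cong by blast

text \<open>Reduces regularity of order \<open>Suc k\<close> to an explicit formula for the derivative; the closure
  properties below are all proved by induction on the order with this rule.\<close>

lemma Ck_on_SucI:
  assumes S: "open S" and D: "\<And>x. x \<in> S \<Longrightarrow> (f has_derivative (\<lambda>v. D v x)) (at x)"
    and C: "\<And>v. Ck_on k S (D v)"
  shows "Ck_on (Suc k) S f"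
proof -
  have "Ck_on k S (pd v f)" for v
    by (rule Ck_on_congI[OF S _ C[of v]]) (simp add: pd_eq[OF D])
  moreover have "f differentiable_on S"
    using D by (auto simp: differentiable_on_open[OF S] differentiable_def)
  ultimately show ?thesis by simp
qed

lemma Ck_on_subset:
  assumes "Ck_on k S f" "T \<subseteq> S"
  shows "Ck_on k T f"
  using assms
  by (induction k arbitrary: f) (auto intro: continuous_on_subset differentiable_on_subset)

lemma Ck_on_Suc_imp: "Ck_on (Suc k) S f \<Longrightarrow> Ck_on k S f"
proof (induction k arbitrary: f)
  case 0
  then show ?case by (simp add: differentiable_imp_continuous_on)
next
  case (Suc k)
  then show ?case by (metis Ck_on.simps(2))
qed

lemma Ck_on_Un:
  assumes "open S" "open T" "Ck_on k S f" "Ck_on k T f"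
  shows "Ck_on k (S \<union> T) f"
  using assms(3,4)
proof (induction k arbitrary: f)
  case 0
  then show ?case using assms(1,2) by (auto intro: continuous_on_open_Un)
next
  case (Suc k)
  then show ?case using assms(1,2) by (auto simp: differentiable_on_open open_Un)
qed

lemma Ck_on_const: "open S \<Longrightarrow> Ck_on k S (\<lambda>x. c)"
proof (induction k arbitrary: c)
  case (Suc k)
  have "pd v (\<lambda>x. c) = (\<lambda>x. 0)" for v :: 'a
    by (auto intro!: pd_eq derivative_eq_intros)
  then show ?case using Suc by simp
qed simp

lemma Ck_on_add:
  assumes S: "open S" and "Ck_on k S f" "Ck_on k S g"
  shows "Ck_on k S (\<lambda>x. f x + g x)"
  using assms(2,3)
proof (induction k arbitrary: f g)
  case 0
  then show ?case by (auto intro: continuous_intros)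
next
  case (Suc k)
  show ?case
  proof (rule Ck_on_SucI[OF S, where D = "\<lambda>v x. pd v f x + pd v g x"])
    show "((\<lambda>x. f x + g x) has_derivative (\<lambda>v. pd v f x + pd v g x)) (at x)" if "x \<in> S" for x
      using that Suc.prems S by (auto simp: differentiable_on_open intro!: has_derivative_add pd_works)
    show "Ck_on k S (\<lambda>x. pd v f x + pd v g x)" for v
      using Suc by simp
  qed
qed

lemma Ck_on_bilinear:
  assumes S: "open S" and h: "bounded_bilinear h" and "Ck_on k S f" "Ck_on k S g"
  shows "Ck_on k S (\<lambda>x. h (f x) (g x))"
  using assms(3,4)
proof (induction k arbitrary: f g)
  case 0
  then show ?case using h by (auto intro: bounded_bilinear.continuous_on)
next
  case (Suc k)
  show ?case
  proof (rule Ck_on_SucI[OF S, where D = "\<lambda>v x. h (f x) (pd v g x) + h (pd v f x) (g x)"])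
    show "((\<lambda>x. h (f x) (g x)) has_derivative (\<lambda>v. h (f x) (pd v g x) + h (pd v f x) (g x))) (at x)"
      if "x \<in> S" for x
      by (rule bounded_bilinear.FDERIV[OF h])
        (use that Suc.prems S in \<open>auto simp: differentiable_on_open intro!: pd_works\<close>)
    show "Ck_on k S (\<lambda>x. h (f x) (pd v g x) + h (pd v f x) (g x))" for v
      using Suc.prems Ck_on_Suc_imp[OF Suc.prems(1)] Ck_on_Suc_imp[OF Suc.prems(2)]
      by (intro Ck_on_add Suc.IH S) auto
  qed
qed

lemma Ck_on_linear:
  assumes S: "open S" and h: "bounded_linear h" and "Ck_on k S f"
  shows "Ck_on k S (\<lambda>x. h (f x))"
  using assms(3)
proof (induction k arbitrary: f)
  case 0
  then show ?case using h by (auto intro: bounded_linear.continuous_on)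
next
  case (Suc k)
  show ?case
  proof (rule Ck_on_SucI[OF S, where D = "\<lambda>v x. h (pd v f x)"])
    show "((\<lambda>x. h (f x)) has_derivative (\<lambda>v. h (pd v f x))) (at x)" if "x \<in> S" for x
      by (rule bounded_linear.has_derivative[OF h])
        (use that Suc.prems S in \<open>auto simp: differentiable_on_open intro!: pd_works\<close>)
    show "Ck_on k S (\<lambda>x. h (pd v f x))" for v
      using Suc.prems by (intro Suc.IH) auto
  qed
qed

lemma Ck_on_sum:
  assumes S: "open S" and "finite I" and "\<And>i. i \<in> I \<Longrightarrow> Ck_on k S (f i)"
  shows "Ck_on k S (\<lambda>x. \<Sum>i\<in>I. f i x)"
  using assms(2,3) by (induction I rule: finite_induct) (auto intro: Ck_on_add Ck_on_const S)

lemma pd_expand_basis: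
  assumes "f differentiable at x"
  shows "pd v f x = (\<Sum>b\<in>Basis. (v \<bullet> b) *\<^sub>R pd b f x)"
proof -
  interpret linear "\<lambda>v. pd v f x" using linear_pd[OF assms] .
  have "pd (\<Sum>b\<in>Basis. (v \<bullet> b) *\<^sub>R b) f x = (\<Sum>b\<in>Basis. (v \<bullet> b) *\<^sub>R pd b f x)"
    by (simp add: sum scale)
  then show ?thesis by (simp add: euclidean_representation)
qed

lemma Ck_on_compose:
  fixes g :: "'a::euclidean_space \<Rightarrow> 'c::euclidean_space" and f :: "'c \<Rightarrow> 'b::euclidean_space"
  assumes S: "open S" and T: "open T" and g: "g ` S \<subseteq> T"
  assumes "Ck_on k T f" "Ck_on k S g"
  shows "Ck_on k S (\<lambda>x. f (g x))"
  using assms(4,5)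
proof (induction k arbitrary: f)
  case 0
  then show ?case using g by (auto intro: continuous_on_compose2)
next
  case (Suc k)
  show ?case
  proof (rule Ck_on_SucI[OF S, where D = "\<lambda>v x. \<Sum>b\<in>Basis. (pd v g x \<bullet> b) *\<^sub>R pd b f (g x)"])
    fix x assume x: "x \<in> S"
    have f: "f differentiable at (g x)" using Suc.prems(1) T g x by (auto simp: differentiable_on_open)
    have "g differentiable at x" using Suc.prems(2) S x by (auto simp: differentiable_on_open)
    then have "((\<lambda>x. f (g x)) has_derivative (\<lambda>v. pd (pd v g x) f (g x))) (at x)"
      using diff_chain_at[OF pd_works[of g x], of f "\<lambda>v. pd v f (g x)"] pd_works[OF f] by (simp add: o_def)
    then show "((\<lambda>x. f (g x)) has_derivative (\<lambda>v. \<Sum>b\<in>Basis. (pd v g x \<bullet> b) *\<^sub>R pd b f (g x))) (at x)"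
      by (simp only: pd_expand_basis[OF f, symmetric])
  next
    show "Ck_on k S (\<lambda>x. \<Sum>b\<in>Basis. (pd v g x \<bullet> b) *\<^sub>R pd b f (g x))" for v
      using Suc.prems Ck_on_Suc_imp[OF Suc.prems(2)]
      by (intro Ck_on_sum S Ck_on_bilinear[OF S bounded_bilinear_scaleR] Suc.IH
          Ck_on_linear[OF S bounded_linear_inner_left]) auto
  qed
qed

lemma Ck_on_inverse:
  fixes f :: "'a::euclidean_space \<Rightarrow> complex"
  assumes S: "open S" and nz: "\<And>x. x \<in> S \<Longrightarrow> f x \<noteq> 0" and "Ck_on k S f"
  shows "Ck_on k S (\<lambda>x. inverse (f x))"
  using assms(3)
proof (induction k)
  case 0
  then show ?case using nz by (auto intro: continuous_intros)
next
  case (Suc k)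
  show ?case
  proof (rule Ck_on_SucI[OF S, where D = "\<lambda>v x. (-1) * ((inverse (f x) * pd v f x) * inverse (f x))"])
    fix x assume x: "x \<in> S"
    have "(f has_derivative (\<lambda>v. pd v f x)) (at x)"
      using x Suc.prems S by (auto simp: differentiable_on_open intro!: pd_works)
    from Deriv.has_derivative_inverse[OF nz[OF x] this]
    show "((\<lambda>x. inverse (f x)) has_derivative (\<lambda>v. (-1) * ((inverse (f x) * pd v f x) * inverse (f x)))) (at x)"
      by simp
  next
    show "Ck_on k S (\<lambda>x. (-1) * ((inverse (f x) * pd v f x) * inverse (f x)))" for v
      using Suc.prems Ck_on_Suc_imp[OF Suc.prems(1)]
      by (intro Ck_on_bilinear[OF S bounded_bilinear_mult] Ck_on_const S Suc.IH) auto
  qed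
qed

lemma smooth_on_cong:
  "open S \<Longrightarrow> (\<And>x. x \<in> S \<Longrightarrow> f x = g x) \<Longrightarrow> smooth_on S f \<longleftrightarrow> smooth_on S g"
  unfolding smooth_on_def using Ck_on_cong by blast

lemma smooth_on_subset: "smooth_on S f \<Longrightarrow> T \<subseteq> S \<Longrightarrow> smooth_on T f"
  by (meson smooth_on_def Ck_on_subset)

lemma smooth_on_Un: "open S \<Longrightarrow> open T \<Longrightarrow> smooth_on S f \<Longrightarrow> smooth_on T f \<Longrightarrow> smooth_on (S \<union> T) f"
  by (meson smooth_on_def Ck_on_Un)

lemma smooth_on_differentiable:
  "smooth_on S f \<Longrightarrow> open S \<Longrightarrow> x \<in> S \<Longrightarrow> f differentiable at x"
  by (metis smooth_on_def Ck_on.simps(2) differentiable_on_open)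

lemma smooth_on_pd: "smooth_on S f \<Longrightarrow> smooth_on S (pd v f)"
  by (metis smooth_on_def Ck_on.simps(2))

lemma smooth_on_continuous: "smooth_on S f \<Longrightarrow> continuous_on S f"
  by (metis smooth_on_def Ck_on.simps(1))

lemma smooth_on_const: "open S \<Longrightarrow> smooth_on S (\<lambda>x. c)"
  by (simp add: smooth_on_def Ck_on_const)

lemma smooth_on_add: "open S \<Longrightarrow> smooth_on S f \<Longrightarrow> smooth_on S g \<Longrightarrow> smooth_on S (\<lambda>x. f x + g x)"
  by (simp add: smooth_on_def Ck_on_add)

lemma smooth_on_bilinear:
  "open S \<Longrightarrow> bounded_bilinear h \<Longrightarrow> smooth_on S f \<Longrightarrow> smooth_on S g \<Longrightarrow> smooth_on S (\<lambda>x. h (f x) (g x))"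
  by (simp add: smooth_on_def Ck_on_bilinear)

lemma smooth_on_linear:
  "open S \<Longrightarrow> bounded_linear h \<Longrightarrow> smooth_on S f \<Longrightarrow> smooth_on S (\<lambda>x. h (f x))"
  by (simp add: smooth_on_def Ck_on_linear)

lemma smooth_on_sum:
  "open S \<Longrightarrow> finite I \<Longrightarrow> (\<And>i. i \<in> I \<Longrightarrow> smooth_on S (f i)) \<Longrightarrow> smooth_on S (\<lambda>x. \<Sum>i\<in>I. f i x)"
  by (simp add: smooth_on_def Ck_on_sum)

lemma smooth_on_mult:
  fixes f g :: "'a::euclidean_space \<Rightarrow> complex"
  shows "open S \<Longrightarrow> smooth_on S f \<Longrightarrow> smooth_on S g \<Longrightarrow> smooth_on S (\<lambda>x. f x * g x)"
  by (rule smooth_on_bilinear[OF _ bounded_bilinear_mult])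

lemma smooth_on_scaleR:
  "open S \<Longrightarrow> smooth_on S f \<Longrightarrow> smooth_on S g \<Longrightarrow> smooth_on S (\<lambda>x. f x *\<^sub>R g x)"
  by (rule smooth_on_bilinear[OF _ bounded_bilinear_scaleR])

lemma smooth_on_of_real:
  "open S \<Longrightarrow> smooth_on S f \<Longrightarrow> smooth_on S (\<lambda>x. complex_of_real (f x))"
  by (rule smooth_on_linear[OF _ bounded_linear_of_real])

lemma smooth_on_inner_left:
  "open S \<Longrightarrow> smooth_on S f \<Longrightarrow> smooth_on S (\<lambda>x. f x \<bullet> b)"
  by (rule smooth_on_linear[OF _ bounded_linear_inner_left])

lemma smooth_on_uminus:
  "open S \<Longrightarrow> smooth_on S f \<Longrightarrow> smooth_on S (\<lambda>x. - f x)"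
  by (rule smooth_on_linear[OF _ bounded_linear_minus[OF bounded_linear_ident]])

lemma smooth_on_diff:
  "open S \<Longrightarrow> smooth_on S f \<Longrightarrow> smooth_on S g \<Longrightarrow> smooth_on S (\<lambda>x. f x - g x)"
  using smooth_on_add[of S f "\<lambda>x. - g x"] smooth_on_uminus[of S g] by simp

lemma smooth_on_inverse:
  fixes f :: "'a::euclidean_space \<Rightarrow> complex"
  shows "open S \<Longrightarrow> (\<And>x. x \<in> S \<Longrightarrow> f x \<noteq> 0) \<Longrightarrow> smooth_on S f \<Longrightarrow> smooth_on S (\<lambda>x. inverse (f x))"
  by (simp add: smooth_on_def Ck_on_inverse)

lemma smooth_on_compose:
  "open S \<Longrightarrow> open T \<Longrightarrow> g ` S \<subseteq> T \<Longrightarrow> smooth_on T f \<Longrightarrow> smooth_on S g \<Longrightarrow> smooth_on S (\<lambda>x. f (g x))"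
  using Ck_on_compose by (metis smooth_on_def)

lemma smooth_on_ident: "open S \<Longrightarrow> smooth_on S (\<lambda>x. x)"
proof -
  assume S: "open S"
  have "pd v (\<lambda>x. x) = (\<lambda>x. v)" for v :: 'a
    by (auto intro!: pd_eq derivative_eq_intros)
  then have "Ck_on k S (\<lambda>x. x)" for k
    by (cases k) (auto intro: Ck_on_const S differentiable_on_ident continuous_on_id)
  then show ?thesis by (simp add: smooth_on_def)
qed

section \<open>Symmetry of second derivatives\<close>

text \<open>The classical argument of Schwarz: the second difference of \<open>f\<close> over a small parallelogram is, by
  two applications of the mean value theorem, the square of the size times the value of either mixed derivative at a
  nearby point, and both mixed derivatives are continuous.\<close>

lemma pd_commute_real:
  fixes f :: "'a::euclidean_space \<Rightarrow> real"
  assumes S: "open S" and x: "x \<in> S" and f: "Ck_on 2 S f"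
  shows "pd v (pd w f) x = pd w (pd v f) x"
proof -
  have C: "\<And>u. Ck_on 1 S (pd u f)" "f differentiable_on S"
    using f by (auto simp: numeral_2_eq_2)
  have d1: "f differentiable at y" if "y \<in> S" for y using C(2) S that by (simp add: differentiable_on_open)
  have d2: "pd u f differentiable at y" if "y \<in> S" for y u
    using C(1)[of u] S that by (auto simp: differentiable_on_open)
  have cont: "continuous_on S (pd u (pd u' f))" for u u' using C(1)[of u'] by auto
  obtain r where r: "r > 0" "ball x r \<subseteq> S" using S x open_contains_ball by blast
  have line: "((\<lambda>s. g (p + s *\<^sub>R u)) has_real_derivative pd u g (p + s *\<^sub>R u)) (at s)"
    if "g differentiable at (p + s *\<^sub>R u)" for g :: "'a \<Rightarrow> real" and p u s
  proof -
    have 1: "((\<lambda>s. p + s *\<^sub>R u) has_derivative (\<lambda>h. h *\<^sub>R u)) (at s)"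
      by (auto intro!: derivative_eq_intros)
    have "((\<lambda>s. g (p + s *\<^sub>R u)) has_derivative (\<lambda>h. pd (h *\<^sub>R u) g (p + s *\<^sub>R u))) (at s)"
      using diff_chain_at[OF 1 pd_works[OF that]] by (simp add: o_def)
    moreover have "pd (h *\<^sub>R u) g (p + s *\<^sub>R u) = pd u g (p + s *\<^sub>R u) * h" for h
      using linear_scale[OF linear_pd[OF that], of h u] by simp
    ultimately show ?thesis
      by (simp add: has_field_derivative_def)
  qed
  have key: "\<exists>s t. 0 < s \<and> s < h \<and> 0 < t \<and> t < h \<and>
      f (x + h *\<^sub>R v + h *\<^sub>R w) - f (x + h *\<^sub>R v) - f (x + h *\<^sub>R w) + f x
        = h * h * pd w (pd v f) (x + s *\<^sub>R v + t *\<^sub>R w)"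
    if h: "0 < h" "h * (norm v + norm w) < r" for h v w
  proof -
    have inS: "x + s *\<^sub>R v + t *\<^sub>R w \<in> S" if "0 \<le> s" "s \<le> h" "0 \<le> t" "t \<le> h" for s t
    proof -
      have "norm (s *\<^sub>R v + t *\<^sub>R w) \<le> s * norm v + t * norm w"
        using norm_triangle_ineq[of "s *\<^sub>R v" "t *\<^sub>R w"] that by simp
      also have "\<dots> \<le> h * norm v + h * norm w" using that by (intro add_mono mult_right_mono) auto
      also have "\<dots> < r" using h by (simp add: algebra_simps)
      finally have "x + s *\<^sub>R v + t *\<^sub>R w \<in> ball x r"
        by (simp add: dist_norm add.assoc norm_minus_commute[of x] del: minus_add_distrib)
      then show ?thesis using r by auto
    qed
    let ?\<phi> = "\<lambda>s. f ((x + h *\<^sub>R w) + s *\<^sub>R v) - f (x + s *\<^sub>R v)"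
    let ?\<phi>' = "\<lambda>s. pd v f ((x + h *\<^sub>R w) + s *\<^sub>R v) - pd v f (x + s *\<^sub>R v)"
    have "(?\<phi> has_real_derivative ?\<phi>' s) (at s)" if "0 \<le> s" "s \<le> h" for s
      using inS[of s h] inS[of s 0] that h by (intro DERIV_diff line d1) (auto simp: algebra_simps)
    then obtain s where s: "0 < s" "s < h" "?\<phi> h - ?\<phi> 0 = (h - 0) * ?\<phi>' s"
      using MVT2[of 0 h ?\<phi> ?\<phi>'] h by blast
    have "((\<lambda>t. pd v f ((x + s *\<^sub>R v) + t *\<^sub>R w)) has_real_derivative pd w (pd v f) ((x + s *\<^sub>R v) + t *\<^sub>R w)) (at t)"
      if "0 \<le> t" "t \<le> h" for t
      using inS[of s t] that s by (intro line d2) auto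
    then obtain t where t: "0 < t" "t < h"
      "pd v f ((x + s *\<^sub>R v) + h *\<^sub>R w) - pd v f ((x + s *\<^sub>R v) + 0 *\<^sub>R w) = (h - 0) * pd w (pd v f) ((x + s *\<^sub>R v) + t *\<^sub>R w)"
      using MVT2[of 0 h "\<lambda>t. pd v f ((x + s *\<^sub>R v) + t *\<^sub>R w)" "\<lambda>t. pd w (pd v f) ((x + s *\<^sub>R v) + t *\<^sub>R w)"] h by blast
    have "?\<phi>' s = h * pd w (pd v f) ((x + s *\<^sub>R v) + t *\<^sub>R w)"
      using t(3) by (simp add: algebra_simps)
    then have "?\<phi> h - ?\<phi> 0 = h * h * pd w (pd v f) ((x + s *\<^sub>R v) + t *\<^sub>R w)"
      using s(3) by simp
    then show ?thesis using s t by (intro exI[of _ s] exI[of _ t]) (auto simp: algebra_simps)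
  qed
  have conv: "(\<lambda>n. pd w (pd v f) (x + s n *\<^sub>R v + t n *\<^sub>R w)) \<longlonglongrightarrow> pd w (pd v f) x"
    if "s \<longlonglongrightarrow> 0" "t \<longlonglongrightarrow> 0" for s t :: "nat \<Rightarrow> real" and v w
  proof -
    have "(\<lambda>n. x + s n *\<^sub>R v + t n *\<^sub>R w) \<longlonglongrightarrow> x + 0 *\<^sub>R v + 0 *\<^sub>R w"
      by (intro tendsto_intros that)
    moreover have "isCont (pd w (pd v f)) x" using cont S x by (simp add: continuous_on_eq_continuous_at)
    ultimately show ?thesis using isCont_tendsto_compose[of x "pd w (pd v f)"] by simp
  qed
  \<comment> \<open>A null sequence of sizes for which the parallelograms stay inside the ball.\<close>
  define h where "h n = (r / 2) / (norm v + norm w + 1) * inverse (real (Suc n))" for n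
  have h0: "0 < h n" for n unfolding h_def using r by (auto intro!: mult_pos_pos divide_pos_pos add_nonneg_pos)
  have hr: "h n * (norm v + norm w) < r" for n
  proof -
    have P: "0 < norm v + norm w + 1" by (simp add: add_nonneg_pos)
    have "h n * (norm v + norm w) \<le> h n * (norm v + norm w + 1)" using h0[of n] by (intro mult_left_mono) auto
    also have "\<dots> = r / 2 * inverse (real (Suc n))" 
    proof -
      have "a / P * i * P = a * i" if "0 < P" for a P i :: real using that by simp
      from this[OF P] show ?thesis unfolding h_def .
    qed
    also have "\<dots> \<le> r / 2 * 1" using r by (intro mult_left_mono) (auto simp: field_simps)
    finally show ?thesis using r by simp
  qed
  have hlim: "h \<longlonglongrightarrow> 0"
    unfolding h_def by (rule tendsto_mult_right_zero) (rule LIMSEQ_inverse_real_of_nat)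
  obtain s1 t1 where 1: "\<And>n. 0 < s1 n \<and> s1 n < h n \<and> 0 < t1 n \<and> t1 n < h n \<and>
      f (x + h n *\<^sub>R v + h n *\<^sub>R w) - f (x + h n *\<^sub>R v) - f (x + h n *\<^sub>R w) + f x
        = h n * h n * pd w (pd v f) (x + s1 n *\<^sub>R v + t1 n *\<^sub>R w)"
    using key[OF h0 hr] by metis
  have hr': "h n * (norm w + norm v) < r" for n using hr[of n] by (simp add: add.commute)
  obtain s2 t2 where 2: "\<And>n. 0 < s2 n \<and> s2 n < h n \<and> 0 < t2 n \<and> t2 n < h n \<and>
      f (x + h n *\<^sub>R w + h n *\<^sub>R v) - f (x + h n *\<^sub>R w) - f (x + h n *\<^sub>R v) + f x
        = h n * h n * pd v (pd w f) (x + s2 n *\<^sub>R w + t2 n *\<^sub>R v)"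
    using key[OF h0 hr'] by metis
  have sq: "a \<longlonglongrightarrow> 0" if "\<And>n. 0 < a n \<and> a n < h n" for a
    by (rule tendsto_sandwich[OF _ _ tendsto_const hlim]) (use that in \<open>auto intro!: always_eventually less_imp_le\<close>)
  have "pd w (pd v f) (x + s1 n *\<^sub>R v + t1 n *\<^sub>R w) = pd v (pd w f) (x + s2 n *\<^sub>R w + t2 n *\<^sub>R v)" for n
  proof -
    have "h n * h n * pd w (pd v f) (x + s1 n *\<^sub>R v + t1 n *\<^sub>R w) = h n * h n * pd v (pd w f) (x + s2 n *\<^sub>R w + t2 n *\<^sub>R v)"
      using 1[of n] 2[of n] by (simp add: algebra_simps)
    then show ?thesis using h0[of n] by simp
  qed
  moreover have "(\<lambda>n. pd w (pd v f) (x + s1 n *\<^sub>R v + t1 n *\<^sub>R w)) \<longlonglongrightarrow> pd w (pd v f) x"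
    by (rule conv; rule sq) (use 1 in auto)
  moreover have "(\<lambda>n. pd v (pd w f) (x + s2 n *\<^sub>R w + t2 n *\<^sub>R v)) \<longlonglongrightarrow> pd v (pd w f) x"
    by (rule conv; rule sq) (use 2 in auto)
  ultimately show ?thesis using LIMSEQ_unique by fastforce
qed

lemma pd_linear_compose:
  assumes "bounded_linear L" "f differentiable at x"
  shows "pd v (\<lambda>x. L (f x)) x = L (pd v f x)"
  by (rule pd_eq, rule bounded_linear.has_derivative[OF assms(1) pd_works[OF assms(2)]])

lemma pd_commute:
  fixes f :: "'a::euclidean_space \<Rightarrow> 'b::euclidean_space"
  assumes S: "open S" and x: "x \<in> S" and f: "smooth_on S f"
  shows "pd v (pd w f) x = pd w (pd v f) x"
proof (rule euclidean_eqI)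
  fix b :: 'b assume "b \<in> Basis"
  have *: "pd v (pd w f) x \<bullet> b = pd v (pd w (\<lambda>y. f y \<bullet> b)) x" for v w
  proof -
    have "pd v (pd w (\<lambda>y. f y \<bullet> b)) x = pd v (\<lambda>y. pd w f y \<bullet> b) x"
      by (rule fun_cong[OF frechet_derivative_cong_open[OF S x]],
          rule pd_linear_compose[OF bounded_linear_inner_left smooth_on_differentiable[OF f S]])
    also have "\<dots> = pd v (pd w f) x \<bullet> b"
      by (rule pd_linear_compose[OF bounded_linear_inner_left smooth_on_differentiable[OF smooth_on_pd[OF f] S x]])
    finally show ?thesis by simp
  qed
  have "Ck_on 2 S (\<lambda>y. f y \<bullet> b)"
    using smooth_on_inner_left[OF S f] unfolding smooth_on_def by blast
  then show "pd v (pd w f) x \<bullet> b = pd w (pd v f) x \<bullet> b"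
    unfolding * by (rule pd_commute_real[OF S x])
qed

section \<open>Bump functions\<close>

text \<open>The family is closed under differentiation up to linear combinations, which makes the
  smoothness of \<open>exp (- 1 / t)\<close> at the origin an induction over all members at once.\<close>

definition flat_exp :: "nat \<Rightarrow> real \<Rightarrow> real" where
  "flat_exp m t = (if t > 0 then inverse t ^ m * exp (- inverse t) else 0)"

lemma flat_exp_tendsto_0: "((\<lambda>t. inverse t ^ m * exp (- inverse t)) \<longlongrightarrow> 0) (at_right (0::real))"
proof -
  have "((\<lambda>u::real. u ^ m / exp u) \<longlongrightarrow> 0) at_top" by (rule tendsto_power_div_exp_0)
  then have "((\<lambda>t::real. inverse t ^ m / exp (inverse t)) \<longlongrightarrow> 0) (at_right 0)"
    by (rule filterlim_compose) (rule filterlim_inverse_at_top_right)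
  then show ?thesis by (simp add: exp_minus divide_inverse)
qed

lemma flat_exp_deriv:
  "(flat_exp m has_real_derivative (flat_exp (m + 2) t - real m * flat_exp (m + 1) t)) (at t)"
proof (cases t "0::real" rule: linorder_cases)
  case less
  have "((\<lambda>t. 0) has_real_derivative 0) (at t)" by simp
  then have "(flat_exp m has_real_derivative 0) (at t)"
    by (rule has_field_derivative_transform_within_open[of _ _ _ "{..<0}"]) (use less in \<open>auto simp: flat_exp_def\<close>)
  then show ?thesis using less by (simp add: flat_exp_def)
next
  case greater
  have "((\<lambda>t. inverse t ^ m * exp (- inverse t)) has_real_derivative
      (flat_exp (m + 2) t - real m * flat_exp (m + 1) t)) (at t)"
  proof -
    have I: "(inverse has_real_derivative - (inverse t ^ 2)) (at t)"
      using DERIV_inverse[of t UNIV] greater by (simp add: numeral_2_eq_2)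
    have E: "((\<lambda>t. exp (- inverse t)) has_real_derivative exp (- inverse t) * (inverse t ^ 2)) (at t)"
      using DERIV_chain2[OF DERIV_exp DERIV_minus[OF I]] by simp
    have P: "((\<lambda>t. inverse t ^ m) has_real_derivative real m * (- (inverse t ^ 2) * inverse t ^ (m - Suc 0))) (at t)"
      by (rule DERIV_power[OF I])
    have *: "real m * (- (inverse t ^ 2) * inverse t ^ (m - Suc 0)) = - (real m * inverse t ^ (m + 1))"
      by (cases m) (simp_all add: power2_eq_square)
    show ?thesis using DERIV_mult[OF P E] greater unfolding *
      by (simp add: flat_exp_def power_add algebra_simps power2_eq_square)
  qed
  then show ?thesis
    by (rule has_field_derivative_transform_within_open[of _ _ _ "{0<..}"]) (use greater in \<open>auto simp: flat_exp_def\<close>)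
next
  case equal
  have l: "((\<lambda>y. (flat_exp m y - flat_exp m 0) / (y - 0)) \<longlongrightarrow> 0) (at_left 0)"
    by (rule tendsto_eventually) (auto simp: flat_exp_def eventually_at_left_field intro!: exI[of _ "-1"])
  have "((\<lambda>y. inverse y ^ (m+1) * exp (- inverse y)) \<longlongrightarrow> 0) (at_right (0::real))"
    by (rule flat_exp_tendsto_0)
  then have r: "((\<lambda>y. (flat_exp m y - flat_exp m 0) / (y - 0)) \<longlongrightarrow> 0) (at_right 0)"
    by (rule Lim_transform_eventually)
       (auto simp: flat_exp_def eventually_at_right_field divide_inverse intro!: exI[of _ "1"])
  have "((\<lambda>y. (flat_exp m y - flat_exp m 0) / (y - 0)) \<longlongrightarrow> 0) (at 0)"
    using l r by (simp add: filterlim_split_at)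
  then show ?thesis using equal by (simp add: has_field_derivative_iff flat_exp_def)
qed

lemma smooth_flat_exp: "smooth_on UNIV (flat_exp m)"
proof -
  have "Ck_on k UNIV (flat_exp m)" for k
  proof (induction k arbitrary: m)
    case 0
    have "isCont (flat_exp m) t" for t by (rule DERIV_isCont[OF flat_exp_deriv])
    then show ?case by (simp add: continuous_on_eq_continuous_at)
  next
    case (Suc k)
    have D: "(flat_exp m has_derivative (\<lambda>v. (flat_exp (m + 2) t - real m * flat_exp (m + 1) t) * v)) (at t)" for t
      using flat_exp_deriv[of m t] by (simp add: has_field_derivative_def)
    then have "pd v (flat_exp m) = (\<lambda>t. (flat_exp (m + 2) t + (- real m) * flat_exp (m + 1) t) * v)" for v
      by (auto intro!: pd_eq[THEN trans])
    moreover have "Ck_on k UNIV (\<lambda>t. (flat_exp (m + 2) t + (- real m) * flat_exp (m + 1) t) * v)" for v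
      by (intro Ck_on_bilinear[OF _ bounded_bilinear_mult] Ck_on_add Ck_on_const Suc.IH open_UNIV)
    ultimately show ?case using D by (auto simp: differentiable_on_open differentiable_def)
  qed
  then show ?thesis by (simp add: smooth_on_def)
qed

lemma bump_function_exists:
  fixes y0 :: "'a::euclidean_space"
  assumes "r > 0"
  obtains chi :: "'a \<Rightarrow> complex" where "smooth_on UNIV chi" "chi y0 = 1" "\<And>y. y \<notin> cball y0 r \<Longrightarrow> chi y = 0"
proof
  define q where "q y = r^2 - (y - y0) \<bullet> (y - y0)" for y
  let ?c = "flat_exp 0 (r^2)"
  have c: "?c \<noteq> 0" using assms by (simp add: flat_exp_def)
  define chi where "chi = (\<lambda>y. complex_of_real (flat_exp 0 (q y)) * complex_of_real (inverse ?c))"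
  have q: "smooth_on UNIV q"
    unfolding q_def
    by (intro smooth_on_diff smooth_on_const open_UNIV smooth_on_bilinear[OF _ bounded_bilinear_inner] smooth_on_ident)
  show "smooth_on UNIV chi"
    unfolding chi_def
    by (intro smooth_on_mult smooth_on_const smooth_on_of_real open_UNIV
        smooth_on_compose[OF open_UNIV open_UNIV _ smooth_flat_exp q]) auto
  show "chi y0 = 1" using c by (simp add: chi_def q_def flip: of_real_mult)
  fix y assume "y \<notin> cball y0 r"
  then have "r < norm (y - y0)" by (simp add: dist_norm norm_minus_commute)
  then have "r^2 < (norm (y - y0))^2" using assms by (intro power_strict_mono) auto
  then have "q y < 0" by (simp add: q_def power2_norm_eq_inner)
  then show "chi y = 0" by (simp add: chi_def flat_exp_def)
qed

section \<open>Linear algebra modulo a subspace\<close>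

text \<open>Linear independence of the images in the quotient by \<open>W\<close>. Indexed families avoid
  the question whether different indices give equal vectors.\<close>

definition independent_modulo ::
  "('c::zero \<Rightarrow> 'b \<Rightarrow> 'b) \<Rightarrow> 'b::comm_monoid_add set \<Rightarrow> 'i set \<Rightarrow> ('i \<Rightarrow> 'b) \<Rightarrow> bool" where
  "independent_modulo smul W I b \<longleftrightarrow>
     (\<forall>c :: 'i \<Rightarrow> 'c. (\<Sum>i\<in>I. smul (c i) (b i)) \<in> W \<longrightarrow> (\<forall>i\<in>I. c i = 0))"

context vector_space
begin

text \<open>Steinitz's inequality in the quotient by \<open>W\<close>. Approximations \<open>t i\<close> of the vectors \<open>b i\<close>
  modulo \<open>W\<close> inherit independence, so the inequality for the span of \<open>T\<close> applies to them.\<close>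

lemma card_le_if_independent_modulo:
  assumes W: "subspace W" and I: "finite I" and T: "finite T"
    and ind: "independent_modulo scale W I b"
    and span: "\<And>i. i \<in> I \<Longrightarrow> \<exists>t\<in>span T. b i - t \<in> W"
  shows "card I \<le> card T"
proof -
  obtain t where t: "\<And>i. i \<in> I \<Longrightarrow> t i \<in> span T" "\<And>i. i \<in> I \<Longrightarrow> b i - t i \<in> W"
    using span by metis
  have t0: "\<forall>i\<in>I. c i = 0" if "(\<Sum>i\<in>I. scale (c i) (t i)) = 0" for c
  proof -
    have "(\<Sum>i\<in>I. scale (c i) (b i)) = (\<Sum>i\<in>I. scale (c i) (b i - t i))"
      using that by (simp add: scale_right_diff_distrib sum_subtractf)
    also have "\<dots> \<in> W" using t(2) W by (intro subspace_sum subspace_scale) auto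
    finally show ?thesis using ind unfolding independent_modulo_def by blast
  qed
  have inj: "inj_on t I"
  proof (rule inj_onI, rule ccontr)
    fix i j assume ij: "i \<in> I" "j \<in> I" "t i = t j" "i \<noteq> j"
    let ?c = "\<lambda>l. if l = i then 1 else if l = j then - 1 else 0"
    have "(\<Sum>l\<in>I. scale (?c l) (t l)) = (\<Sum>l\<in>I. (if l = i then t l else 0) - (if l = j then t l else 0))"
      using ij(4) by (intro sum.cong) auto
    also have "\<dots> = 0" using ij I by (simp add: sum_subtractf)
    finally show False using t0[of ?c] ij(1) by (auto split: if_splits)
  qed
  have "independent (t ` I)"
  proof
    assume "dependent (t ` I)"
    then obtain u v where uv: "v \<in> t ` I" "u v \<noteq> 0" "(\<Sum>w\<in>t ` I. scale (u w) w) = 0"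
      using dependent_finite[of "t ` I"] I by auto
    then show False using t0[of "\<lambda>i. u (t i)"] inj by (auto simp: sum.reindex)
  qed
  moreover have "t ` I \<subseteq> span T" using t(1) by auto
  ultimately show ?thesis using independent_span_bound[OF T] card_image[OF inj] by fastforce
qed

text \<open>A basis of a finite dimensional quotient \<open>G / W\<close>, as a maximal independent family.\<close>

lemma maximal_independent_modulo:
  assumes W: "subspace W" and G: "subspace G"
    and bound: "\<And>T. finite T \<Longrightarrow> T \<subseteq> G \<Longrightarrow> independent_modulo scale W T id \<Longrightarrow> card T \<le> N"
  obtains T where "finite T" "T \<subseteq> G" "independent_modulo scale W T id" "\<And>g. g \<in> G \<Longrightarrow> \<exists>t\<in>span T. g - t \<in> W"
proof -
  let ?P = "\<lambda>T. finite T \<and> T \<subseteq> G \<and> independent_modulo scale W T id"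
  have "?P {}" by (simp add: independent_modulo_def)
  moreover have "\<forall>T. ?P T \<longrightarrow> card T < Suc N" using bound by (simp add: less_Suc_eq_le)
  ultimately have "\<exists>T. ?P T \<and> (\<forall>T'. ?P T' \<longrightarrow> card T' \<le> card T)"
    by (rule ex_has_greatest_nat)
  then obtain T where T: "?P T" and max: "\<And>T'. ?P T' \<Longrightarrow> card T' \<le> card T"
    by (elim exE conjE) simp
  have "\<exists>t\<in>span T. g - t \<in> W" if g: "g \<in> G" for g
  proof (rule ccontr)
    assume no: "\<not> (\<exists>t\<in>span T. g - t \<in> W)"
    have gT: "g \<notin> T" using no span_base[of g T] subspace_0[OF W] by force
    have "independent_modulo scale W (insert g T) id"
      unfolding independent_modulo_def
    proof (intro allI impI)
      fix c assume "(\<Sum>i\<in>insert g T. scale (c i) (id i)) \<in> W"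
      then have c: "scale (c g) g + (\<Sum>i\<in>T. scale (c i) i) \<in> W" using T gT by simp
      show "\<forall>i\<in>insert g T. c i = 0"
      proof (cases "c g = 0")
        case True
        then show ?thesis using c T unfolding independent_modulo_def by simp
      next
        case False
        let ?t = "- (\<Sum>i\<in>T. scale (c i / c g) i)"
        have "?t \<in> span T" by (intro span_neg span_sum span_scale span_base)
        moreover have "scale (inverse (c g)) (scale (c g) g + (\<Sum>i\<in>T. scale (c i) i)) = g - ?t"
          using False by (simp add: scale_right_distrib scale_sum_right divide_inverse mult.commute)
        then have "g - ?t \<in> W" using subspace_scale[OF W c, of "inverse (c g)"] by simp
        ultimately show ?thesis using no by blast
      qed
    qed
    then have "card (insert g T) \<le> card T" using max T g by simp
    then show False using T gT by simp
  qed
  then show thesis using that T by blast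
qed

end

text \<open>The pointwise scalar multiplication on functions with an arbitrary domain: forms, functions
  on a chart and covector fields on a chart all become instances of one vector space.\<close>

definition fscale :: "complex \<Rightarrow> ('i \<Rightarrow> complex) \<Rightarrow> 'i \<Rightarrow> complex" where
  "fscale a f = (\<lambda>i. a * f i)"

lemma cscale_eq_fscale: "cscale = fscale"
  by (simp add: fun_eq_iff cscale_def fscale_def)

interpretation fs: vector_space fscale
  by unfold_locales (auto simp: fscale_def fun_eq_iff algebra_simps)

lemma sum_fun_apply: "(\<Sum>i\<in>I. f i) x = (\<Sum>i\<in>I. f i (x::'a) :: 'b::comm_monoid_add)"
  by (induction I rule: infinite_finite_induct) auto

lemma fscale_linear_combination:
  "(\<Sum>i\<in>I. fscale (c i) (f i)) = (\<lambda>x. \<Sum>i\<in>I. c i * f i x)"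
  by (simp add: fun_eq_iff sum_fun_apply fscale_def)

section \<open>Jets of functions at a point\<close>

lemma pd_add:
  "f differentiable at x \<Longrightarrow> g differentiable at x \<Longrightarrow> pd v (\<lambda>x. f x + g x) x = pd v f x + pd v g x"
  by (rule pd_eq, rule has_derivative_add) (auto intro: pd_works)

lemma pd_mult:
  fixes f g :: "'a::euclidean_space \<Rightarrow> complex"
  shows "f differentiable at x \<Longrightarrow> g differentiable at x \<Longrightarrow>
    pd v (\<lambda>x. f x * g x) x = f x * pd v g x + pd v f x * g x"
  by (rule pd_eq, rule has_derivative_mult) (auto intro: pd_works)

lemma pd_const: "pd v (\<lambda>x. c) x = 0"
  by (auto intro!: pd_eq derivative_eq_intros)

lemma pd_cmult:
  fixes f :: "'a::euclidean_space \<Rightarrow> complex"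
  shows "f differentiable at x \<Longrightarrow> pd v (\<lambda>x. c * f x) x = c * pd v f x"
  using pd_mult[of "\<lambda>x. c" x f v] pd_const[of c x v] by simp

lemma pd_sum:
  assumes "\<And>i. i \<in> I \<Longrightarrow> f i differentiable at x"
  shows "pd v (\<lambda>x. \<Sum>i\<in>I. f i x) x = (\<Sum>i\<in>I. pd v (f i) x)"
  by (rule pd_eq, rule has_derivative_sum) (auto intro: pd_works assms)

text \<open>All derivatives of order at most \<open>k\<close> vanish at the point \<open>y\<close>.\<close>

fun vanishes_to_order :: "'a::euclidean_space \<Rightarrow> nat \<Rightarrow> ('a \<Rightarrow> complex) \<Rightarrow> bool" where
  "vanishes_to_order y 0 f \<longleftrightarrow> f y = 0"
| "vanishes_to_order y (Suc k) f \<longleftrightarrow> f y = 0 \<and> (\<forall>v. vanishes_to_order y k (pd v f))"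

lemma vanishes_to_order_imp_zero: "vanishes_to_order y k f \<Longrightarrow> f y = 0"
  by (cases k) auto

lemma vanishes_to_order_cong:
  assumes "open S" "y \<in> S" "\<And>x. x \<in> S \<Longrightarrow> f x = g x"
  shows "vanishes_to_order y k f \<longleftrightarrow> vanishes_to_order y k g"
  using assms(3)
proof (induction k arbitrary: f g)
  case (Suc k)
  have "vanishes_to_order y k (pd v f) \<longleftrightarrow> vanishes_to_order y k (pd v g)" for v
    by (rule Suc.IH, rule fun_cong[OF frechet_derivative_cong_open[OF assms(1)]]) (auto intro: Suc.prems)
  then show ?case using Suc.prems[OF assms(2)] by simp
qed (use assms in simp)

lemma vanishes_to_order_Suc_imp: "vanishes_to_order y (Suc k) f \<Longrightarrow> vanishes_to_order y k f"
proof (induction k arbitrary: f)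
  case (Suc k)
  have "vanishes_to_order y k (pd v f)" for v
    using Suc.prems by (intro Suc.IH) simp
  then show ?case using Suc.prems by simp
qed simp

lemma vanishes_to_order_zero: "vanishes_to_order y k (\<lambda>x. 0)"
proof (induction k)
  case (Suc k)
  then show ?case by (simp add: pd_const)
qed simp

definition smooth_functions :: "'a::euclidean_space set \<Rightarrow> ('a \<Rightarrow> complex) set" where
  "smooth_functions S = {f. smooth_on S f}"

definition flat_functions :: "'a::euclidean_space set \<Rightarrow> 'a \<Rightarrow> nat \<Rightarrow> ('a \<Rightarrow> complex) set" where
  "flat_functions S y k = {f. smooth_on S f \<and> vanishes_to_order y k f}"

context
  fixes S :: "'a::euclidean_space set" and y :: 'a
  assumes S: "open S" and y: "y \<in> S"
begin

lemma vanishes_to_order_add: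
  assumes "smooth_on S f" "smooth_on S g" "vanishes_to_order y k f" "vanishes_to_order y k g"
  shows "vanishes_to_order y k (\<lambda>x. f x + g x)"
  using assms
proof (induction k arbitrary: f g)
  case (Suc k)
  have "vanishes_to_order y k (pd v (\<lambda>x. f x + g x))" for v
  proof -
    have "vanishes_to_order y k (\<lambda>x. pd v f x + pd v g x)"
      using Suc.prems by (intro Suc.IH smooth_on_pd) auto
    then show ?thesis
      by (subst vanishes_to_order_cong[OF S y])
         (auto intro!: pd_add smooth_on_differentiable[OF _ S] Suc.prems)
  qed
  then show ?case using Suc.prems by simp
qed simp

lemma vanishes_to_order_mult:
  assumes "smooth_on S f" "smooth_on S g" "vanishes_to_order y k g"
  shows "vanishes_to_order y k (\<lambda>x. f x * g x)"
  using assms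
proof (induction k arbitrary: f g)
  case (Suc k)
  have "vanishes_to_order y k (pd v (\<lambda>x. f x * g x))" for v
  proof -
    have "vanishes_to_order y k (\<lambda>x. f x * pd v g x + pd v f x * g x)"
      using Suc.prems vanishes_to_order_Suc_imp[OF Suc.prems(3)]
      by (intro vanishes_to_order_add Suc.IH smooth_on_pd smooth_on_mult[OF S]) auto
    then show ?thesis
      by (subst vanishes_to_order_cong[OF S y])
         (auto intro!: pd_mult smooth_on_differentiable[OF _ S] Suc.prems)
  qed
  then show ?case using Suc.prems by simp
qed simp

lemma vanishes_to_order_sum:
  assumes "finite I" "\<And>i. i \<in> I \<Longrightarrow> smooth_on S (f i)" "\<And>i. i \<in> I \<Longrightarrow> vanishes_to_order y k (f i)"
  shows "vanishes_to_order y k (\<lambda>x. \<Sum>i\<in>I. f i x)"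
  using assms
  by (induction I rule: finite_induct)
     (auto intro!: vanishes_to_order_add smooth_on_sum S simp: vanishes_to_order_zero)

text \<open>A matrix of functions that is the identity at the point is invertible on jets: the derivative of the
  system is again such a system for the derivatives of the unknowns, up to terms that vanish by the
  induction hypothesis.\<close>

lemma vanishes_to_order_linear_system:
  assumes I: "finite I" and A: "\<And>i j. i \<in> I \<Longrightarrow> j \<in> I \<Longrightarrow> smooth_on S (A i j)"
    and A0: "\<And>i j. i \<in> I \<Longrightarrow> j \<in> I \<Longrightarrow> A i j y = (if i = j then 1 else 0)"
    and "\<And>j. j \<in> I \<Longrightarrow> smooth_on S (g j)"
    and "\<And>i. i \<in> I \<Longrightarrow> vanishes_to_order y k (\<lambda>x. \<Sum>j\<in>I. A i j x * g j x)"
    and "j \<in> I"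
  shows "vanishes_to_order y k (g j)"
  using assms(4-)
proof (induction k arbitrary: g j)
  case 0
  have "(\<Sum>l\<in>I. A j l y * g l y) = (\<Sum>l\<in>I. if l = j then g l y else 0)"
    using A0 0(3) by (intro sum.cong) auto
  then show ?case using 0 I by simp
next
  case (Suc k)
  note g = Suc.prems(1)
  have vk: "vanishes_to_order y k (g j)" if "j \<in> I" for j
    by (rule Suc.IH[OF g vanishes_to_order_Suc_imp[OF Suc.prems(2)] that])
  have "vanishes_to_order y k (pd v (g j))" for v
  proof (rule Suc.IH)
    fix i assume i: "i \<in> I"
    have "pd v (\<lambda>x. \<Sum>j\<in>I. A i j x * g j x) x = (\<Sum>j\<in>I. A i j x * pd v (g j) x + pd v (A i j) x * g j x)"
      if "x \<in> S" for x
    proof -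
      have "pd v (\<lambda>x. \<Sum>j\<in>I. A i j x * g j x) x = (\<Sum>j\<in>I. pd v (\<lambda>x. A i j x * g j x) x)"
        by (rule pd_sum) (use i that g A S in \<open>auto intro!: smooth_on_differentiable[OF smooth_on_mult] \<close>)
      also have "\<dots> = (\<Sum>j\<in>I. A i j x * pd v (g j) x + pd v (A i j) x * g j x)"
        by (intro sum.cong refl pd_mult) (use i that g A S in \<open>auto intro!: smooth_on_differentiable\<close>)
      finally show ?thesis .
    qed
    moreover have "vanishes_to_order y k (pd v (\<lambda>x. \<Sum>j\<in>I. A i j x * g j x))"
      using Suc.prems(2)[OF i] by simp
    ultimately have 1: "vanishes_to_order y k (\<lambda>x. \<Sum>j\<in>I. A i j x * pd v (g j) x + pd v (A i j) x * g j x)"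
      using vanishes_to_order_cong[OF S y, of "pd v (\<lambda>x. \<Sum>j\<in>I. A i j x * g j x)"] by simp
    have 2: "vanishes_to_order y k (\<lambda>x. \<Sum>j\<in>I. (- pd v (A i j) x) * g j x)"
      by (intro vanishes_to_order_sum I smooth_on_mult[OF S] vanishes_to_order_mult smooth_on_uminus[OF S]
          smooth_on_pd A g vk i)
    have "vanishes_to_order y k (\<lambda>x. (\<Sum>j\<in>I. A i j x * pd v (g j) x + pd v (A i j) x * g j x)
        + (\<Sum>j\<in>I. (- pd v (A i j) x) * g j x))"
      by (intro vanishes_to_order_add 1 2 smooth_on_sum[OF S] I smooth_on_add[OF S] smooth_on_mult[OF S]
          smooth_on_uminus[OF S] smooth_on_pd A g i)
    then show "vanishes_to_order y k (\<lambda>x. \<Sum>j\<in>I. A i j x * pd v (g j) x)"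
      by (simp add: sum.distrib sum_negf)
  qed (use g Suc.prems(3) in \<open>auto intro: smooth_on_pd\<close>)
  then show ?case using vk[OF Suc.prems(3)] vanishes_to_order_imp_zero by auto
qed

lemma smooth_on_iterated_pd: "smooth_on S f \<Longrightarrow> smooth_on S (foldr pd ws f)"
  by (induction ws) (auto intro: smooth_on_pd)

lemma vanishes_to_order_if_basis_words:
  assumes "smooth_on S f"
    and "\<And>ws. set ws \<subseteq> Basis \<Longrightarrow> length ws \<le> k \<Longrightarrow> foldr pd ws f y = 0"
  shows "vanishes_to_order y k f"
  using assms
proof (induction k arbitrary: f)
  case 0
  then show ?case using "0.prems"(2)[of "[]"] by simp
next
  case (Suc k)
  have b: "vanishes_to_order y k (pd b f)" if "b \<in> Basis" for b
  proof (rule Suc.IH)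
    fix ws :: "'a list" assume "set ws \<subseteq> Basis" "length ws \<le> k"
    then show "foldr pd ws (pd b f) y = 0"
      using Suc.prems(2)[of "ws @ [b]"] that by simp
  qed (use Suc.prems in \<open>auto intro: smooth_on_pd\<close>)
  have "vanishes_to_order y k (pd v f)" for v
  proof -
    have "vanishes_to_order y k (\<lambda>x. \<Sum>b\<in>Basis. complex_of_real (v \<bullet> b) * pd b f x)"
      by (intro vanishes_to_order_sum smooth_on_mult[OF S] vanishes_to_order_mult smooth_on_const[OF S]
          smooth_on_pd Suc.prems b finite_Basis)
    then show ?thesis
      by (subst vanishes_to_order_cong[OF S y])
         (auto simp: pd_expand_basis[OF smooth_on_differentiable[OF Suc.prems(1) S]] scaleR_conv_of_real)
  qed
  then show ?case using Suc.prems(2)[of "[]"] by simp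
qed

text \<open>Iterated derivatives are indexed by words in the directions; this and the next lemma show that only the multiset
  of the letters matters.\<close>

lemma iterated_pd_move:
  assumes "smooth_on S f" "x \<in> S"
  shows "foldr pd (xs @ a # ys) f x = foldr pd (a # xs @ ys) f x"
  using assms(2)
proof (induction xs arbitrary: x)
  case (Cons b xs)
  have "pd b (foldr pd (xs @ a # ys) f) x = pd b (foldr pd (a # xs @ ys) f) x"
    by (rule fun_cong[OF frechet_derivative_cong_open[OF S Cons.prems]]) (rule Cons.IH)
  also have "\<dots> = pd b (pd a (foldr pd (xs @ ys) f)) x" by simp
  also have "\<dots> = pd a (pd b (foldr pd (xs @ ys) f)) x"
    by (rule pd_commute[OF S Cons.prems smooth_on_iterated_pd[OF assms(1)]])
  finally show ?case by simp
qed simp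

lemma iterated_pd_mset:
  assumes "smooth_on S f" "mset ws = mset ws'" "x \<in> S"
  shows "foldr pd ws f x = foldr pd ws' f x"
  using assms(2,3)
proof (induction ws arbitrary: ws' x)
  case (Cons a ws)
  then have "a \<in> set ws'" by (metis list.set_intros(1) set_mset_mset)
  then obtain xs ys where ws': "ws' = xs @ a # ys" by (meson split_list)
  then have "mset ws = mset (xs @ ys)" using Cons.prems(1) by simp
  from Cons.IH[OF this] have "pd a (foldr pd ws f) x = pd a (foldr pd (xs @ ys) f) x"
    by (intro fun_cong[OF frechet_derivative_cong_open[OF S Cons.prems(2)]]) auto
  then show ?case using iterated_pd_move[OF assms(1) Cons.prems(2)] ws' by simp
qed simp

lemma iterated_pd_linear_combination:
  fixes f :: "'t \<Rightarrow> 'a \<Rightarrow> complex"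
  assumes T: "finite T" "\<And>t. t \<in> T \<Longrightarrow> smooth_on S (f t)" and "x \<in> S"
  shows "foldr pd ws (\<lambda>x. \<Sum>t\<in>T. c t * f t x) x = (\<Sum>t\<in>T. c t * foldr pd ws (f t) x)"
  using assms(3)
proof (induction ws arbitrary: x)
  case (Cons a ws)
  have d: "foldr pd ws (f t) differentiable at x" if "t \<in> T" for t
    by (rule smooth_on_differentiable[OF smooth_on_iterated_pd[OF T(2)[OF that]] S Cons.prems])
  have "pd a (foldr pd ws (\<lambda>x. \<Sum>t\<in>T. c t * f t x)) x = pd a (\<lambda>x. \<Sum>t\<in>T. c t * foldr pd ws (f t) x) x"
    by (rule fun_cong[OF frechet_derivative_cong_open[OF S Cons.prems]]) (rule Cons.IH)
  also have "\<dots> = (\<Sum>t\<in>T. pd a (\<lambda>x. c t * foldr pd ws (f t) x) x)"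
    by (rule pd_sum, rule smooth_on_differentiable[OF smooth_on_mult[OF S smooth_on_const[OF S] smooth_on_iterated_pd[OF T(2)]] S Cons.prems])
  also have "\<dots> = (\<Sum>t\<in>T. c t * pd a (foldr pd ws (f t)) x)"
    by (intro sum.cong refl pd_cmult d)
  finally show ?case by simp
qed simp

lemma subspace_smooth_functions: "fs.subspace (smooth_functions S)"
  unfolding smooth_functions_def
  by (rule fs.subspaceI)
     (auto simp: fscale_def zero_fun_def plus_fun_def intro!: smooth_on_const S smooth_on_add smooth_on_mult)

lemma subspace_flat_functions: "fs.subspace (flat_functions S y k)"
  unfolding flat_functions_def
  by (rule fs.subspaceI)
     (auto simp: fscale_def zero_fun_def plus_fun_def vanishes_to_order_zero
       intro!: smooth_on_const S smooth_on_add smooth_on_mult vanishes_to_order_add vanishes_to_order_mult)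

text \<open>There are polynomially many multisets of size at most \<open>k\<close>, while the number of words
  grows exponentially. This is where the symmetry of second derivatives pays off.\<close>

lemma card_small_multisets:
  "finite {M :: 'a multiset. set_mset M \<subseteq> Basis \<and> size M \<le> k}"
  "card {M :: 'a multiset. set_mset M \<subseteq> Basis \<and> size M \<le> k} \<le> (k + 1) ^ DIM('a)"
proof -
  let ?I = "{M :: 'a multiset. set_mset M \<subseteq> Basis \<and> size M \<le> k}"
  let ?h = "\<lambda>M::'a multiset. restrict (count M) Basis"
  have inj: "inj_on ?h ?I"
  proof (rule inj_onI)
    fix M N assume MN: "M \<in> ?I" "N \<in> ?I" "?h M = ?h N"
    show "M = N"
    proof (rule multiset_eqI)
      fix a show "count M a = count N a"
      proof (cases "a \<in> Basis")
        case True then show ?thesis using fun_cong[OF MN(3), of a] by simp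
      next
        case False then show ?thesis using MN by (metis (mono_tags, lifting) count_eq_zero_iff mem_Collect_eq subsetD)
      qed
    qed
  qed
  have im: "?h ` ?I \<subseteq> PiE Basis (\<lambda>_. {..k})"
    using count_le_size le_trans by fastforce
  have fin: "finite (PiE (Basis :: 'a set) (\<lambda>_. {..k}))" by (intro finite_PiE) auto
  show "finite ?I" using finite_imageD[OF finite_subset[OF im fin] inj] .
  have "card ?I \<le> card (PiE (Basis :: 'a set) (\<lambda>_. {..k}))" by (rule card_inj_on_le[OF inj im fin])
  then show "card ?I \<le> (k + 1) ^ DIM('a)" by (simp add: card_PiE)
qed

text \<open>The upper bound on the dimension of the space of \<open>k\<close>-jets: a function is flat once its partial derivatives indexed by
  multisets vanish at the point, so independent jets stay independent as vectors of these derivatives.\<close>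

lemma card_independent_modulo_flat:
  assumes T: "finite T" "T \<subseteq> smooth_functions S"
    and ind: "independent_modulo fscale (flat_functions S y k) T id"
  shows "card T \<le> (k + 1) ^ DIM('a)"
proof -
  let ?I = "{M :: 'a multiset. set_mset M \<subseteq> Basis \<and> size M \<le> k}"
  define word where "word M = (SOME ws. mset ws = M)" for M :: "'a multiset"
  have word: "mset (word M) = M" for M unfolding word_def by (rule someI_ex) (rule ex_mset)
  define jet where "jet f = (\<lambda>M. if M \<in> ?I then foldr pd (word M) f y else 0)" for f :: "'a \<Rightarrow> complex"
  let ?\<delta> = "\<lambda>M N. if N = M then 1 else (0::complex)"
  have "card T \<le> card (?\<delta> ` ?I)"
  proof (rule fs.card_le_if_independent_modulo[where W = "{0}" and b = jet])
    show "fs.subspace {0}" by (simp add: fs.subspace_single_0)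
    show "finite (?\<delta> ` ?I)" using card_small_multisets by auto
    show "independent_modulo fscale {0} T jet"
      unfolding independent_modulo_def
    proof (intro allI impI)
      fix c assume 0: "(\<Sum>t\<in>T. fscale (c t) (jet t)) \<in> {0}"
      let ?f = "\<lambda>x. \<Sum>t\<in>T. c t * t x"
      have sm: "smooth_on S ?f"
        using T unfolding smooth_functions_def by (intro smooth_on_sum smooth_on_mult smooth_on_const S) auto
      have "foldr pd ws ?f y = 0" if ws: "set ws \<subseteq> Basis" "length ws \<le> k" for ws
      proof -
        have "foldr pd ws ?f y = foldr pd (word (mset ws)) ?f y"
          by (rule iterated_pd_mset[OF sm _ y]) (simp add: word)
        also have "\<dots> = (\<Sum>t\<in>T. c t * foldr pd (word (mset ws)) t y)"
          by (rule iterated_pd_linear_combination[OF T(1) _ y]) (use T in \<open>auto simp: smooth_functions_def\<close>)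
        also have "\<dots> = (\<Sum>t\<in>T. fscale (c t) (jet t)) (mset ws)"
          using ws by (simp add: sum_fun_apply fscale_def jet_def)
        also have "\<dots> = 0" using 0 by simp
        finally show ?thesis .
      qed
      then have "vanishes_to_order y k ?f" by (rule vanishes_to_order_if_basis_words[OF sm])
      then have "(\<Sum>t\<in>T. fscale (c t) (id t)) \<in> flat_functions S y k"
        using sm by (simp add: flat_functions_def fscale_linear_combination)
      then show "\<forall>t\<in>T. c t = 0" using ind unfolding independent_modulo_def by blast
    qed
    fix f
    have "jet f = (\<Sum>M\<in>?I. fscale (jet f M) (?\<delta> M))"
    proof
      fix N
      have "(\<Sum>M\<in>?I. fscale (jet f M) (?\<delta> M)) N = (\<Sum>M\<in>?I. if M = N then jet f N else 0)"
        by (auto simp: sum_fun_apply fscale_def intro!: sum.cong)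
      then show "jet f N = (\<Sum>M\<in>?I. fscale (jet f M) (?\<delta> M)) N"
        using card_small_multisets(1)[of k] by (simp add: jet_def)
    qed
    also have "\<dots> \<in> fs.span (?\<delta> ` ?I)" by (intro fs.span_sum fs.span_scale fs.span_base) auto
    finally show "\<exists>t\<in>fs.span (?\<delta> ` ?I). jet f - t \<in> {0}" by auto
  qed (use T in auto)
  also have "\<dots> \<le> card ?I" by (intro card_image_le card_small_multisets)
  also have "\<dots> \<le> (k + 1) ^ DIM('a)" by (rule card_small_multisets)
  finally show ?thesis .
qed

text \<open>The lower bound on the dimension of the space of \<open>k\<close>-jets. Differentiating a linear combination of powers of a
  coordinate shifts the coefficients.\<close>

lemma powers_independent_modulo_flat:
  fixes k :: nat
  assumes b: "b \<in> Basis"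
  defines "l \<equiv> \<lambda>x. complex_of_real ((x - y) \<bullet> b)"
  shows "\<And>j. smooth_on S (\<lambda>x. l x ^ j)"
    and "independent_modulo fscale (flat_functions S y k) {..k} (\<lambda>j x. l x ^ j)"
proof -
  have l: "smooth_on S l"
    unfolding l_def by (intro smooth_on_of_real smooth_on_inner_left smooth_on_diff smooth_on_ident smooth_on_const S)
  have lj: "smooth_on S (\<lambda>x. l x ^ j)" for j
    by (induction j) (auto intro: smooth_on_const smooth_on_mult S l)
  then show "\<And>j. smooth_on S (\<lambda>x. l x ^ j)" .
  have dl: "(l has_derivative (\<lambda>v. complex_of_real (v \<bullet> b))) (at x)" for x
    unfolding l_def by (auto intro!: derivative_eq_intros)
  have dlj: "pd b (\<lambda>x. l x ^ Suc j) x = of_nat (Suc j) * l x ^ j" for j x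
    using pd_eq[OF has_derivative_power[OF dl, of "Suc j" x], of b] b by simp
  have "\<forall>j\<le>k. c j = 0" if "vanishes_to_order y k (\<lambda>x. \<Sum>j\<le>k. c j * l x ^ j)" for c
    using that
  proof (induction k arbitrary: c)
    case 0
    then show ?case by simp
  next
    case (Suc k)
    let ?f = "\<lambda>x. \<Sum>j\<le>Suc k. c j * l x ^ j"
    have "pd b ?f x = (\<Sum>j\<le>k. (c (Suc j) * of_nat (Suc j)) * l x ^ j)" if x: "x \<in> S" for x
    proof -
      have d: "(\<lambda>x. l x ^ j) differentiable at x" for j by (rule smooth_on_differentiable[OF lj S x])
      have "pd b ?f x = (\<Sum>j\<le>Suc k. pd b (\<lambda>x. c j * l x ^ j) x)"
        by (rule pd_sum, rule smooth_on_differentiable[OF smooth_on_mult[OF S smooth_on_const[OF S] lj] S x])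
      also have "\<dots> = (\<Sum>j\<le>Suc k. c j * pd b (\<lambda>x. l x ^ j) x)"
        by (intro sum.cong refl pd_cmult d)
      also have "\<dots> = (\<Sum>j\<le>k. c (Suc j) * pd b (\<lambda>x. l x ^ Suc j) x)"
        unfolding sum.atMost_Suc_shift by (simp add: pd_const)
      finally show ?thesis by (simp only: dlj mult.assoc)
    qed
    moreover have "vanishes_to_order y k (pd b ?f)" using Suc.prems by simp
    ultimately have "vanishes_to_order y k (\<lambda>x. \<Sum>j\<le>k. (c (Suc j) * of_nat (Suc j)) * l x ^ j)"
      using vanishes_to_order_cong[OF S y, of "pd b ?f"] by simp
    from Suc.IH[OF this] have "c (Suc j) = 0" if "j \<le> k" for j
      using that by (auto simp del: of_nat_Suc)
    moreover have "c 0 = 0"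
      using vanishes_to_order_imp_zero[OF Suc.prems] by (simp add: sum.atMost_Suc_shift l_def del: sum.atMost_Suc)
    ultimately show ?case by (metis Suc_le_mono not0_implies_Suc)
  qed
  then show "independent_modulo fscale (flat_functions S y k) {..k} (\<lambda>j x. l x ^ j)"
    unfolding independent_modulo_def flat_functions_def
    by (auto simp: fscale_linear_combination)
qed

text \<open>The set \<open>T k\<close> is a basis of the space of \<open>k\<close>-jets, represented by functions.\<close>

lemma jet_spaces:
  obtains T where "\<And>k. finite (T k)" "\<And>k. T k \<subseteq> smooth_functions S"
    "\<And>k. independent_modulo fscale (flat_functions S y k) (T k) id"
    "\<And>k g. g \<in> smooth_functions S \<Longrightarrow> \<exists>t\<in>fs.span (T k). g - t \<in> flat_functions S y k"
    "\<And>k. k + 1 \<le> card (T k)" "\<And>k. card (T k) \<le> (k + 1) ^ DIM('a)"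
proof -
  have "\<exists>T. finite T \<and> T \<subseteq> smooth_functions S \<and> independent_modulo fscale (flat_functions S y k) T id \<and>
      (\<forall>g\<in>smooth_functions S. \<exists>t\<in>fs.span T. g - t \<in> flat_functions S y k)" for k
    by (rule fs.maximal_independent_modulo[OF subspace_flat_functions[of k] subspace_smooth_functions card_independent_modulo_flat])
       auto
  then obtain T where T: "\<And>k. finite (T k) \<and> T k \<subseteq> smooth_functions S \<and> independent_modulo fscale (flat_functions S y k) (T k) id \<and>
      (\<forall>g\<in>smooth_functions S. \<exists>t\<in>fs.span (T k). g - t \<in> flat_functions S y k)" by metis
  obtain b :: 'a where b: "b \<in> Basis" using nonempty_Basis by blast
  have "card {..k} \<le> card (T k)" for k
    by (rule fs.card_le_if_independent_modulo[OF subspace_flat_functions _ _ powers_independent_modulo_flat(2)[OF b]])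
       (use T powers_independent_modulo_flat(1)[OF b] in \<open>auto simp: smooth_functions_def\<close>)
  then show thesis using that[of T] T card_independent_modulo_flat by auto
qed

end

text \<open>By induction \<open>c (N + j)\<close> is at least \<open>N + 2 ^ j\<close>, which eventually exceeds every polynomial.\<close>

lemma no_exponential_below_polynomial:
  fixes c :: "nat \<Rightarrow> nat"
  assumes double: "\<And>k. 2 * c k \<le> N + c (k + 1)" and lower: "\<And>k. k + 1 \<le> c k"
    and upper: "\<And>k. c k \<le> (k + 1) ^ d"
  shows False
proof -
  have exp: "N + 2 ^ j \<le> c (N + j)" for j
  proof (induction j)
    case 0
    then show ?case using lower[of N] by simp
  next
    case (Suc j)
    then show ?case using double[of "N + j"] by simp
  qed
  \<comment> \<open>In terms of \<open>u\<close> the comparison is the limit of \<open>u ^ d / exp u\<close>.\<close>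
  define u where "u j = ln 2 * real (N + j + 1)" for j
  have lin: "filterlim u at_top sequentially"
    unfolding u_def
    by (rule filterlim_tendsto_pos_mult_at_top[OF tendsto_const _
          filterlim_at_top_mono[OF filterlim_real_sequentially]]) auto
  have "((\<lambda>j. u j ^ d / exp (u j)) \<longlongrightarrow> 0) sequentially"
    by (rule filterlim_compose[OF tendsto_power_div_exp_0 lin])
  then have "((\<lambda>j. 2 ^ (N + 1) / ln 2 ^ d * (u j ^ d / exp (u j))) \<longlongrightarrow> 0) sequentially"
    by (rule tendsto_mult_right_zero)
  then have "eventually (\<lambda>j. 2 ^ (N + 1) / ln 2 ^ d * (u j ^ d / exp (u j)) < 1) sequentially"
    by (rule order_tendstoD) simp
  then obtain j where j: "2 ^ (N + 1) / ln 2 ^ d * (u j ^ d / exp (u j)) < 1"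
    using eventually_happens by fastforce
  have e: "exp (u j) = 2 ^ (N + j + 1)"
    using exp_of_nat2_mult[of "ln 2 :: real" "N + j + 1"] unfolding u_def by simp
  have "2 ^ (N + 1) / ln 2 ^ d * (u j ^ d / exp (u j)) = real (N + j + 1) ^ d / 2 ^ j"
    unfolding e by (simp add: u_def power_mult_distrib power_add)
  with j have "real (N + j + 1) ^ d / 2 ^ j < 1" by (simp only:)
  then have "real (N + j + 1) ^ d < 2 ^ j" by (simp add: divide_less_eq)
  then have "(N + j + 1) ^ d < 2 ^ j" by (metis of_nat_less_iff of_nat_numeral of_nat_power)
  then show False using exp[of j] upper[of "N + j"] by simp
qed

lemma fscale_apply: "fscale c f i = c * f i"
  by (simp add: fscale_def)

section \<open>Types of alternating forms at a point\<close>

text \<open>The pointwise condition in the definition of an almost complex structure.\<close>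

definition complex_structure :: "('e::real_vector \<Rightarrow> 'e) \<Rightarrow> bool" where
  "complex_structure J \<longleftrightarrow> linear J \<and> (\<forall>v. J (J v) = - v)"

lemma complex_structureD:
  assumes "complex_structure J"
  shows "linear J" "J (J v) = - v"
  using assms by (auto simp: complex_structure_def)

text \<open>The vectors of type \<open>(0,1)\<close> are \<open>(v, J v)\<close>, that is \<open>v + \<i> J v\<close>, so the covectors
  of type \<open>(1,0)\<close> are the ones that intertwine \<open>J\<close> with multiplication by \<open>\<i>\<close>.\<close>

lemma A10_iff:
  assumes "complex_structure J"
  shows "\<alpha> \<in> A10 J \<longleftrightarrow> linear \<alpha> \<and> (\<forall>v. \<alpha> (J v) = \<i> * \<alpha> v)"
proof -
  have "(\<forall>(u, w)\<in>T01 J. \<alpha> u + \<i> * \<alpha> w = 0) \<longleftrightarrow> (\<forall>v. \<alpha> (J v) = \<i> * \<alpha> v)"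
  proof
    assume *: "\<forall>(u, w)\<in>T01 J. \<alpha> u + \<i> * \<alpha> w = 0"
    show "\<forall>v. \<alpha> (J v) = \<i> * \<alpha> v"
    proof
      fix v
      have "(v, J v) \<in> T01 J" using assms by (simp add: T01_def complex_structure_def)
      then have "\<alpha> v + \<i> * \<alpha> (J v) = 0" using * by blast
      then have "\<i> * (\<alpha> v + \<i> * \<alpha> (J v)) = 0" by simp
      then show "\<alpha> (J v) = \<i> * \<alpha> v" by (simp add: algebra_simps)
    qed
  next
    assume "\<forall>v. \<alpha> (J v) = \<i> * \<alpha> v"
    then show "\<forall>(u, w)\<in>T01 J. \<alpha> u + \<i> * \<alpha> w = 0" by (auto simp: T01_def)
  qed
  then show ?thesis by (simp add: A10_def)
qed

lemma A01_iff:
  assumes "complex_structure J"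
  shows "\<alpha> \<in> A01 J \<longleftrightarrow> linear \<alpha> \<and> (\<forall>v. \<alpha> (J v) = - \<i> * \<alpha> v)"
proof -
  have "(\<forall>(u, w)\<in>T10 J. \<alpha> u + \<i> * \<alpha> w = 0) \<longleftrightarrow> (\<forall>v. \<alpha> (J v) = - \<i> * \<alpha> v)" if "linear \<alpha>"
  proof
    assume *: "\<forall>(u, w)\<in>T10 J. \<alpha> u + \<i> * \<alpha> w = 0"
    show "\<forall>v. \<alpha> (J v) = - \<i> * \<alpha> v"
    proof
      fix v
      have "(J v, v) \<in> T10 J" using assms by (simp add: T10_def complex_structure_def)
      then have "\<alpha> (J v) + \<i> * \<alpha> v = 0" using * by blast
      then show "\<alpha> (J v) = - \<i> * \<alpha> v" by (simp add: add_eq_0_iff)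
    qed
  next
    assume *: "\<forall>v. \<alpha> (J v) = - \<i> * \<alpha> v"
    show "\<forall>(u, w)\<in>T10 J. \<alpha> u + \<i> * \<alpha> w = 0"
    proof safe
      fix u w assume "(u, w) \<in> T10 J"
      then have "J w = u" by (simp add: T10_def)
      then show "\<alpha> u + \<i> * \<alpha> w = 0" using *[rule_format, of w] by simp
    qed
  qed
  then show ?thesis by (auto simp: A01_def)
qed

lemma wedge_length: "length vs \<noteq> length \<alpha>s \<Longrightarrow> wedge \<alpha>s vs = 0"
  by (simp add: wedge_def)

lemma wedge_1: "wedge [\<alpha>] = (\<lambda>vs. case vs of [v] \<Rightarrow> \<alpha> v | _ \<Rightarrow> 0)"
proof
  fix vs :: "'a list"
  have *: "{\<pi>. \<pi> permutes {..<Suc 0}} = {id}"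
    using permutes_sing[of _ 0] by (auto simp: lessThan_Suc)
  show "wedge [\<alpha>] vs = (case vs of [v] \<Rightarrow> \<alpha> v | _ \<Rightarrow> 0)"
    by (auto simp: wedge_def * sign_id lessThan_Suc split: list.splits)
qed

lemma wedge_2:
  "wedge [\<alpha>, \<beta>] = (\<lambda>vs. case vs of [v, w] \<Rightarrow> \<alpha> v * \<beta> w - \<alpha> w * \<beta> v | _ \<Rightarrow> 0)"
proof
  fix vs :: "'a list"
  have l: "{..<2} = insert (0::nat) {1}" by auto
  have f: "finite {1::nat}" "0 \<notin> {1::nat}" by auto
  show "wedge [\<alpha>, \<beta>] vs = (case vs of [v, w] \<Rightarrow> \<alpha> v * \<beta> w - \<alpha> w * \<beta> v | _ \<Rightarrow> 0)"
  proof (cases "length vs = 2")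
    case True
    then obtain v w where vs: "vs = [v, w]"
      by (metis (no_types, opaque_lifting) One_nat_def Suc_1 length_0_conv length_Suc_conv)
    have "wedge [\<alpha>, \<beta>] vs = (\<Sum>\<pi> | \<pi> permutes {..<2}. of_int (sign \<pi>) * (\<Prod>i<2. ([\<alpha>, \<beta>] ! i) (vs ! \<pi> i)))"
      by (simp add: wedge_def vs numeral_2_eq_2)
    also have "\<dots> = \<alpha> v * \<beta> w - \<alpha> w * \<beta> v"
      unfolding l sum_over_permutations_insert[OF f] permutes_sing
      by (simp add: sign_swap_id sign_id vs)
    finally show ?thesis by (simp add: vs)
  next
    case False
    then show ?thesis by (auto simp: wedge_length split: list.splits)
  qed
qed

lemma wedge_scaling:
  assumes "\<And>i v. i < length \<gamma>s \<Longrightarrow> (\<gamma>s ! i) (R v) = z i * (\<gamma>s ! i) v"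
  shows "wedge \<gamma>s (map R vs) = (\<Prod>i<length \<gamma>s. z i) * wedge \<gamma>s vs"
proof (cases "length vs = length \<gamma>s")
  case True
  have "(\<Prod>i<length \<gamma>s. (\<gamma>s ! i) (map R vs ! \<pi> i)) = (\<Prod>i<length \<gamma>s. z i) * (\<Prod>i<length \<gamma>s. (\<gamma>s ! i) (vs ! \<pi> i))"
    if "\<pi> permutes {..<length \<gamma>s}" for \<pi>
    unfolding prod.distrib[symmetric]
  proof (rule prod.cong[OF refl])
    fix i assume "i \<in> {..<length \<gamma>s}"
    then have "\<pi> i < length vs" "i < length \<gamma>s" using permutes_in_image[OF that] True by auto
    then show "(\<gamma>s ! i) (map R vs ! \<pi> i) = z i * (\<gamma>s ! i) (vs ! \<pi> i)" using assms by simp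
  qed
  then show ?thesis using True by (simp add: wedge_def sum_distrib_left mult.left_commute)
qed (simp add: wedge_length)

text \<open>Expanding the vectors in a basis, every choice of basis vectors repeats one of them, and
  the transposition of the two positions changes the sign of the sum over all permutations.\<close>

lemma wedge_eq_0_if_longer_than_dim:
  fixes \<gamma>s :: "('e::euclidean_space \<Rightarrow> complex) list"
  assumes lin: "\<And>i. i < length \<gamma>s \<Longrightarrow> linear (\<gamma>s ! i)" and long: "DIM('e) < length \<gamma>s"
  shows "wedge \<gamma>s = 0"
proof
  fix vs :: "'e list"
  let ?k = "length \<gamma>s"
  let ?F = "PiE {..<?k} (\<lambda>_. Basis :: 'e set)"
  have zero: "(\<Sum>\<pi> | \<pi> permutes {..<?k}. of_int (sign \<pi>) * (\<Prod>i<?k. complex_of_real (vs ! \<pi> i \<bullet> g i))) = 0"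
    if g: "g \<in> ?F" for g
  proof -
    have "\<not> inj_on g {..<?k}"
      using card_inj_on_le[of g "{..<?k}" "Basis :: 'e set"] g long by (auto simp: PiE_iff)
    then obtain a b where ab: "a < ?k" "b < ?k" "a \<noteq> b" "g a = g b" by (auto simp: inj_on_def)
    let ?t = "Transposition.transpose a b"
    have tp: "?t permutes {..<?k}" using ab by (intro permutes_swap_id) auto
    let ?P = "{\<pi>. \<pi> permutes {..<?k}}"
    let ?f = "\<lambda>\<pi>. of_int (sign \<pi>) * (\<Prod>i<?k. complex_of_real (vs ! \<pi> i \<bullet> g i))"
    have "sum ?f ?P = (\<Sum>\<pi>\<in>?P. ?f (\<pi> \<circ> ?t))"
      by (rule sum_permutations_compose_right[OF tp])
    also have "\<dots> = (\<Sum>\<pi>\<in>?P. - ?f \<pi>)"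
    proof (rule sum.cong[OF refl])
      fix \<pi> assume "\<pi> \<in> ?P"
      then have p: "permutation \<pi>" by (auto intro: permutes_imp_permutation)
      have "sign (\<pi> \<circ> ?t) = - sign \<pi>"
        using ab p by (simp add: sign_compose permutation_swap_id sign_swap_id)
      moreover have "(\<Prod>i<?k. complex_of_real (vs ! (\<pi> \<circ> ?t) i \<bullet> g i)) = (\<Prod>i<?k. complex_of_real (vs ! \<pi> i \<bullet> g i))"
      proof -
        have "g (?t i) = g i" for i using ab by (cases "i = a"; cases "i = b") auto
        then have "(\<Prod>i<?k. complex_of_real (vs ! (\<pi> \<circ> ?t) i \<bullet> g i))
          = prod ((\<lambda>i. complex_of_real (vs ! \<pi> i \<bullet> g i)) \<circ> ?t) {..<?k}" by simp
        then show ?thesis by (simp only: prod.permute[OF tp, symmetric])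
      qed
      ultimately show "?f (\<pi> \<circ> ?t) = - ?f \<pi>" by simp
    qed
    also have "\<dots> = - sum ?f ?P" by (rule sum_negf)
    finally show ?thesis by simp
  qed
  have expand: "(\<gamma>s ! i) v = (\<Sum>b\<in>Basis. complex_of_real (v \<bullet> b) * (\<gamma>s ! i) b)" if "i < ?k" for i v
  proof -
    interpret linear "\<gamma>s ! i" using lin[OF that] .
    have "(\<gamma>s ! i) (\<Sum>b\<in>Basis. (v \<bullet> b) *\<^sub>R b) = (\<Sum>b\<in>Basis. complex_of_real (v \<bullet> b) * (\<gamma>s ! i) b)"
      by (simp add: sum scale scaleR_conv_of_real)
    then show ?thesis by (simp add: euclidean_representation)
  qed
  have "(\<Sum>\<pi> | \<pi> permutes {..<?k}. of_int (sign \<pi>) * (\<Prod>i<?k. (\<gamma>s ! i) (vs ! \<pi> i)))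
    = (\<Sum>\<pi> | \<pi> permutes {..<?k}. of_int (sign \<pi>) * (\<Sum>g\<in>?F. \<Prod>i<?k. complex_of_real (vs ! \<pi> i \<bullet> g i) * (\<gamma>s ! i) (g i)))"
    by (intro sum.cong refl arg_cong2[of _ _ _ _ times])
       (subst prod_sum_PiE[symmetric], auto simp: expand[symmetric])
  also have "\<dots> = (\<Sum>\<pi> | \<pi> permutes {..<?k}. \<Sum>g\<in>?F. (\<Prod>i<?k. (\<gamma>s ! i) (g i)) *
      (of_int (sign \<pi>) * (\<Prod>i<?k. complex_of_real (vs ! \<pi> i \<bullet> g i))))"
    by (simp add: sum_distrib_left prod.distrib mult_ac)
  also have "\<dots> = (\<Sum>g\<in>?F. (\<Prod>i<?k. (\<gamma>s ! i) (g i)) *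
      (\<Sum>\<pi> | \<pi> permutes {..<?k}. of_int (sign \<pi>) * (\<Prod>i<?k. complex_of_real (vs ! \<pi> i \<bullet> g i))))"
    by (subst sum.swap) (simp add: sum_distrib_left)
  also have "\<dots> = 0" using zero by simp
  finally show "wedge \<gamma>s vs = 0 vs" by (simp add: wedge_def)
qed

lemma forms_at_fs: "forms_at J p q = fs.span
     {wedge (\<alpha>s @ \<beta>s) | \<alpha>s \<beta>s. length \<alpha>s = p \<and> set \<alpha>s \<subseteq> A10 J \<and> length \<beta>s = q \<and> set \<beta>s \<subseteq> A01 J}"
  by (simp add: forms_at_def cscale_eq_fscale)

lemma subspace_forms_at: "fs.subspace (forms_at J p q)"
  by (simp add: forms_at_fs)

lemma zero_in_forms_at: "0 \<in> forms_at J p q"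
  by (rule fs.subspace_0[OF subspace_forms_at])

lemma wedge_in_forms_at:
  "set \<alpha>s \<subseteq> A10 J \<Longrightarrow> set \<beta>s \<subseteq> A01 J \<Longrightarrow> wedge (\<alpha>s @ \<beta>s) \<in> forms_at J (length \<alpha>s) (length \<beta>s)"
  unfolding forms_at_fs by (rule fs.span_base) auto

lemma linear_if_A10: "\<alpha> \<in> A10 J \<Longrightarrow> linear \<alpha>" by (simp add: A10_def)
lemma linear_if_A01: "\<alpha> \<in> A01 J \<Longrightarrow> linear \<alpha>" by (simp add: A01_def)

lemma forms_at_eq_0_above_dim:
  fixes J :: "'e::euclidean_space \<Rightarrow> 'e"
  assumes "DIM('e) < p + q"
  shows "forms_at J p q = {0}"
proof -
  have "wedge (\<alpha>s @ \<beta>s) = 0"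
    if "length \<alpha>s = p" "set \<alpha>s \<subseteq> A10 J" "length \<beta>s = q" "set \<beta>s \<subseteq> A01 J" for \<alpha>s \<beta>s
  proof (rule wedge_eq_0_if_longer_than_dim)
    fix i assume "i < length (\<alpha>s @ \<beta>s)"
    then have "(\<alpha>s @ \<beta>s) ! i \<in> set (\<alpha>s @ \<beta>s)" by (rule nth_mem)
    then show "linear ((\<alpha>s @ \<beta>s) ! i)" using that by (auto intro: linear_if_A10 linear_if_A01)
  qed (use that assms in simp)
  then have "forms_at J p q \<subseteq> fs.span {0}"
    unfolding forms_at_fs by (intro fs.span_mono) auto
  then show ?thesis using zero_in_forms_at by (auto simp: fs.span_singleton)
qed

lemma forms_at_length:
  assumes "\<theta> \<in> forms_at J p q" "length vs \<noteq> p + q"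
  shows "\<theta> vs = 0"
  using assms(1) unfolding forms_at_fs
proof (induction rule: fs.span_induct)
  case base
  show ?case by (rule fs.subspaceI) (auto simp: fscale_def)
next
  case (step x)
  then show ?case using assms(2) by (auto intro: wedge_length)
qed

text \<open>Multiplication by \<open>cis t\<close> for the complex structure \<open>J\<close>. It acts on forms of type \<open>(p,q)\<close>
  by the scalar \<open>cis (t * (p - q))\<close>, and so distinguishes the types within one degree.\<close>

definition rotate_by :: "real \<Rightarrow> ('e::real_vector \<Rightarrow> 'e) \<Rightarrow> 'e \<Rightarrow> 'e" where
  "rotate_by t J v = cos t *\<^sub>R v + sin t *\<^sub>R J v"

lemma forms_at_rotate:
  assumes J: "complex_structure J" and "\<theta> \<in> forms_at J p q"
  shows "\<theta> (map (rotate_by t J) vs) = cis (t * (real p - real q)) * \<theta> vs"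
  using assms(2) unfolding forms_at_fs
proof (induction rule: fs.span_induct)
  case base
  show ?case by (rule fs.subspaceI) (auto simp: fscale_def algebra_simps)
next
  case (step \<theta>)
  then obtain \<alpha>s \<beta>s where \<theta>: "\<theta> = wedge (\<alpha>s @ \<beta>s)" and l: "length \<alpha>s = p" "length \<beta>s = q"
    and A: "set \<alpha>s \<subseteq> A10 J" "set \<beta>s \<subseteq> A01 J" by blast
  let ?z = "\<lambda>i. if i < p then cis t else cis (- t)"
  have "wedge (\<alpha>s @ \<beta>s) (map (rotate_by t J) vs) = (\<Prod>i<length (\<alpha>s @ \<beta>s). ?z i) * wedge (\<alpha>s @ \<beta>s) vs"
  proof (rule wedge_scaling)
    fix i v assume i: "i < length (\<alpha>s @ \<beta>s)"
    show "((\<alpha>s @ \<beta>s) ! i) (rotate_by t J v) = ?z i * ((\<alpha>s @ \<beta>s) ! i) v"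
    proof (cases "i < p")
      case True
      then have "\<alpha>s ! i \<in> A10 J" using A l by (metis nth_mem subsetD)
      then show ?thesis using True l
        by (auto simp: nth_append A10_iff[OF J] rotate_by_def linear_add linear_scale complex_eq_iff algebra_simps)
    next
      case False
      then have "\<beta>s ! (i - p) \<in> A01 J" using A l i by (auto intro!: subsetD[OF A(2)] nth_mem)
      then show ?thesis using False l
        by (auto simp: nth_append A01_iff[OF J] rotate_by_def linear_add linear_scale complex_eq_iff algebra_simps)
    qed
  qed
  also have "(\<Prod>i<length (\<alpha>s @ \<beta>s). ?z i) = (\<Prod>i<p. cis t) * (\<Prod>i\<in>{p..<p + q}. cis (- t))"
  proof -
    have "{..<p + q} = {..<p} \<union> {p..<p + q}" by auto
    then show ?thesis using l by (simp add: prod.union_disjoint ivl_disj_int)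
  qed
  also have "\<dots> = cis (t * (real p - real q))"
    by (simp add: Complex.DeMoivre cis_mult algebra_simps)
  finally show ?case by (simp add: \<theta>)
qed

text \<open>The product over the list \<open>ls\<close> of the operators \<open>R - l\<close>, where \<open>R\<close> acts on forms by
  substitution.\<close>

definition annihilate_eigenvalues :: "(complex list) \<Rightarrow> ('e \<Rightarrow> 'e) \<Rightarrow> 'e cform \<Rightarrow> 'e cform" where
  "annihilate_eigenvalues ls R = foldr (\<lambda>l \<theta> vs. \<theta> (map R vs) - l * \<theta> vs) ls"

lemma annihilate_eigenvalues_linear:
  "annihilate_eigenvalues ls R 0 = 0"
  "annihilate_eigenvalues ls R (\<theta> + \<eta>) = annihilate_eigenvalues ls R \<theta> + annihilate_eigenvalues ls R \<eta>"
  "annihilate_eigenvalues ls R (fscale c \<theta>) = fscale c (annihilate_eigenvalues ls R \<theta>)"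
  unfolding annihilate_eigenvalues_def
  by (induction ls) (auto simp: fun_eq_iff fscale_def algebra_simps)

lemma annihilate_eigenvalues_on_eigenvector:
  assumes "\<And>vs. length vs = k \<Longrightarrow> \<theta> (map R vs) = m * \<theta> vs" "length vs = k"
  shows "annihilate_eigenvalues ls R \<theta> vs = (\<Prod>l\<leftarrow>ls. m - l) * \<theta> vs"
  using assms(2)
proof (induction ls arbitrary: vs)
  case (Cons l ls)
  have "annihilate_eigenvalues (l # ls) R \<theta> vs = annihilate_eigenvalues ls R \<theta> (map R vs) - l * annihilate_eigenvalues ls R \<theta> vs"
    by (simp add: annihilate_eigenvalues_def)
  then show ?case using Cons assms(1) by (simp add: algebra_simps)
qed (simp add: annihilate_eigenvalues_def)

definition other_forms_at :: "('e::euclidean_space \<Rightarrow> 'e) \<Rightarrow> nat \<Rightarrow> nat \<Rightarrow> 'e cform set" where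
  "other_forms_at J p q = module.span cscale (\<Union>(r, s)\<in>- {(p, q)}. forms_at J r s)"

lemma subspace_other_forms_at: "fs.subspace (other_forms_at J p q)"
  by (simp add: other_forms_at_def cscale_eq_fscale)

lemma in_other_forms_at: "\<theta> \<in> forms_at J r s \<Longrightarrow> (r, s) \<noteq> (p, q) \<Longrightarrow> \<theta> \<in> other_forms_at J p q"
  unfolding other_forms_at_def cscale_eq_fscale by (rule fs.span_base) auto

text \<open>A form in the intersection lives in degree \<open>p + q\<close>, where the types are eigenspaces of a
  small rotation with different eigenvalues. The product of \<open>R - l\<close> over the eigenvalues \<open>l\<close> of
  the other types annihilates the form as a sum of forms of other types, but multiplies it by a nonzero number as a form of type \<open>(p,q)\<close>.\<close>

lemma bidegrees_independent:
  assumes J: "complex_structure J" and \<eta>: "\<eta> \<in> forms_at J p q" and other: "\<eta> \<in> other_forms_at J p q"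
  shows "\<eta> = 0"
proof
  fix vs
  show "\<eta> vs = 0 vs"
  proof (cases "length vs = p + q")
    case False
    then show ?thesis using forms_at_length[OF \<eta>] by simp
  next
    case len: True
    define k where "k = p + q"
    \<comment> \<open>The angle is so small that the eigenvalues of different types of degree \<open>k\<close> are different.\<close>
    define t where "t = 1 / real (k + 1)"
    \<comment> \<open>The eigenvalue on forms of type \<open>(r, k - r)\<close>.\<close>
    define ev where "ev r = cis (t * (2 * real r - real k))" for r
    let ?R = "rotate_by t J"
    let ?ls = "map ev (filter (\<lambda>r. r \<noteq> p) [0..<Suc k])"
    have eig: "\<theta> (map ?R vs) = ev r * \<theta> vs" if "\<theta> \<in> forms_at J r s" "r + s = k" for \<theta> r s vs
    proof -
      have d: "real r - real s = 2 * real r - real k" using that(2) by auto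
      from forms_at_rotate[OF J that(1), of t vs] show ?thesis unfolding d ev_def .
    qed
    have "annihilate_eigenvalues ?ls ?R \<theta> vs = 0" if "\<theta> \<in> other_forms_at J p q" for \<theta>
      using that unfolding other_forms_at_def cscale_eq_fscale
    proof (induction rule: fs.span_induct)
      case base
      show ?case by (rule fs.subspaceI) (auto simp: annihilate_eigenvalues_linear fscale_apply)
    next
      case (step \<theta>)
      then obtain r s where rs: "\<theta> \<in> forms_at J r s" "(r, s) \<noteq> (p, q)" by auto
      show ?case
      proof (cases "r + s = k")
        case True
        then have "r \<noteq> p" "r \<le> k" using rs(2) by (auto simp: k_def)
        then have "r \<in> set (filter (\<lambda>r. r \<noteq> p) [0..<Suc k])" by auto
        then have "ev r \<in> set ?ls" unfolding set_map by (rule imageI)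
        then have "(\<Prod>l\<leftarrow>?ls. ev r - l) = 0" by (force simp: prod_list_zero_iff)
        then show ?thesis
          using annihilate_eigenvalues_on_eigenvector[of k \<theta> ?R "ev r" vs ?ls] eig[OF rs(1) True] len by (simp add: k_def)
      next
        case False
        then have "\<theta> us = 0" if "length us = k" for us using forms_at_length[OF rs(1)] that by auto
        then show ?thesis
          using annihilate_eigenvalues_on_eigenvector[of k \<theta> ?R 0 vs ?ls] len by (simp add: k_def)
      qed
    qed
    then have "annihilate_eigenvalues ?ls ?R \<eta> vs = 0" using other by blast
    moreover have "annihilate_eigenvalues ?ls ?R \<eta> vs = (\<Prod>l\<leftarrow>?ls. ev p - l) * \<eta> vs"
      by (rule annihilate_eigenvalues_on_eigenvector[of k]) (use eig[OF \<eta>] len in \<open>auto simp: k_def\<close>)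
    moreover have "(\<Prod>l\<leftarrow>?ls. ev p - l) \<noteq> 0"
    proof -
      have "ev p \<noteq> ev r" if r: "r \<noteq> p" "r \<le> k" for r
      proof
        assume "ev p = ev r"
        then have "ev p / ev r = 1" by (simp add: ev_def)
        then have "cis (t * (2 * (real p - real r))) = 1"
          by (simp add: ev_def cis_divide algebra_simps)
        then have s: "sin (t * (2 * (real p - real r))) = 0" by (metis cis.simps(2) one_complex.simps(2))
        have "\<bar>real p - real r\<bar> \<le> real k" using r k_def by auto
        then have "\<bar>t * (2 * (real p - real r))\<bar> < 2"
          by (simp add: t_def abs_mult field_simps)
        then have "\<bar>t * (2 * (real p - real r))\<bar> < pi" using pi_gt3 by linarith
        then have "t * (2 * (real p - real r)) = 0" by (intro sin_eq_0_pi[OF _ _ s]) linarith+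
        then show False using r by (simp add: t_def)
      qed
      then show ?thesis by (auto simp: prod_list_zero_iff)
    qed
    ultimately show ?thesis by simp
  qed
qed

text \<open>Directness of the decomposition turns the definite description into a computation rule: any
  decomposition determines the component.\<close>

lemma pq_part_eqI:
  assumes J: "complex_structure J" and "\<eta> \<in> forms_at J p q" "\<theta> - \<eta> \<in> other_forms_at J p q"
  shows "pq_part J p q \<theta> = \<eta>"
  unfolding pq_part_def other_forms_at_def[symmetric]
proof (rule the_equality)
  fix \<eta>' assume \<eta>': "\<eta>' \<in> forms_at J p q \<and> \<theta> - \<eta>' \<in> other_forms_at J p q"
  have "\<eta>' - \<eta> \<in> forms_at J p q"
    by (rule fs.subspace_diff[OF subspace_forms_at conjunct1[OF \<eta>'] assms(2)])
  moreover have "(\<theta> - \<eta>) - (\<theta> - \<eta>') \<in> other_forms_at J p q"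
    by (rule fs.subspace_diff[OF subspace_other_forms_at assms(3) conjunct2[OF \<eta>']])
  ultimately have "\<eta>' - \<eta> = 0" by (intro bidegrees_independent[OF J, of "\<eta>' - \<eta>" p q]) simp_all
  then show "\<eta>' = \<eta>" by simp
qed (use assms in auto)

lemma pq_part_zero: "complex_structure J \<Longrightarrow> pq_part J p q 0 = 0"
  by (rule pq_part_eqI) (auto simp: zero_in_forms_at fs.subspace_0[OF subspace_other_forms_at])

text \<open>The component of type \<open>(0,1)\<close> of a covector.\<close>

definition proj01 :: "('e \<Rightarrow> 'e) \<Rightarrow> ('e \<Rightarrow> complex) \<Rightarrow> 'e \<Rightarrow> complex" where
  "proj01 J \<alpha> = (\<lambda>v. (\<alpha> v + \<i> * \<alpha> (J v)) / 2)"

definition proj10 :: "('e \<Rightarrow> 'e) \<Rightarrow> ('e \<Rightarrow> complex) \<Rightarrow> 'e \<Rightarrow> complex" where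
  "proj10 J \<alpha> = (\<lambda>v. (\<alpha> v - \<i> * \<alpha> (J v)) / 2)"

lemma linear_half_combination:
  fixes \<alpha> :: "'e::real_vector \<Rightarrow> complex"
  assumes "linear J" "linear \<alpha>"
  shows "linear (\<lambda>v. (\<alpha> v + c * \<alpha> (J v)) / 2)"
  by (rule linearI)
     (auto simp: linear_add[OF assms(1)] linear_add[OF assms(2)] linear_scale[OF assms(1)]
       linear_scale[OF assms(2)] scaleR_conv_of_real field_simps)

lemma proj01_in_A01:
  assumes J: "complex_structure J" and "linear \<alpha>"
  shows "proj01 J \<alpha> \<in> A01 J"
  using linear_half_combination[OF complex_structureD(1)[OF J] assms(2), of \<i>] complex_structureD(2)[OF J]
  by (auto simp: A01_iff[OF J] proj01_def linear_neg[OF assms(2)] algebra_simps)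

lemma proj10_in_A10:
  assumes J: "complex_structure J" and "linear \<alpha>"
  shows "proj10 J \<alpha> \<in> A10 J"
  using linear_half_combination[OF complex_structureD(1)[OF J] assms(2), of "-\<i>"] complex_structureD(2)[OF J]
  by (auto simp: A10_iff[OF J] proj10_def linear_neg[OF assms(2)] algebra_simps)

lemma proj_sum: "proj10 J \<alpha> v + proj01 J \<alpha> v = \<alpha> v"
  by (simp add: proj10_def proj01_def field_simps)

lemma proj01_fixes_A01: "complex_structure J \<Longrightarrow> \<alpha> \<in> A01 J \<Longrightarrow> proj01 J \<alpha> = \<alpha>"
  by (auto simp: A01_iff proj01_def fun_eq_iff)

lemma proj10_fixes_A10: "complex_structure J \<Longrightarrow> \<alpha> \<in> A10 J \<Longrightarrow> proj10 J \<alpha> = \<alpha>"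
  by (auto simp: A10_iff proj10_def fun_eq_iff)

lemma forms_at_10: "forms_at J 1 0 = {wedge [\<alpha>] | \<alpha>. \<alpha> \<in> A10 J}"
proof -
  have "{wedge (\<alpha>s @ \<beta>s) | \<alpha>s \<beta>s. length \<alpha>s = 1 \<and> set \<alpha>s \<subseteq> A10 J \<and> length \<beta>s = 0 \<and> set \<beta>s \<subseteq> A01 J}
     = {wedge [\<alpha>] | \<alpha>. \<alpha> \<in> A10 J}" (is "?G = ?H")
    by (force simp: length_Suc_conv)
  moreover have "fs.span ?H = ?H"
  proof (rule fs.span_eq_iff[THEN iffD2], rule fs.subspaceI)
    show "0 \<in> ?H"
      by (rule CollectI, rule exI[of _ "\<lambda>v. 0"])
         (auto simp: A10_def wedge_1 fun_eq_iff linear_zero split: list.splits)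
  next
    fix x y assume "x \<in> ?H" "y \<in> ?H"
    then obtain \<alpha> \<beta> where *: "x = wedge [\<alpha>]" "\<alpha> \<in> A10 J" "y = wedge [\<beta>]" "\<beta> \<in> A10 J" by auto
    have "x + y = wedge [\<lambda>v. \<alpha> v + \<beta> v]" using * by (auto simp: wedge_1 fun_eq_iff split: list.splits)
    moreover have "(\<lambda>v. \<alpha> v + \<beta> v) \<in> A10 J"
    proof -
      have "\<alpha> u + \<beta> u + \<i> * (\<alpha> w + \<beta> w) = 0" if "(u, w) \<in> T01 J" for u w
      proof -
        have "\<alpha> u + \<i> * \<alpha> w = 0" "\<beta> u + \<i> * \<beta> w = 0" using * that by (auto simp: A10_def)
        then have "(\<alpha> u + \<i> * \<alpha> w) + (\<beta> u + \<i> * \<beta> w) = 0" by simp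
        then show ?thesis by (simp add: algebra_simps)
      qed
      then show ?thesis using * by (auto simp: A10_def intro: linear_compose_add)
    qed
    ultimately show "x + y \<in> ?H" by blast
  next
    fix c x assume "x \<in> ?H"
    then obtain \<alpha> where *: "x = wedge [\<alpha>]" "\<alpha> \<in> A10 J" by auto
    have "fscale c x = wedge [\<lambda>v. c * \<alpha> v]" using * by (auto simp: wedge_1 fun_eq_iff fscale_def split: list.splits)
    moreover have "(\<lambda>v. c * \<alpha> v) \<in> A10 J"
    proof -
      have "linear (\<lambda>v. c * \<alpha> v)"
        using * linear_compose[of \<alpha> "\<lambda>z. c * z"] by (simp add: A10_def o_def bounded_linear.linear bounded_linear_mult_right)
      moreover have "c * \<alpha> u + \<i> * (c * \<alpha> w) = 0" if "(u, w) \<in> T01 J" for u w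
      proof -
        have "\<alpha> u + \<i> * \<alpha> w = 0" using * that by (auto simp: A10_def)
        then have "c * (\<alpha> u + \<i> * \<alpha> w) = 0" by simp
        then show ?thesis by (simp add: algebra_simps)
      qed
      ultimately show ?thesis by (auto simp: A10_def)
    qed
    ultimately show "fscale c x \<in> ?H" by blast
  qed
  ultimately show ?thesis by (simp only: forms_at_fs)
qed

lemma pq_part_01:
  fixes \<alpha> :: "'e::euclidean_space \<Rightarrow> complex"
  assumes J: "complex_structure J" and \<alpha>: "linear \<alpha>"
  shows "pq_part J 0 1 (wedge [\<alpha>]) = wedge [proj01 J \<alpha>]"
proof (rule pq_part_eqI[OF J])
  show "wedge [proj01 J \<alpha>] \<in> forms_at J 0 1"
    using wedge_in_forms_at[of "[]" J "[proj01 J \<alpha>]"] proj01_in_A01[OF J \<alpha>] by simp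
  have "wedge [\<alpha>] - wedge [proj01 J \<alpha>] = wedge [proj10 J \<alpha>]"
    by (auto simp: wedge_1 fun_eq_iff proj10_def proj01_def field_simps split: list.splits)
  moreover have "wedge [proj10 J \<alpha>] \<in> forms_at J 1 0"
    using wedge_in_forms_at[of "[proj10 J \<alpha>]" J "[]"] proj10_in_A10[OF J \<alpha>] by simp
  ultimately show "wedge [\<alpha>] - wedge [proj01 J \<alpha>] \<in> other_forms_at J 0 1"
    using in_other_forms_at by fastforce
qed

text \<open>The component of type \<open>(0,2)\<close> of a form of degree two: the projection onto the
  \<open>(0,1)\<close>-part is applied in both arguments. In contrast to \<^const>\<open>pq_part\<close> it is given by a formula, so it is
  visibly linear and natural.\<close>

definition part_02 :: "('e \<Rightarrow> 'e) \<Rightarrow> 'e cform \<Rightarrow> 'e cform" where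
  "part_02 J \<theta> = (\<lambda>vs. case vs of [v, w] \<Rightarrow>
     (\<theta> [v, w] + \<i> * \<theta> [J v, w] + \<i> * \<theta> [v, J w] - \<theta> [J v, J w]) / 4 | _ \<Rightarrow> 0)"

lemma part_02_wedge: "part_02 J (wedge [\<alpha>, \<beta>]) = wedge [proj01 J \<alpha>, proj01 J \<beta>]"
  by (auto simp: fun_eq_iff part_02_def wedge_2 proj01_def algebra_simps add_divide_distrib diff_divide_distrib split: list.splits)

lemma part_02_sum: "part_02 J (\<Sum>i\<in>I. \<theta> i) = (\<Sum>i\<in>I. part_02 J (\<theta> i))"
proof
  fix vs
  show "part_02 J (\<Sum>i\<in>I. \<theta> i) vs = (\<Sum>i\<in>I. part_02 J (\<theta> i)) vs"
    by (auto simp: part_02_def sum_fun_apply sum.distrib sum_subtractf sum_distrib_left sum_divide_distrib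
        add_divide_distrib diff_divide_distrib split: list.splits)
qed

lemma pq_part_02:
  fixes \<alpha> \<beta> :: "'i \<Rightarrow> 'e::euclidean_space \<Rightarrow> complex"
  assumes J: "complex_structure J" and lin: "\<And>i. i \<in> I \<Longrightarrow> linear (\<alpha> i)" "\<And>i. i \<in> I \<Longrightarrow> linear (\<beta> i)"
  defines "\<theta> \<equiv> \<Sum>i\<in>I. wedge [\<alpha> i, \<beta> i]"
  shows "pq_part J 0 2 \<theta> = part_02 J \<theta>" "part_02 J \<theta> \<in> forms_at J 0 2"
proof -
  have eq: "part_02 J \<theta> = (\<Sum>i\<in>I. wedge [proj01 J (\<alpha> i), proj01 J (\<beta> i)])"
    by (simp add: \<theta>_def part_02_sum part_02_wedge)
  have in02: "wedge [proj01 J (\<alpha> i), proj01 J (\<beta> i)] \<in> forms_at J 0 2" if "i \<in> I" for i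
    using wedge_in_forms_at[of "[]" J "[proj01 J (\<alpha> i), proj01 J (\<beta> i)]"]
      proj01_in_A01[OF J] lin[OF that] by (simp add: numeral_2_eq_2)
  then show *: "part_02 J \<theta> \<in> forms_at J 0 2"
    unfolding eq by (intro fs.subspace_sum[OF subspace_forms_at])
  have "wedge [\<alpha> i, \<beta> i] - wedge [proj01 J (\<alpha> i), proj01 J (\<beta> i)] \<in> other_forms_at J 0 2" if i: "i \<in> I" for i
  proof -
    have "wedge [\<alpha> i, \<beta> i] - wedge [proj01 J (\<alpha> i), proj01 J (\<beta> i)] =
      wedge [proj10 J (\<alpha> i), proj01 J (\<beta> i)] + wedge [proj10 J (\<alpha> i), proj10 J (\<beta> i)]
       - wedge [proj10 J (\<beta> i), proj01 J (\<alpha> i)]"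
    proof
      fix vs
      have a: "\<alpha> i v = proj10 J (\<alpha> i) v + proj01 J (\<alpha> i) v" for v by (simp add: proj_sum)
      have b: "\<beta> i v = proj10 J (\<beta> i) v + proj01 J (\<beta> i) v" for v by (simp add: proj_sum)
      define a1 a2 b1 b2 where "a1 = proj10 J (\<alpha> i)" "a2 = proj01 J (\<alpha> i)" "b1 = proj10 J (\<beta> i)" "b2 = proj01 J (\<beta> i)"
      have "\<alpha> i = (\<lambda>v. a1 v + a2 v)" "\<beta> i = (\<lambda>v. b1 v + b2 v)"
        unfolding a1_a2_b1_b2_def using a b by auto
      then show "(wedge [\<alpha> i, \<beta> i] - wedge [proj01 J (\<alpha> i), proj01 J (\<beta> i)]) vs =
        (wedge [proj10 J (\<alpha> i), proj01 J (\<beta> i)] + wedge [proj10 J (\<alpha> i), proj10 J (\<beta> i)]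
         - wedge [proj10 J (\<beta> i), proj01 J (\<alpha> i)]) vs"
        unfolding a1_a2_b1_b2_def[symmetric]
        by (auto simp: wedge_2 algebra_simps split: list.splits)
    qed
    moreover have "wedge [proj10 J (\<alpha> i), proj01 J (\<beta> i)] \<in> other_forms_at J 0 2"
      using wedge_in_forms_at[of "[proj10 J (\<alpha> i)]" J "[proj01 J (\<beta> i)]"] proj01_in_A01[OF J lin(2)[OF i]]
        proj10_in_A10[OF J lin(1)[OF i]] by (auto intro: in_other_forms_at)
    moreover have "wedge [proj10 J (\<beta> i), proj01 J (\<alpha> i)] \<in> other_forms_at J 0 2"
      using wedge_in_forms_at[of "[proj10 J (\<beta> i)]" J "[proj01 J (\<alpha> i)]"] proj01_in_A01[OF J lin(1)[OF i]]
        proj10_in_A10[OF J lin(2)[OF i]] by (auto intro: in_other_forms_at)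
    moreover have "wedge [proj10 J (\<alpha> i), proj10 J (\<beta> i)] \<in> other_forms_at J 0 2"
      using wedge_in_forms_at[of "[proj10 J (\<alpha> i), proj10 J (\<beta> i)]" J "[]"] 
        proj10_in_A10[OF J lin(1)[OF i]] proj10_in_A10[OF J lin(2)[OF i]] by (auto intro: in_other_forms_at)
    ultimately show ?thesis
      by (simp add: fs.subspace_add fs.subspace_diff subspace_other_forms_at)
  qed
  then have "(\<Sum>i\<in>I. wedge [\<alpha> i, \<beta> i] - wedge [proj01 J (\<alpha> i), proj01 J (\<beta> i)]) \<in> other_forms_at J 0 2"
    by (intro fs.subspace_sum[OF subspace_other_forms_at])
  then have "\<theta> - part_02 J \<theta> \<in> other_forms_at J 0 2"
    unfolding eq unfolding \<theta>_def by (simp only: sum_subtractf)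
  then show "pq_part J 0 2 \<theta> = part_02 J \<theta>" by (rule pq_part_eqI[OF J *])
qed

definition covector :: "'e::euclidean_space \<Rightarrow> 'e \<Rightarrow> complex" where
  "covector b = (\<lambda>v. complex_of_real (v \<bullet> b))"

lemma linear_covector: "linear (covector b)"
  by (rule linearI) (auto simp: covector_def inner_add_left scaleR_conv_of_real)

lemma linear_expand_basis:
  fixes \<alpha> :: "'e::euclidean_space \<Rightarrow> complex"
  assumes "linear \<alpha>"
  shows "\<alpha> v = (\<Sum>b\<in>Basis. \<alpha> b * covector b v)"
proof -
  interpret linear \<alpha> by fact
  have "\<alpha> (\<Sum>b\<in>Basis. (v \<bullet> b) *\<^sub>R b) = (\<Sum>b\<in>Basis. \<alpha> b * covector b v)"
    by (simp add: sum scale scaleR_conv_of_real covector_def mult.commute)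
  then show ?thesis by (simp add: euclidean_representation)
qed

text \<open>The \<open>(0,2)\<close>-parts of products of coordinate covectors generate the \<open>(0,2)\<close>-forms, for all
  complex structures at once, and the coefficients are values of the form. This replaces a local frame.\<close>

lemma part_02_expand:
  fixes J :: "'e::euclidean_space \<Rightarrow> 'e"
  assumes J: "complex_structure J" and "\<theta> \<in> forms_at J 0 2"
  shows "\<theta> = (\<Sum>(a, b)\<in>Basis \<times> Basis. fscale (\<theta> [a, b] / 2) (part_02 J (wedge [covector a, covector b])))"
proof -
  let ?h = "\<lambda>\<theta>. (\<Sum>(a, b)\<in>Basis \<times> Basis. fscale (\<theta> [a, b] / 2) (part_02 J (wedge [covector a, covector b])))"
  have "\<theta> = ?h \<theta>" using assms(2) unfolding forms_at_fs
  proof (induction rule: fs.span_induct)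
    case base
    show ?case
    proof (rule fs.subspaceI)
      show "0 \<in> Collect (\<lambda>\<theta>. \<theta> = ?h \<theta>)"
        by (simp add: fun_eq_iff sum_fun_apply fscale_def case_prod_unfold)
    next
      fix x y assume "x \<in> Collect (\<lambda>\<theta>. \<theta> = ?h \<theta>)" "y \<in> Collect (\<lambda>\<theta>. \<theta> = ?h \<theta>)"
      then have "x + y = ?h x + ?h y" by simp
      also have "\<dots> = ?h (x + y)"
        by (simp add: fun_eq_iff sum_fun_apply fscale_def case_prod_unfold add_divide_distrib algebra_simps sum.distrib)
      finally show "x + y \<in> Collect (\<lambda>\<theta>. \<theta> = ?h \<theta>)" unfolding mem_Collect_eq .
    next
      fix c x assume "x \<in> Collect (\<lambda>\<theta>. \<theta> = ?h \<theta>)"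
      then have "fscale c x = fscale c (?h x)" by simp
      also have "\<dots> = ?h (fscale c x)"
        by (simp add: fun_eq_iff sum_fun_apply fscale_def case_prod_unfold sum_distrib_left mult.assoc)
      finally show "fscale c x \<in> Collect (\<lambda>\<theta>. \<theta> = ?h \<theta>)" unfolding mem_Collect_eq .
    qed
  next
    case (step \<theta>)
    then obtain \<beta>s where "\<theta> = wedge \<beta>s" "length \<beta>s = 2" "set \<beta>s \<subseteq> A01 J" by auto
    then obtain \<alpha> \<beta> where \<theta>: "\<theta> = wedge [\<alpha>, \<beta>]" and A: "\<alpha> \<in> A01 J" "\<beta> \<in> A01 J"
      by (auto simp: numeral_2_eq_2 length_Suc_conv)
    note lin = linear_expand_basis[OF linear_if_A01[OF A(1)]] linear_expand_basis[OF linear_if_A01[OF A(2)]]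
    have w: "wedge [\<alpha>, \<beta>] = (\<Sum>(a, b)\<in>Basis \<times> Basis. fscale (wedge [\<alpha>, \<beta>] [a, b] / 2) (wedge [covector a, covector b]))"
    proof
      fix vs :: "'e list"
      show "wedge [\<alpha>, \<beta>] vs = (\<Sum>(a, b)\<in>Basis \<times> Basis. fscale (wedge [\<alpha>, \<beta>] [a, b] / 2) (wedge [covector a, covector b])) vs"
      proof (cases "length vs = 2")
        case True
        then obtain v w where vs: "vs = [v, w]" by (auto simp: numeral_2_eq_2 length_Suc_conv)
        have S: "(\<Sum>(a, b)\<in>Basis \<times> Basis. f a * g b) = sum f Basis * sum g Basis" for f g :: "'e \<Rightarrow> complex"
          by (simp add: sum_product sum.cartesian_product)
        have "2 * (\<alpha> v * \<beta> w - \<alpha> w * \<beta> v) = \<alpha> v * \<beta> w - \<beta> v * \<alpha> w - (\<alpha> w * \<beta> v - \<beta> w * \<alpha> v)"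
          by simp
        also have "\<dots> = (\<Sum>(a, b)\<in>Basis \<times> Basis. (\<alpha> a * covector a v) * (\<beta> b * covector b w))
          - (\<Sum>(a, b)\<in>Basis \<times> Basis. (\<beta> a * covector a v) * (\<alpha> b * covector b w))
          - ((\<Sum>(a, b)\<in>Basis \<times> Basis. (\<alpha> a * covector a w) * (\<beta> b * covector b v))
          - (\<Sum>(a, b)\<in>Basis \<times> Basis. (\<beta> a * covector a w) * (\<alpha> b * covector b v)))"
          unfolding S lin[symmetric] ..
        also have "\<dots> = (\<Sum>(a, b)\<in>Basis \<times> Basis. (\<alpha> a * \<beta> b - \<alpha> b * \<beta> a) * (covector a v * covector b w - covector a w * covector b v))"
          unfolding sum_subtractf[symmetric] by (intro sum.cong refl) (auto simp: algebra_simps)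
        finally show ?thesis
          by (simp add: vs wedge_2 sum_fun_apply fscale_def case_prod_unfold sum_divide_distrib[symmetric] field_simps)
      qed (auto simp: wedge_length sum_fun_apply fscale_def case_prod_unfold)
    qed
    have "wedge [\<alpha>, \<beta>] = part_02 J (wedge [\<alpha>, \<beta>])"
      using A by (simp add: part_02_wedge proj01_fixes_A01[OF J])
    also have "\<dots> = ?h (wedge [\<alpha>, \<beta>])"
    proof -
      have f: "part_02 J (fscale c \<eta>) = fscale c (part_02 J \<eta>)" for c \<eta>
        by (auto simp: fun_eq_iff part_02_def fscale_def algebra_simps split: list.splits)
      show ?thesis by (subst w) (simp only: part_02_sum case_prod_unfold f)
    qed
    finally show ?case by (simp add: \<theta>)
  qed
  then show ?thesis .
qed

text \<open>A basis of the real vector space with complex structure \<open>- J\<close>, as a complex vector space, together with its dual basis. With this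
  choice of sign the covectors of type \<open>(0,1)\<close> are the complex linear ones. Counting real dimensions gives \<open>2 * card B\<close>.\<close>

lemma complex_frame:
  fixes J :: "'e::euclidean_space \<Rightarrow> 'e"
  assumes J: "complex_structure J"
  obtains B :: "'e set" and \<beta> where "finite B" "2 * card B = DIM('e)" "\<And>b. b \<in> B \<Longrightarrow> \<beta> b \<in> A01 J"
    "\<And>b c. b \<in> B \<Longrightarrow> c \<in> B \<Longrightarrow> \<beta> b c = (if b = c then 1 else 0)"
    "\<And>\<alpha>. \<alpha> \<in> A01 J \<Longrightarrow> \<alpha> = (\<lambda>v. \<Sum>b\<in>B. \<alpha> b * \<beta> b v)"
proof -
  note lJ = complex_structureD(1)[OF J] and JJ = complex_structureD(2)[OF J]
  \<comment> \<open>The sign makes \<open>\<i>\<close> act as \<open>- J\<close>.\<close>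
  define sc where "sc z v = Re z *\<^sub>R v - Im z *\<^sub>R J v" for z v
  interpret V: vector_space sc
    by unfold_locales
       (auto simp: sc_def linear_add[OF lJ] linear_diff[OF lJ] linear_scale[OF lJ] JJ algebra_simps)
  obtain B where B: "V.independent B" "V.span B = UNIV"
    by (rule V.maximal_independent_subset[of UNIV]) (simp add: top.extremum_unique)
  have fin_bound: "2 * card B' \<le> DIM('e)" if B': "finite B'" "B' \<subseteq> B" for B'
  proof -
    let ?b = "\<lambda>(v, e). if e then J v else v"
    have "card (B' \<times> (UNIV :: bool set)) \<le> card (Basis :: 'e set)"
    proof (rule real_vector.card_le_if_independent_modulo[where W = "{0}" and b = ?b])
      show "independent_modulo (*\<^sub>R) {0} (B' \<times> UNIV) ?b"
        unfolding independent_modulo_def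
      proof (intro allI impI)
        fix c assume "(\<Sum>i\<in>B' \<times> (UNIV :: bool set). c i *\<^sub>R ?b i) \<in> {0}"
        then have "(\<Sum>v\<in>B'. \<Sum>e\<in>UNIV. c (v, e) *\<^sub>R ?b (v, e)) = 0"
          unfolding sum.cartesian_product' by simp
        then have "(\<Sum>v\<in>B'. sc (Complex (c (v, False)) (- c (v, True))) v) = 0"
          by (simp add: UNIV_bool sc_def)
        then have z: "Complex (c (v, False)) (- c (v, True)) = 0" if "v \<in> B'" for v
          using V.independentD[OF B(1) B'(1) B'(2), of "\<lambda>v. Complex (c (v, False)) (- c (v, True))"] that by simp
        show "\<forall>i\<in>B' \<times> UNIV. c i = 0"
        proof safe
          fix v and e :: bool assume "v \<in> B'"
          from z[OF this] show "c (v, e) = 0" by (cases e) (auto simp: complex_eq_iff)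
        qed
      qed
    next
      fix i show "\<exists>t\<in>span Basis. ?b i - t \<in> {0}" by (auto simp: span_Basis)
    qed (use B' in \<open>auto simp: subspace_single_0\<close>)
    then show ?thesis by (simp add: card_cartesian_product)
  qed
  have finB: "finite B"
    using finite_if_finite_subsets_card_bdd[of B "DIM('e)"] fin_bound by fastforce
  have expand: "v = (\<Sum>b\<in>B. sc (V.representation B v b) b)" for v
    using V.sum_representation_eq[OF B(1) _ finB subset_refl, of v] B(2) by simp
  have "DIM('e) \<le> card (B \<union> J ` B)"
  proof -
    have "v \<in> span (B \<union> J ` B)" for v
    proof -
      have "(\<Sum>b\<in>B. sc (V.representation B v b) b) \<in> span (B \<union> J ` B)"
        unfolding sc_def by (intro span_sum span_diff span_scale span_base) auto
      then show ?thesis using expand[of v] by simp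
    qed
    then have "dim (UNIV :: 'e set) \<le> card (B \<union> J ` B)" using finB by (intro dim_le_card) auto
    then show ?thesis by simp
  qed
  also have "\<dots> \<le> card B + card (J ` B)" by (rule card_Un_le)
  also have "\<dots> \<le> 2 * card B" using card_image_le[OF finB, of J] by simp
  finally have card: "2 * card B = DIM('e)" using fin_bound[OF finB] by simp
  define \<beta> where "\<beta> b v = V.representation B v b" for b v
  have scr: "r *\<^sub>R v = sc (of_real r) v" for r v by (simp add: sc_def)
  have Ji: "J v = sc (- \<i>) v" for v by (simp add: sc_def)
  have \<beta>: "\<beta> b \<in> A01 J" for b
  proof -
    have "linear (\<beta> b)"
      by (rule linearI)
         (auto simp: \<beta>_def scr V.representation_add[OF B(1)] V.representation_scale[OF B(1)] B(2) scaleR_conv_of_real)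
    moreover have "\<beta> b (J v) = - \<i> * \<beta> b v" for v
      unfolding \<beta>_def Ji by (subst V.representation_scale[OF B(1)]) (simp_all add: B(2))
    ultimately show ?thesis by (simp add: A01_iff[OF J])
  qed
  have dual: "\<beta> b c = (if b = c then 1 else 0)" if "c \<in> B" for b c
    unfolding \<beta>_def using V.representation_basis[OF B(1) that] by auto
  have rep: "\<alpha> = (\<lambda>v. \<Sum>b\<in>B. \<alpha> b * \<beta> b v)" if \<alpha>: "\<alpha> \<in> A01 J" for \<alpha>
  proof
    fix v
    have l: "linear \<alpha>" using \<alpha> by (rule linear_if_A01)
    have s: "\<alpha> (sc z w) = z * \<alpha> w" for z w
      using \<alpha> by (simp add: sc_def linear_diff[OF l] linear_scale[OF l] A01_iff[OF J] scaleR_conv_of_real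
          complex_eq_iff algebra_simps)
    have "\<alpha> v = \<alpha> (\<Sum>b\<in>B. sc (V.representation B v b) b)" using expand[of v] by simp
    also have "\<dots> = (\<Sum>b\<in>B. \<alpha> b * \<beta> b v)" by (simp add: linear_sum[OF l] s \<beta>_def mult.commute)
    finally show "\<alpha> v = (\<Sum>b\<in>B. \<alpha> b * \<beta> b v)" .
  qed
  show thesis by (rule that[OF finB card \<beta> dual rep])
qed

text \<open>The products \<open>\<beta> b \<and> \<beta> b'\<close> of dual basis covectors generate; a two-element set of indices stands for a product with increasing
  indices.\<close>

lemma forms_at_02_spanned:
  fixes J :: "'e::euclidean_space \<Rightarrow> 'e"
  assumes J: "complex_structure J"
  obtains T where "finite T" "card T \<le> (DIM('e) div 2) choose 2" "forms_at J 0 2 \<subseteq> fs.span T"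
proof -
  obtain B \<beta> where B: "finite B" "2 * card B = DIM('e)" "\<And>b. b \<in> B \<Longrightarrow> \<beta> b \<in> A01 J"
    and "\<And>b c. b \<in> B \<Longrightarrow> c \<in> B \<Longrightarrow> \<beta> b c = (if b = c then 1 else 0)"
    and rep: "\<And>\<alpha>. \<alpha> \<in> A01 J \<Longrightarrow> \<alpha> = (\<lambda>v. \<Sum>b\<in>B. \<alpha> b * \<beta> b v)"
    by (rule complex_frame[OF J]) (rule that)
  let ?n = "DIM('e) div 2"
  have cB: "card B = ?n" using B(2) by simp
  obtain f where f: "bij_betw f {0..<?n} B" using ex_bij_betw_nat_finite[OF B(1)] cB by auto
  define e where "e i = \<beta> (f i)" for i
  let ?K = "{K. K \<subseteq> {0..<?n} \<and> card K = 2}"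
  define T where "T = (\<lambda>K. wedge [e (Min K), e (Max K)]) ` ?K"
  have finK: "finite ?K" by (rule finite_subset[of _ "Pow {0..<?n}"]) auto
  have "card T \<le> card ?K" unfolding T_def by (rule card_image_le[OF finK])
  also have "card ?K = ?n choose 2" using n_subsets[of "{0..<?n}" 2] by simp
  finally have cT: "card T \<le> ?n choose 2" .
  have lt: "wedge [e i, e j] \<in> fs.span T" if "i < j" "j < ?n" for i j
  proof -
    have "Min {i, j} = i" "Max {i, j} = j" using that by auto
    moreover have "{i, j} \<in> ?K" using that by (auto simp: card_insert_if)
    ultimately have "wedge [e i, e j] \<in> T" unfolding T_def by (metis (no_types, lifting) image_eqI)
    then show ?thesis by (rule fs.span_base)
  qed
  have swap: "wedge [e i, e j] = - wedge [e j, e i]" for i j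
    by (auto simp: wedge_2 fun_eq_iff algebra_simps split: list.splits)
  have all: "wedge [e i, e j] \<in> fs.span T" if "i < ?n" "j < ?n" for i j
  proof (cases i j rule: linorder_cases)
    case less then show ?thesis using lt that by simp
  next
    case equal
    then have "wedge [e i, e j] = 0" by (auto simp: wedge_2 fun_eq_iff split: list.splits)
    then show ?thesis by (simp add: fs.span_zero)
  next
    case greater then show ?thesis using lt that swap[of i j] fs.span_neg by metis
  qed
  have rep': "\<alpha> = (\<lambda>v. \<Sum>i\<in>{0..<?n}. \<alpha> (f i) * e i v)" if "\<alpha> \<in> A01 J" for \<alpha>
    by (subst rep[OF that]) (simp add: e_def sum.reindex_bij_betw[OF f, of "\<lambda>b. \<alpha> b * \<beta> b _"])
  have "forms_at J 0 2 \<subseteq> fs.span T"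
    unfolding forms_at_fs
  proof (rule fs.span_minimal)
    show "{wedge (\<alpha>s @ \<beta>s) | \<alpha>s \<beta>s. length \<alpha>s = 0 \<and> set \<alpha>s \<subseteq> A10 J \<and> length \<beta>s = 2 \<and> set \<beta>s \<subseteq> A01 J} \<subseteq> fs.span T"
    proof
      fix x assume "x \<in> {wedge (\<alpha>s @ \<beta>s) | \<alpha>s \<beta>s. length \<alpha>s = 0 \<and> set \<alpha>s \<subseteq> A10 J \<and> length \<beta>s = 2 \<and> set \<beta>s \<subseteq> A01 J}"
      then obtain \<beta>s where *: "x = wedge \<beta>s" "length \<beta>s = 2" "set \<beta>s \<subseteq> A01 J" by auto
      then obtain \<alpha> \<beta> where \<beta>s: "\<beta>s = [\<alpha>, \<beta>]" "\<alpha> \<in> A01 J" "\<beta> \<in> A01 J"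
        by (auto simp: numeral_2_eq_2 length_Suc_conv)
      have "wedge [\<alpha>, \<beta>] = (\<Sum>(i, j)\<in>{0..<?n} \<times> {0..<?n}. fscale (\<alpha> (f i) * \<beta> (f j)) (wedge [e i, e j]))"
      proof
        fix vs :: "'e list"
        show "wedge [\<alpha>, \<beta>] vs = (\<Sum>(i, j)\<in>{0..<?n} \<times> {0..<?n}. fscale (\<alpha> (f i) * \<beta> (f j)) (wedge [e i, e j])) vs"
        proof (cases "length vs = 2")
          case True
          then obtain v w where vs: "vs = [v, w]" by (auto simp: numeral_2_eq_2 length_Suc_conv)
          have S: "(\<Sum>(a, b)\<in>{0..<?n} \<times> {0..<?n}. f a * g b) = sum f {0..<?n} * sum g {0..<?n}" for f g :: "nat \<Rightarrow> complex"
            by (simp add: sum_product sum.cartesian_product)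
          have "\<alpha> v * \<beta> w - \<alpha> w * \<beta> v = 
             (\<Sum>(i, j)\<in>{0..<?n} \<times> {0..<?n}. (\<alpha> (f i) * e i v) * (\<beta> (f j) * e j w)) -
             (\<Sum>(i, j)\<in>{0..<?n} \<times> {0..<?n}. (\<alpha> (f i) * e i w) * (\<beta> (f j) * e j v))"
            unfolding S by (simp only: fun_cong[OF rep'[OF \<beta>s(2)], symmetric] fun_cong[OF rep'[OF \<beta>s(3)], symmetric])
          then show ?thesis
            by (simp add: vs wedge_2 sum_fun_apply fscale_def case_prod_unfold sum_subtractf[symmetric] algebra_simps)
        qed (auto simp: wedge_length sum_fun_apply fscale_def case_prod_unfold)
      qed
      also have "\<dots> \<in> fs.span T"
        by (intro fs.span_sum) (auto intro!: fs.span_scale all)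
      finally show "x \<in> fs.span T" using * \<beta>s by simp
    qed
  qed (rule fs.subspace_span)
  moreover have "finite T" unfolding T_def using finK by simp
  ultimately show thesis using that cT by blast
qed

section \<open>Covector fields on open sets\<close>

definition covector_field :: "'e::euclidean_space set \<Rightarrow> ('e \<Rightarrow> 'e \<Rightarrow> complex) \<Rightarrow> bool" where
  "covector_field S \<theta> \<longleftrightarrow> (\<forall>y\<in>S. linear (\<theta> y)) \<and> (\<forall>v. smooth_on S (\<lambda>y. \<theta> y v))"

definition d_covector :: "('e::euclidean_space \<Rightarrow> 'e \<Rightarrow> complex) \<Rightarrow> 'e \<Rightarrow> 'e cform" where
  "d_covector \<theta> y = ext_deriv (\<lambda>z. wedge [\<theta> z]) y"

text \<open>On fields of type \<open>(1,0)\<close> this is \<open>mubar\<close>, on fields of type \<open>(0,1)\<close> it is \<open>dbar\<close>, so that both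
  operators are instances of one formula.\<close>

definition d02 :: "('e \<Rightarrow> 'e \<Rightarrow> 'e) \<Rightarrow> ('e::euclidean_space \<Rightarrow> 'e \<Rightarrow> complex) \<Rightarrow> 'e \<Rightarrow> 'e cform" where
  "d02 J \<theta> y = part_02 (J y) (d_covector \<theta> y)"

lemma d_covector_eq:
  "d_covector \<theta> y = (\<lambda>vs. case vs of [v, w] \<Rightarrow> pd v (\<lambda>z. \<theta> z w) y - pd w (\<lambda>z. \<theta> z v) y | _ \<Rightarrow> 0)"
proof
  fix vs :: "'a list"
  consider "vs = []" | v where "vs = [v]" | v w where "vs = [v, w]" | u v w ws where "vs = u # v # w # ws"
    by (metis list.exhaust)
  then show "d_covector \<theta> y vs = (case vs of [v, w] \<Rightarrow> pd v (\<lambda>z. \<theta> z w) y - pd w (\<lambda>z. \<theta> z v) y | _ \<Rightarrow> 0)"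
  proof cases
    case 1
    then show ?thesis by (simp add: d_covector_def ext_deriv_def)
  next
    case 2
    then show ?thesis by (simp add: d_covector_def ext_deriv_def wedge_1 pd_const)
  next
    case 3
    then show ?thesis by (simp add: d_covector_def ext_deriv_def wedge_1 lessThan_Suc)
  next
    case 4
    have "wedge [\<theta> z] (take i vs @ drop (Suc i) vs) = 0" if "i < length vs" for z i
      by (rule wedge_length) (use 4 that in auto)
    then show ?thesis using 4 by (simp add: d_covector_def ext_deriv_def pd_const del: take_Suc_Cons drop_Suc_Cons cong: sum.cong_simp)
  qed
qed

lemma d_covector_cong:
  assumes "open S" "y \<in> S" "\<And>z. z \<in> S \<Longrightarrow> \<theta> z = \<theta>' z"
  shows "d_covector \<theta> y = d_covector \<theta>' y"
proof -
  have "pd v (\<lambda>z. \<theta> z w) y = pd v (\<lambda>z. \<theta>' z w) y" for v w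
    by (rule fun_cong[OF frechet_derivative_cong_open[OF assms(1,2)]]) (simp add: assms(3))
  then show ?thesis by (auto simp: d_covector_eq fun_eq_iff split: list.splits)
qed

lemma d02_cong:
  assumes "open S" "y \<in> S" "\<And>z. z \<in> S \<Longrightarrow> \<theta> z = \<theta>' z"
  shows "d02 J \<theta> y = d02 J \<theta>' y"
  using d_covector_cong[OF assms] by (simp add: d02_def)

lemma d02_zero: "d02 J (\<lambda>z v. 0) y = 0"
  by (auto simp: d02_def d_covector_eq part_02_def fun_eq_iff pd_const split: list.splits)

lemma covector_field_differentiable:
  "covector_field S \<theta> \<Longrightarrow> open S \<Longrightarrow> y \<in> S \<Longrightarrow> (\<lambda>z. \<theta> z v) differentiable at y"
  by (auto simp: covector_field_def intro: smooth_on_differentiable)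

lemma d_covector_decomposition:
  assumes S: "open S" "y \<in> S" and \<theta>: "covector_field S \<theta>"
  shows "d_covector \<theta> y = (\<Sum>b\<in>Basis. wedge [\<lambda>v. pd v (\<lambda>z. \<theta> z b) y, covector b])"
proof
  fix vs :: "'a list"
  have e: "pd v (\<lambda>z. \<theta> z w) y = (\<Sum>b\<in>Basis. pd v (\<lambda>z. \<theta> z b) y * covector b w)" for v w
  proof -
    have "pd v (\<lambda>z. \<theta> z w) y = pd v (\<lambda>z. \<Sum>b\<in>Basis. covector b w * \<theta> z b) y"
      by (rule fun_cong[OF frechet_derivative_cong_open[OF S]])
         (use \<theta> in \<open>auto simp: covector_field_def mult.commute[of "covector _ _"] intro: linear_expand_basis\<close>)
    also have "\<dots> = (\<Sum>b\<in>Basis. pd v (\<lambda>z. covector b w * \<theta> z b) y)"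
      using \<theta> by (intro pd_sum smooth_on_differentiable[OF smooth_on_mult[OF S(1) smooth_on_const[OF S(1)]] S])
        (simp add: covector_field_def)
    also have "\<dots> = (\<Sum>b\<in>Basis. covector b w * pd v (\<lambda>z. \<theta> z b) y)"
      by (intro sum.cong refl pd_cmult covector_field_differentiable[OF \<theta> S])
    finally show ?thesis by (simp add: mult.commute)
  qed
  show "d_covector \<theta> y vs = (\<Sum>b\<in>Basis. wedge [\<lambda>v. pd v (\<lambda>z. \<theta> z b) y, covector b]) vs"
  proof (cases "length vs = 2")
    case True
    then obtain v w where vs: "vs = [v, w]" by (auto simp: numeral_2_eq_2 length_Suc_conv)
    show ?thesis
      unfolding vs by (simp add: d_covector_eq e[of v w] e[of w v] wedge_2 sum_fun_apply sum_subtractf)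
  qed (auto simp: d_covector_eq sum_fun_apply wedge_length split: list.splits)
qed

lemma
  assumes S: "open S" "y \<in> S" and \<theta>: "covector_field S \<theta>" and J: "complex_structure (J y)"
  shows pq_part_02_d_covector: "pq_part (J y) 0 2 (d_covector \<theta> y) = d02 J \<theta> y"
    and d02_in_forms_at: "d02 J \<theta> y \<in> forms_at (J y) 0 2"
proof -
  have *: "linear (\<lambda>v. pd v (\<lambda>z. \<theta> z b) y)" for b
    by (rule linear_pd[OF covector_field_differentiable[OF \<theta> S]])
  show "pq_part (J y) 0 2 (d_covector \<theta> y) = d02 J \<theta> y" "d02 J \<theta> y \<in> forms_at (J y) 0 2"
    unfolding d02_def d_covector_decomposition[OF S \<theta>]
    by (rule pq_part_02[OF J]; simp add: * linear_covector)+
qed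

lemma part_02_add: "part_02 J (\<theta> + \<eta>) = part_02 J \<theta> + part_02 J \<eta>"
  by (auto simp: part_02_def fun_eq_iff add_divide_distrib diff_divide_distrib algebra_simps split: list.splits)

lemma part_02_fscale: "part_02 J (fscale c \<theta>) = fscale c (part_02 J \<theta>)"
  by (auto simp: part_02_def fun_eq_iff fscale_def algebra_simps split: list.splits)

lemma proj01_A10: "complex_structure J \<Longrightarrow> \<alpha> \<in> A10 J \<Longrightarrow> proj01 J \<alpha> = (\<lambda>v. 0)"
  by (auto simp: proj01_def A10_iff fun_eq_iff)

text \<open>On fields of type \<open>(1,0)\<close> the operator is linear over functions: the additional term \<open>dh \<and> \<theta>\<close> of
  the Leibniz rule has no component of type \<open>(0,2)\<close>.\<close>

lemma d02_mult:
  assumes S: "open S" "y \<in> S" and \<theta>: "covector_field S \<theta>" and h: "smooth_on S h"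
    and J: "complex_structure (J y)" and "\<theta> y \<in> A10 (J y)"
  shows "d02 J (\<lambda>z v. h z * \<theta> z v) y = fscale (h y) (d02 J \<theta> y)"
proof -
  have "pd v (\<lambda>z. h z * \<theta> z w) y = h y * pd v (\<lambda>z. \<theta> z w) y + pd v h y * \<theta> y w" for v w
    by (rule pd_mult[OF smooth_on_differentiable[OF h S] covector_field_differentiable[OF \<theta> S]])
  then have "d_covector (\<lambda>z v. h z * \<theta> z v) y = fscale (h y) (d_covector \<theta> y) + wedge [\<lambda>v. pd v h y, \<theta> y]"
    by (auto simp: fun_eq_iff d_covector_eq fscale_def wedge_2 algebra_simps split: list.splits)
  moreover have "part_02 (J y) (wedge [\<lambda>v. pd v h y, \<theta> y]) = 0"
    unfolding part_02_wedge proj01_A10[OF J assms(6)] by (auto simp: wedge_2 fun_eq_iff split: list.splits)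
  ultimately show ?thesis by (simp add: d02_def part_02_add part_02_fscale)
qed

lemma d02_sum:
  assumes S: "open S" "y \<in> S" and \<theta>: "\<And>i. i \<in> I \<Longrightarrow> covector_field S (\<theta> i)"
  shows "d02 J (\<lambda>z v. \<Sum>i\<in>I. \<theta> i z v) y = (\<Sum>i\<in>I. d02 J (\<theta> i) y)"
proof -
  have "pd v (\<lambda>z. \<Sum>i\<in>I. \<theta> i z w) y = (\<Sum>i\<in>I. pd v (\<lambda>z. \<theta> i z w) y)" for v w
    by (rule pd_sum) (rule covector_field_differentiable[OF \<theta> S])
  then have "d_covector (\<lambda>z v. \<Sum>i\<in>I. \<theta> i z v) y = (\<Sum>i\<in>I. d_covector (\<theta> i) y)"
    by (auto simp: fun_eq_iff d_covector_eq sum_fun_apply sum_subtractf split: list.splits)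
  then show ?thesis by (simp add: d02_def part_02_sum)
qed

definition complex_structure_field :: "'e::euclidean_space set \<Rightarrow> ('e \<Rightarrow> 'e \<Rightarrow> 'e) \<Rightarrow> bool" where
  "complex_structure_field S J \<longleftrightarrow> (\<forall>y\<in>S. complex_structure (J y)) \<and> (\<forall>v. smooth_on S (\<lambda>y. J y v))"

lemma covector_field_mult:
  assumes "open S" "smooth_on S h" "covector_field S \<theta>"
  shows "covector_field S (\<lambda>z v. h z * \<theta> z v)"
proof -
  have "linear (\<lambda>v. h y * \<theta> y v)" if "y \<in> S" for y
    using assms(3) that linear_compose[of "\<theta> y" "\<lambda>z. h y * z"]
    by (simp add: covector_field_def o_def bounded_linear.linear bounded_linear_mult_right)
  then show ?thesis using assms by (auto simp: covector_field_def intro: smooth_on_mult)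
qed

lemma covector_field_sum:
  assumes "open S" "finite I" "\<And>i. i \<in> I \<Longrightarrow> covector_field S (\<theta> i)"
  shows "covector_field S (\<lambda>z v. \<Sum>i\<in>I. \<theta> i z v)"
  using assms by (auto simp: covector_field_def intro!: smooth_on_sum linear_compose_sum)

lemma covector_field_half_combination:
  assumes S: "open S" and J: "complex_structure_field S J" and \<alpha>: "linear \<alpha>"
  shows "covector_field S (\<lambda>y v. (\<alpha> v + c * \<alpha> (J y v)) / 2)"
proof -
  have "smooth_on S (\<lambda>y. (\<alpha> v + c * \<alpha> (J y v)) * (1/2))" for v
    using J by (intro smooth_on_mult smooth_on_add smooth_on_const S smooth_on_linear[OF S linear_conv_bounded_linear[THEN iffD1, OF \<alpha>]])
      (auto simp: complex_structure_field_def)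
  then show ?thesis
    using J linear_half_combination[OF _ \<alpha>]
    by (auto simp: covector_field_def complex_structure_field_def complex_structure_def)
qed

lemma covector_field_proj10:
  "open S \<Longrightarrow> complex_structure_field S J \<Longrightarrow> linear \<alpha> \<Longrightarrow> covector_field S (\<lambda>y. proj10 (J y) \<alpha>)"
  using covector_field_half_combination[of S J \<alpha> "-\<i>"] by (simp add: proj10_def)

lemma covector_field_proj01:
  "open S \<Longrightarrow> complex_structure_field S J \<Longrightarrow> linear \<alpha> \<Longrightarrow> covector_field S (\<lambda>y. proj01 (J y) \<alpha>)"
  using covector_field_half_combination[of S J \<alpha> "\<i>"] by (simp add: proj01_def)

lemma A10_expand:
  fixes \<alpha> :: "'e::euclidean_space \<Rightarrow> complex"
  assumes J: "complex_structure J" and \<alpha>: "\<alpha> \<in> A10 J"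
  shows "\<alpha> = (\<lambda>v. \<Sum>b\<in>Basis. \<alpha> b * proj10 J (covector b) v)"
proof
  fix v
  have l: "\<alpha> v = (\<Sum>b\<in>Basis. \<alpha> b * covector b v)" for v by (rule linear_expand_basis[OF linear_if_A10[OF \<alpha>]])
  have "\<alpha> v = proj10 J \<alpha> v" by (simp add: proj10_fixes_A10[OF J \<alpha>])
  also have "\<dots> = (\<Sum>b\<in>Basis. \<alpha> b * proj10 J (covector b) v)"
    unfolding proj10_def l[of v] l[of "J v"]
    by (simp add: sum_distrib_left sum_subtractf[symmetric] sum_divide_distrib algebra_simps)
  finally show "\<alpha> v = (\<Sum>b\<in>Basis. \<alpha> b * proj10 J (covector b) v)" .
qed

text \<open>Linearity over functions makes the value at a point depend only on the value of the field at this
  point. Here the field is written as a combination of the fields \<open>proj10 (J z) (covector b)\<close> with coefficients that vanish at the point.\<close>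

lemma d02_eq_0_if_zero_at:
  assumes S: "open S" "y \<in> S" and J: "complex_structure_field S J" and \<theta>: "covector_field S \<theta>"
    and type: "\<And>z. z \<in> S \<Longrightarrow> \<theta> z \<in> A10 (J z)" and zero: "\<And>v. \<theta> y v = 0"
  shows "d02 J \<theta> y = 0"
proof -
  let ?e = "\<lambda>b z v. \<theta> z b * proj10 (J z) (covector b) v"
  have Jz: "complex_structure (J z)" if "z \<in> S" for z using J that by (simp add: complex_structure_field_def)
  have p: "covector_field S (\<lambda>z. proj10 (J z) (covector b))" for b
    by (rule covector_field_proj10[OF S(1) J linear_covector])
  have h: "smooth_on S (\<lambda>z. \<theta> z b)" for b using \<theta> by (simp add: covector_field_def)
  have "d02 J \<theta> y = d02 J (\<lambda>z v. \<Sum>b\<in>Basis. ?e b z v) y"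
    by (rule d02_cong[OF S]) (rule A10_expand[OF Jz type])
  also have "\<dots> = (\<Sum>b\<in>Basis. d02 J (?e b) y)"
    by (rule d02_sum[OF S]) (rule covector_field_mult[OF S(1) h p])
  also have "\<dots> = (\<Sum>b\<in>Basis. fscale (\<theta> y b) (d02 J (\<lambda>z. proj10 (J z) (covector b)) y))"
  proof (rule sum.cong[OF refl])
    fix b
    show "d02 J (?e b) y = fscale (\<theta> y b) (d02 J (\<lambda>z. proj10 (J z) (covector b)) y)"
      by (rule d02_mult[where J = J and y = y and \<theta> = "\<lambda>z. proj10 (J z) (covector b)" and h = "\<lambda>z. \<theta> z b",
            OF S p h Jz[OF S(2)] proj10_in_A10[OF Jz[OF S(2)] linear_covector]])
  qed
  also have "\<dots> = 0" by (simp add: zero fscale_def fun_eq_iff sum_fun_apply)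
  finally show ?thesis .
qed

lemma smooth_on_directional:
  assumes S: "open S" and f: "smooth_on S f" and V: "smooth_on S V"
  shows "smooth_on S (\<lambda>y. pd (V y) f y)"
proof -
  have "smooth_on S (\<lambda>y. \<Sum>b\<in>Basis. (V y \<bullet> b) *\<^sub>R pd b f y)"
    by (intro smooth_on_sum smooth_on_scaleR smooth_on_inner_left S V smooth_on_pd f finite_Basis)
  then show ?thesis
    by (subst smooth_on_cong[OF S pd_expand_basis[OF smooth_on_differentiable[OF f S]]])
qed

lemma smooth_on_d_covector:
  assumes S: "open S" and \<theta>: "covector_field S \<theta>" and V: "smooth_on S V" and W: "smooth_on S W"
  shows "smooth_on S (\<lambda>y. d_covector \<theta> y [V y, W y])"
proof -
  have "smooth_on S (\<lambda>y. \<Sum>b\<in>Basis. pd (V y) (\<lambda>z. \<theta> z b) y * complex_of_real (W y \<bullet> b)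
      - pd (W y) (\<lambda>z. \<theta> z b) y * complex_of_real (V y \<bullet> b))"
    using \<theta> by (intro smooth_on_sum smooth_on_diff smooth_on_mult smooth_on_of_real smooth_on_inner_left S V W
        smooth_on_directional) (auto simp: covector_field_def)
  then show ?thesis
    by (subst smooth_on_cong[OF S]) (auto simp: d_covector_decomposition[OF S _ \<theta>] sum_fun_apply wedge_2 covector_def)
qed

lemma smooth_on_d02:
  assumes S: "open S" and J: "complex_structure_field S J" and \<theta>: "covector_field S \<theta>"
  shows "smooth_on S (\<lambda>y. d02 J \<theta> y [a, b])"
proof -
  have "smooth_on S (\<lambda>y. (d_covector \<theta> y [a, b] + \<i> * d_covector \<theta> y [J y a, b]
      + \<i> * d_covector \<theta> y [a, J y b] - d_covector \<theta> y [J y a, J y b]) * (1 / 4))"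
    using J by (intro smooth_on_mult smooth_on_add smooth_on_diff smooth_on_const S smooth_on_d_covector \<theta>)
      (auto simp: complex_structure_field_def)
  then show ?thesis by (simp add: d02_def part_02_def)
qed

section \<open>Systems of equations with small coefficients\<close>

text \<open>The matrix \<open>T\<close> is a left inverse of \<open>1 - R\<close>, in a form suited to elimination of unknowns.\<close>

definition solves_system :: "'p set \<Rightarrow> ('p \<Rightarrow> 'p \<Rightarrow> complex) \<Rightarrow> ('p \<Rightarrow> 'p \<Rightarrow> complex) \<Rightarrow> bool" where
  "solves_system P R T \<longleftrightarrow>
     (\<forall>e u. (\<forall>p\<in>P. e p = u p + (\<Sum>q\<in>P. R p q * e q)) \<longrightarrow> (\<forall>p\<in>P. e p = (\<Sum>q\<in>P. T p q * u q)))"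

lemma solves_systemD:
  assumes "solves_system P R T" "\<And>p. p \<in> P \<Longrightarrow> e p = u p + (\<Sum>q\<in>P. R p q * e q)" "p \<in> P"
  shows "e p = (\<Sum>q\<in>P. T p q * u q)"
  using assms unfolding solves_system_def by blast

text \<open>A system \<open>e = u + R e\<close> can be solved for \<open>e\<close> near a point where \<open>R\<close> vanishes, with smooth
  coefficients. The proof eliminates one unknown \<open>e z\<close> at a time; the coefficients that remain,
  \<open>R p q + R p z * R z q / (1 - R z z)\<close>, vanish at the point as well.\<close>

lemma smooth_solution_near:
  fixes R :: "'p \<Rightarrow> 'p \<Rightarrow> 'a::euclidean_space \<Rightarrow> complex"
  assumes "finite P" and "open S" "y \<in> S"
    and "\<And>p q. p \<in> P \<Longrightarrow> q \<in> P \<Longrightarrow> smooth_on S (R p q)"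
    and "\<And>p q. p \<in> P \<Longrightarrow> q \<in> P \<Longrightarrow> R p q y = 0"
  shows "\<exists>U T. open U \<and> y \<in> U \<and> U \<subseteq> S \<and> (\<forall>p\<in>P. \<forall>q\<in>P. smooth_on U (T p q)) \<and>
     (\<forall>x\<in>U. solves_system P (\<lambda>p q. R p q x) (\<lambda>p q. T p q x))"
  using assms
proof (induction P arbitrary: S R rule: finite_induct)
  case empty
  then show ?case by (auto simp: solves_system_def)
next
  case (insert z P)
  note S = \<open>open S\<close> \<open>y \<in> S\<close>
  \<comment> \<open>The pivot is invertible on this neighbourhood.\<close>
  define S' where "S' = {x \<in> S. 1 - R z z x \<noteq> 0}"
  have cont: "continuous_on S (\<lambda>x. 1 - R z z x)"
    using insert.prems(3)[of z z] by (intro smooth_on_continuous smooth_on_diff smooth_on_const S(1)) auto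
  have S': "open S'" "y \<in> S'" "S' \<subseteq> S"
  proof -
    have "open (S \<inter> (\<lambda>x. 1 - R z z x) -` (- {0}))"
      using cont S(1) by (intro continuous_open_preimage) auto
    moreover have "S' = S \<inter> (\<lambda>x. 1 - R z z x) -` (- {0})" by (auto simp: S'_def)
    ultimately show "open S'" by simp
    show "y \<in> S'" using S insert.prems(4)[of z z] by (simp add: S'_def)
  qed (auto simp: S'_def)
  define i where "i x = inverse (1 - R z z x)" for x
  have R: "smooth_on S' (R p q)" if "p \<in> insert z P" "q \<in> insert z P" for p q
    by (rule smooth_on_subset[OF insert.prems(3)[OF that] S'(3)])
  have i: "smooth_on S' i"
    unfolding i_def
  proof (rule smooth_on_inverse[OF S'(1)])
    show "smooth_on S' (\<lambda>x. 1 - R z z x)" by (intro smooth_on_diff smooth_on_const S'(1) R) auto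
  qed (simp add: S'_def)
  define R' where "R' p q x = R p q x + R p z x * i x * R z q x" for p q x
  have "\<exists>U T. open U \<and> y \<in> U \<and> U \<subseteq> S' \<and> (\<forall>p\<in>P. \<forall>q\<in>P. smooth_on U (T p q)) \<and>
     (\<forall>x\<in>U. solves_system P (\<lambda>p q. R' p q x) (\<lambda>p q. T p q x))"
  proof (rule insert.IH[OF S'(1,2)])
    fix p q assume "p \<in> P" "q \<in> P"
    then show "smooth_on S' (R' p q)" "R' p q y = 0"
      unfolding R'_def using insert.prems(4)
      by (auto intro!: smooth_on_add smooth_on_mult S'(1) R i)
  qed
  then obtain U T where U: "open U" "y \<in> U" "U \<subseteq> S'"
    and T0: "\<forall>p\<in>P. \<forall>q\<in>P. smooth_on U (T p q)"
    and sol0: "\<forall>x\<in>U. solves_system P (\<lambda>p q. R' p q x) (\<lambda>p q. T p q x)"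
    by (elim exE conjE) (rule that)
  note T = T0[rule_format] and sol = sol0[rule_format]
  define Tz where "Tz p x = (\<Sum>q\<in>P. T p q x * (R q z x * i x))" for p x
  define T' where "T' p q x = (if p = z then
       (if q = z then i x + i x * (\<Sum>r\<in>P. R z r x * Tz r x) else i x * (\<Sum>r\<in>P. R z r x * T r q x))
     else (if q = z then Tz p x else T p q x))" for p q x
  have RU: "smooth_on U (R p q)" if "p \<in> insert z P" "q \<in> insert z P" for p q
    by (rule smooth_on_subset[OF R[OF that] U(3)])
  have iU: "smooth_on U i" by (rule smooth_on_subset[OF i U(3)])
  have TzU: "smooth_on U (Tz p)" if "p \<in> P" for p
    unfolding Tz_def using that by (intro smooth_on_sum smooth_on_mult U(1) T RU iU insert.hyps) auto
  have "smooth_on U (T' p q)" if "p \<in> insert z P" "q \<in> insert z P" for p q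
  proof -
    have 1: "smooth_on U (\<lambda>x. i x + i x * (\<Sum>r\<in>P. R z r x * Tz r x))"
      by (intro smooth_on_add smooth_on_mult smooth_on_sum iU RU TzU U(1) insert.hyps) auto
    have 2: "smooth_on U (\<lambda>x. i x * (\<Sum>r\<in>P. R z r x * T r q x))" if "q \<in> P" for q
      using that by (intro smooth_on_mult smooth_on_sum iU RU T U(1) insert.hyps) auto
    show ?thesis
      unfolding T'_def using that 1 2 T TzU by (cases "p = z"; cases "q = z") auto
  qed
  moreover have solved: "\<forall>p\<in>insert z P. e p = (\<Sum>q\<in>insert z P. T' p q x * u q)"
    if x: "x \<in> U" and e: "\<forall>p\<in>insert z P. e p = u p + (\<Sum>q\<in>insert z P. R p q x * e q)" for x e u
  proof -
    have nz: "1 - R z z x \<noteq> 0" using x U(3) by (auto simp: S'_def)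
    have ez: "e z = i x * (u z + (\<Sum>q\<in>P. R z q x * e q))"
    proof -
      have "e z = u z + (R z z x * e z + (\<Sum>q\<in>P. R z q x * e q))"
        using e[rule_format, OF insertI1] unfolding sum.insert[OF insert.hyps] .
      then have "(1 - R z z x) * e z = u z + (\<Sum>q\<in>P. R z q x * e q)" by (simp add: algebra_simps)
      then show ?thesis using nz by (simp add: i_def field_simps)
    qed
    have ep: "e p = (\<Sum>q\<in>P. T p q x * (u q + R q z x * i x * u z))" if "p \<in> P" for p
    proof (rule solves_systemD[OF sol[OF x] _ that])
      fix p assume p: "p \<in> P"
      have "e p = u p + (R p z x * e z + (\<Sum>q\<in>P. R p q x * e q))"
        using e[rule_format, OF insertI2[OF p]] unfolding sum.insert[OF insert.hyps] .
      also have "\<dots> = (u p + R p z x * i x * u z) + (\<Sum>q\<in>P. R' p q x * e q)"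
        by (subst ez) (simp add: R'_def algebra_simps sum.distrib sum_distrib_left)
      finally show "e p = (u p + R p z x * i x * u z) + (\<Sum>q\<in>P. R' p q x * e q)" .
    qed
    have ep': "e p = Tz p x * u z + (\<Sum>q\<in>P. T p q x * u q)" if "p \<in> P" for p
      unfolding ep[OF that] Tz_def by (simp add: algebra_simps sum.distrib sum_distrib_left)
    have "e z = i x * (u z + (\<Sum>r\<in>P. R z r x * (Tz r x * u z + (\<Sum>q\<in>P. T r q x * u q))))"
    proof -
      have "(\<Sum>q\<in>P. R z q x * e q) = (\<Sum>r\<in>P. R z r x * (Tz r x * u z + (\<Sum>q\<in>P. T r q x * u q)))"
        by (intro sum.cong refl) (simp only: ep')
      from ez[unfolded this] show ?thesis .
    qed
    also have "\<dots> = (i x + i x * (\<Sum>r\<in>P. R z r x * Tz r x)) * u z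
        + i x * (\<Sum>r\<in>P. \<Sum>q\<in>P. R z r x * T r q x * u q)"
      by (simp add: algebra_simps sum.distrib sum_distrib_left)
    also have "(\<Sum>r\<in>P. \<Sum>q\<in>P. R z r x * T r q x * u q) = (\<Sum>q\<in>P. (\<Sum>r\<in>P. R z r x * T r q x) * u q)"
      by (subst sum.swap) (simp add: sum_distrib_right)
    also have "i x * (\<Sum>q\<in>P. (\<Sum>r\<in>P. R z r x * T r q x) * u q) = (\<Sum>q\<in>P. (i x * (\<Sum>r\<in>P. R z r x * T r q x)) * u q)"
    proof -
      have "i x * (\<Sum>q\<in>P. A q * u q) = (\<Sum>q\<in>P. (i x * A q) * u q)" for A
        by (simp add: sum_distrib_left mult.assoc)
      then show ?thesis .
    qed
    finally have ez': "e z = (i x + i x * (\<Sum>r\<in>P. R z r x * Tz r x)) * u z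
        + (\<Sum>q\<in>P. (i x * (\<Sum>r\<in>P. R z r x * T r q x)) * u q)" .
    show ?thesis
    proof
      fix p assume p: "p \<in> insert z P"
      have nz: "q \<noteq> z" if "q \<in> P" for q using that insert.hyps by auto
      show "e p = (\<Sum>q\<in>insert z P. T' p q x * u q)"
      proof (cases "p = z")
        case True
        have "(\<Sum>q\<in>P. T' z q x * u q) = (\<Sum>q\<in>P. (i x * (\<Sum>r\<in>P. R z r x * T r q x)) * u q)"
          using nz by (intro sum.cong refl) (simp add: T'_def)
        then show ?thesis using True ez' insert.hyps by (simp add: T'_def)
      next
        case False
        have "(\<Sum>q\<in>P. T' p q x * u q) = (\<Sum>q\<in>P. T p q x * u q)"
          using nz False by (intro sum.cong refl) (simp add: T'_def)
        then show ?thesis using False p ep'[of p] insert.hyps by (simp add: T'_def)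
      qed
    qed
  qed
  moreover have "solves_system (insert z P) (\<lambda>p q. R p q x) (\<lambda>p q. T' p q x)" if "x \<in> U" for x
    unfolding solves_system_def using solved[OF that] by (intro allI impI)
  ultimately show ?case using U S'(3) by (intro exI[of _ U] exI[of _ T']) simp
qed

section \<open>Local surjectivity of mubar\<close>

lemma smooth_on_extend_by_zero:
  fixes h :: "'a::euclidean_space \<Rightarrow> complex"
  assumes "open S" "open U" "U \<subseteq> S" "closed K" "S \<inter> K \<subseteq> U" "smooth_on U h" "\<And>y. y \<in> U - K \<Longrightarrow> h y = 0"
  shows "smooth_on S (\<lambda>y. if y \<in> U then h y else 0)"
proof -
  let ?h = "\<lambda>y. if y \<in> U then h y else 0"
  have "smooth_on U ?h" using assms(6) by (subst smooth_on_cong[OF assms(2), of _ h]) auto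
  moreover have o: "open (S - K)" using assms by auto
  moreover have "smooth_on (S - K) ?h"
    using smooth_on_const[OF o, of 0] by (subst smooth_on_cong[OF o, of _ "\<lambda>y. 0"]) (use assms(7) in auto)
  moreover have "U \<union> (S - K) = S" using assms by auto
  ultimately show ?thesis using smooth_on_Un[OF assms(2) o] by fastforce
qed

text \<open>Nakayama's lemma for the sections \<open>d02 J (\<alpha> i)\<close>. The generators \<open>e p\<close> of
  the \<open>(0,2)\<close>-forms are combinations of these sections at the point \<open>y0\<close>. With the same constant coefficients
  elsewhere there remains an error, which is a combination of the \<open>e p\<close> with coefficients \<open>R p q\<close> that vanish
  at \<open>y0\<close>; solving for \<open>e\<close> expresses the generators by the sections on a neighbourhood. The
  coefficients of \<open>d02 J \<theta>\<close> inherit the support of \<open>\<theta>\<close>, and \<open>\<phi>\<close> is the corresponding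
  combination of the \<open>\<alpha> i\<close>, because the operator is linear over functions on fields of type \<open>(1,0)\<close>.\<close>

lemma mubar_onto_locally:
  fixes J :: "'e::euclidean_space \<Rightarrow> 'e \<Rightarrow> 'e"
  assumes S: "open S" "y0 \<in> S" and J: "complex_structure_field S J" and I: "finite I"
    and \<alpha>: "\<And>i. i \<in> I \<Longrightarrow> covector_field S (\<alpha> i)"
    and type: "\<And>i y. i \<in> I \<Longrightarrow> y \<in> S \<Longrightarrow> \<alpha> i y \<in> A10 (J y)"
    and gen: "forms_at (J y0) 0 2 \<subseteq> fs.span ((\<lambda>i. d02 J (\<alpha> i) y0) ` I)"
  obtains U where "open U" "y0 \<in> U" "U \<subseteq> S"
    "\<And>K \<theta>. closed K \<Longrightarrow> K \<subseteq> U \<Longrightarrow> covector_field S \<theta> \<Longrightarrow> (\<And>y v. y \<in> S - K \<Longrightarrow> \<theta> y v = 0) \<Longrightarrow>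
       \<exists>\<phi>. covector_field S \<phi> \<and> (\<forall>y\<in>S. \<phi> y \<in> A10 (J y)) \<and> (\<forall>y\<in>S - K. \<forall>v. \<phi> y v = 0) \<and>
         (\<forall>y\<in>S. d02 J \<phi> y = d02 J \<theta> y)"
proof -
  let ?P = "Basis \<times> Basis :: ('e \<times> 'e) set"
  have Jy: "complex_structure (J y)" if "y \<in> S" for y using J that by (simp add: complex_structure_field_def)
  define s where "s i y = d02 J (\<alpha> i) y" for i y
  define e where "e p y = part_02 (J y) (wedge [covector (fst p), covector (snd p)])" for p :: "'e \<times> 'e" and y
  have e_in: "e p y \<in> forms_at (J y) 0 2" if "y \<in> S" for p y
    using pq_part_02(2)[OF Jy[OF that], of "{()}" "\<lambda>_. covector (fst p)" "\<lambda>_. covector (snd p)"]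
    by (simp add: e_def linear_covector)
  have s_in: "s i y \<in> forms_at (J y) 0 2" if "i \<in> I" "y \<in> S" for i y
    unfolding s_def by (rule d02_in_forms_at[where J = J, OF S(1) that(2) \<alpha>[OF that(1)] Jy[OF that(2)]])
  have expand: "\<theta> = (\<Sum>p\<in>?P. fscale (\<theta> [fst p, snd p] / 2) (e p y))" if "y \<in> S" "\<theta> \<in> forms_at (J y) 0 2" for \<theta> y
    using part_02_expand[OF Jy[OF that(1)] that(2)] by (simp add: e_def case_prod_unfold)
  have "\<exists>C. e p y0 = (\<Sum>i\<in>I. fscale (C i) (s i y0))" for p
  proof -
    have "e p y0 \<in> fs.span ((\<lambda>i. s i y0) ` I)" using subsetD[OF gen e_in[OF S(2)]] unfolding s_def .
    then obtain u where u: "e p y0 = (\<Sum>v\<in>(\<lambda>i. s i y0) ` I. fscale (u v) v)"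
      unfolding fs.span_finite[OF finite_imageI[OF I]] by (rule rangeE)
    obtain I' where I': "I' \<subseteq> I" "inj_on (\<lambda>i. s i y0) I'" "(\<lambda>i. s i y0) ` I = (\<lambda>i. s i y0) ` I'"
      using subset_image_inj[of "(\<lambda>i. s i y0) ` I" "\<lambda>i. s i y0" I] by auto
    have "e p y0 = (\<Sum>i\<in>I'. fscale (u (s i y0)) (s i y0))"
      unfolding u I'(3) by (simp add: sum.reindex[OF I'(2)])
    also have "\<dots> = (\<Sum>i\<in>I. fscale (if i \<in> I' then u (s i y0) else 0) (s i y0))"
      by (rule sum.mono_neutral_cong_left[OF I I'(1)]) auto
    finally show ?thesis by (rule exI[of _ "\<lambda>i. if i \<in> I' then u (s i y0) else 0"])
  qed
  then obtain C where C: "\<And>p. e p y0 = (\<Sum>i\<in>I. fscale (C p i) (s i y0))" by metis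
  \<comment> \<open>The error of the representation with constant coefficients, and its own coefficients.\<close>
  define r where "r p y = e p y - (\<Sum>i\<in>I. fscale (C p i) (s i y))" for p y
  define R where "R p q y = r p y [fst q, snd q] / 2" for p q y
  have r_in: "r p y \<in> forms_at (J y) 0 2" if "y \<in> S" for p y
    unfolding r_def
    by (intro fs.subspace_diff fs.subspace_sum fs.subspace_scale subspace_forms_at e_in s_in that)
  have e_smooth: "smooth_on S (\<lambda>y. e p y [a, b])" for p a b
  proof -
    have "smooth_on S (\<lambda>y. proj01 (J y) (covector c) v)" for c v
      using covector_field_proj01[OF S(1) J linear_covector[of c]] by (simp add: covector_field_def)
    then show ?thesis
      unfolding e_def part_02_wedge unfolding wedge_2 by (auto intro!: smooth_on_diff smooth_on_mult S(1))
  qed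
  have R_smooth: "smooth_on S (R p q)" for p q
  proof -
    have "smooth_on S (\<lambda>y. (e p y [fst q, snd q] - (\<Sum>i\<in>I. C p i * s i y [fst q, snd q])) * (1/2))"
      unfolding s_def
      by (intro smooth_on_mult smooth_on_diff smooth_on_sum smooth_on_const S(1) I e_smooth smooth_on_d02 J \<alpha>)
    then show ?thesis by (simp add: R_def[abs_def] r_def sum_fun_apply fscale_def)
  qed
  have R0: "R p q y0 = 0" for p q
    by (simp add: R_def r_def C[of p])
  have finP: "finite ?P" by (intro finite_cartesian_product finite_Basis)
  obtain U T where U: "open U" "y0 \<in> U" "U \<subseteq> S" and T0: "\<forall>p\<in>?P. \<forall>q\<in>?P. smooth_on U (T p q)"
    and sol0: "\<forall>x\<in>U. solves_system ?P (\<lambda>p q. R p q x) (\<lambda>p q. T p q x)"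
    using smooth_solution_near[of ?P S y0 R, OF finP S R_smooth R0] by (elim exE conjE) (rule that)
  note T = T0[rule_format] and sol = sol0[rule_format]
  have e_sol: "e p y vs = (\<Sum>i\<in>I. (\<Sum>q\<in>?P. T p q y * C q i) * s i y vs)" if y: "y \<in> U" and p: "p \<in> ?P" for p y vs
  proof -
    have yS: "y \<in> S" using y U(3) by auto
    have "e p y vs = (\<Sum>q\<in>?P. T p q y * (\<Sum>i\<in>I. C q i * s i y vs))"
    proof (rule solves_systemD[OF sol[OF y] _ p])
      fix p
      have "r p y vs = (\<Sum>q\<in>?P. R p q y * e q y vs)"
        by (subst expand[OF yS r_in[OF yS]]) (simp add: sum_fun_apply fscale_def R_def)
      then show "e p y vs = (\<Sum>i\<in>I. C p i * s i y vs) + (\<Sum>q\<in>?P. R p q y * e q y vs)"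
        by (simp add: r_def sum_fun_apply fscale_def diff_eq_eq add.commute)
    qed
    also have "\<dots> = (\<Sum>q\<in>?P. \<Sum>i\<in>I. T p q y * C q i * s i y vs)"
      by (simp add: sum_distrib_left mult.assoc)
    also have "\<dots> = (\<Sum>i\<in>I. (\<Sum>q\<in>?P. T p q y * C q i) * s i y vs)"
      by (subst sum.swap) (simp add: sum_distrib_right)
    finally show ?thesis .
  qed
  show thesis
  proof (rule that[OF U])
    fix K \<theta> assume K: "closed K" "K \<subseteq> U" and \<theta>: "covector_field S \<theta>" and \<theta>0: "\<And>y v. y \<in> S - K \<Longrightarrow> \<theta> y v = 0"
    have SK: "open (S - K)" using S K by auto
    have d0: "d02 J \<theta> y = 0" if "y \<in> S - K" for y
    proof -
      have "d02 J \<theta> y = d02 J (\<lambda>z v. 0) y" by (rule d02_cong[OF SK that]) (use \<theta>0 in auto)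
      then show ?thesis by (simp add: d02_zero)
    qed
    define h where "h i y = (\<Sum>p\<in>?P. (d02 J \<theta> y [fst p, snd p] * (1/2)) * (\<Sum>q\<in>?P. T p q y * C q i))" for i y
    define g where "g i y = (if y \<in> U then h i y else 0)" for i y
    have h_smooth: "smooth_on U (h i)" for i
      unfolding h_def
      by (intro smooth_on_sum smooth_on_mult smooth_on_const U(1) T smooth_on_subset[OF smooth_on_d02[OF S(1) J \<theta>] U(3)]
          finite_cartesian_product finite_Basis)
    have h0: "h i y = 0" if "y \<in> U - K" for i y
      using d0[of y] that U(3) by (simp add: h_def subset_iff)
    have g_smooth: "smooth_on S (g i)" for i
      unfolding g_def
      by (rule smooth_on_extend_by_zero[OF S(1) U(1) U(3) K(1) _ h_smooth h0]) (use K in auto)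
    have g0: "g i y = 0" if "y \<in> S - K" for i y
      using h0 that by (auto simp: g_def)
    define \<phi> where "\<phi> y v = (\<Sum>i\<in>I. g i y * \<alpha> i y v)" for y v
    have g\<alpha>: "covector_field S (\<lambda>y v. g i y * \<alpha> i y v)" if "i \<in> I" for i
      by (rule covector_field_mult[OF S(1) g_smooth \<alpha>[OF that]])
    have \<phi>: "covector_field S \<phi>" unfolding \<phi>_def by (rule covector_field_sum[OF S(1) I g\<alpha>])
    have "\<phi> y \<in> A10 (J y)" if y: "y \<in> S" for y
    proof -
      have "\<alpha> i y (J y v) = \<i> * \<alpha> i y v" if "i \<in> I" for i v
        using type[OF that y] unfolding A10_iff[OF Jy[OF y]] by simp
      then have "\<phi> y (J y v) = \<i> * \<phi> y v" for v
        by (simp add: \<phi>_def sum_distrib_left mult.left_commute)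
      moreover have "linear (\<phi> y)" using \<phi> y by (simp add: covector_field_def)
      ultimately show ?thesis unfolding A10_iff[OF Jy[OF y]] by simp
    qed
    moreover have "\<phi> y v = 0" if "y \<in> S - K" for y v using g0[OF that] by (simp add: \<phi>_def)
    moreover have "d02 J \<phi> y = d02 J \<theta> y" if y: "y \<in> S" for y
    proof -
      have d: "d02 J \<phi> y = (\<Sum>i\<in>I. fscale (g i y) (s i y))"
        unfolding \<phi>_def s_def
        by (subst d02_sum[OF S(1) y g\<alpha>], assumption)
           (intro sum.cong refl d02_mult[where J = J, OF S(1) y \<alpha> g_smooth Jy[OF y] type[OF _ y]])
      show ?thesis
      proof (cases "y \<in> U")
        case True
        show ?thesis
        proof
          fix vs
          have "d02 J \<theta> y vs = (\<Sum>p\<in>?P. (d02 J \<theta> y [fst p, snd p] * (1/2)) * e p y vs)"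
            by (subst expand[OF y d02_in_forms_at[where J = J, OF S(1) y \<theta> Jy[OF y]]]) (simp add: sum_fun_apply fscale_def)
          also have "\<dots> = (\<Sum>p\<in>?P. (d02 J \<theta> y [fst p, snd p] * (1/2)) * (\<Sum>i\<in>I. (\<Sum>q\<in>?P. T p q y * C q i) * s i y vs))"
            using e_sol[OF True] by (intro sum.cong refl) simp
          also have "\<dots> = (\<Sum>p\<in>?P. \<Sum>i\<in>I. (d02 J \<theta> y [fst p, snd p] * (1/2)) * (\<Sum>q\<in>?P. T p q y * C q i) * s i y vs)"
          proof -
            have "a * (\<Sum>i\<in>I. B i * f i) = (\<Sum>i\<in>I. a * B i * f i)" for a and B f :: "_ \<Rightarrow> complex"
              by (simp add: sum_distrib_left mult.assoc)
            then show ?thesis by (simp only:)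
          qed
          also have "\<dots> = (\<Sum>i\<in>I. h i y * s i y vs)"
            unfolding h_def sum_distrib_right by (rule sum.swap)
          finally show "d02 J \<phi> y vs = d02 J \<theta> y vs"
            using True by (simp add: d sum_fun_apply fscale_def g_def)
        qed
      next
        case False
        then have "y \<in> S - K" using y K by auto
        then show ?thesis using d0 g0 by (simp add: d fun_eq_iff sum_fun_apply fscale_def)
      qed
    qed
    ultimately show "\<exists>\<phi>. covector_field S \<phi> \<and> (\<forall>y\<in>S. \<phi> y \<in> A10 (J y)) \<and> (\<forall>y\<in>S - K. \<forall>v. \<phi> y v = 0) \<and>
         (\<forall>y\<in>S. d02 J \<phi> y = d02 J \<theta> y)" using \<phi> by (intro exI[of _ \<phi>]) simp
  qed
qed

section \<open>Pullback of covector fields\<close>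

definition pullback :: "('e::euclidean_space \<Rightarrow> 'e) \<Rightarrow> ('e \<Rightarrow> 'e \<Rightarrow> complex) \<Rightarrow> 'e \<Rightarrow> 'e \<Rightarrow> complex" where
  "pullback \<tau> \<theta> y v = \<theta> (\<tau> y) (pd v \<tau> y)"

lemma pullback_expand:
  assumes "covector_field S \<theta>" "\<tau> y \<in> S"
  shows "pullback \<tau> \<theta> y v = (\<Sum>b\<in>Basis. \<theta> (\<tau> y) b * complex_of_real (pd v \<tau> y \<bullet> b))"
  using linear_expand_basis[of "\<theta> (\<tau> y)" "pd v \<tau> y"] assms by (simp add: pullback_def covector_field_def covector_def)

lemma covector_field_pullback:
  assumes W: "open W" and S: "open S" and \<tau>: "smooth_on W \<tau>" "\<tau> ` W \<subseteq> S" and \<theta>: "covector_field S \<theta>"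
  shows "covector_field W (pullback \<tau> \<theta>)"
proof -
  have "linear (pullback \<tau> \<theta> y)" if y: "y \<in> W" for y
  proof -
    have "linear (\<theta> (\<tau> y))" using \<theta> \<tau>(2) y by (auto simp: covector_field_def)
    then show ?thesis
      using linear_compose[OF linear_pd[OF smooth_on_differentiable[OF \<tau>(1) W y]]]
      by (simp add: pullback_def[abs_def] o_def)
  qed
  moreover have "smooth_on W (\<lambda>y. pullback \<tau> \<theta> y v)" for v
  proof -
    have "smooth_on W (\<lambda>y. \<Sum>b\<in>Basis. \<theta> (\<tau> y) b * complex_of_real (pd v \<tau> y \<bullet> b))"
      by (intro smooth_on_sum smooth_on_mult smooth_on_of_real smooth_on_inner_left smooth_on_pd W \<tau>(1) finite_Basis
          smooth_on_compose[OF W S \<tau>(2) _ \<tau>(1)])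
         (use \<theta> in \<open>simp add: covector_field_def\<close>)
    then show ?thesis
      by (subst smooth_on_cong[OF W]) (use \<tau>(2) in \<open>auto intro: pullback_expand[OF \<theta>]\<close>)
  qed
  ultimately show ?thesis by (simp add: covector_field_def)
qed

lemma pd_compose:
  assumes "\<tau> differentiable at y" "f differentiable at (\<tau> y)"
  shows "pd v (\<lambda>z. f (\<tau> z)) y = pd (pd v \<tau> y) f (\<tau> y)"
  by (rule pd_eq) (use diff_chain_at[OF pd_works[OF assms(1)] pd_works[OF assms(2)]] in \<open>simp add: o_def\<close>)

text \<open>Naturality of the exterior derivative. The second derivatives of \<open>\<tau>\<close> cancel by symmetry.\<close>

lemma d_covector_pullback:
  assumes W: "open W" "y \<in> W" and S: "open S" and \<tau>: "smooth_on W \<tau>" "\<tau> ` W \<subseteq> S" and \<theta>: "covector_field S \<theta>"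
  shows "d_covector (pullback \<tau> \<theta>) y vs = d_covector \<theta> (\<tau> y) (map (\<lambda>v. pd v \<tau> y) vs)"
proof -
  have ty: "\<tau> y \<in> S" using \<tau>(2) W by auto
  have d\<tau>: "\<tau> differentiable at y" by (rule smooth_on_differentiable[OF \<tau>(1) W])
  have d\<theta>: "(\<lambda>z. \<theta> z b) differentiable at (\<tau> y)" for b by (rule covector_field_differentiable[OF \<theta> S ty])
  have d\<theta>\<tau>: "(\<lambda>z. \<theta> (\<tau> z) b) differentiable at y" for b
    by (rule smooth_on_differentiable[OF smooth_on_compose[OF W(1) S \<tau>(2) _ \<tau>(1)] W])
       (use \<theta> in \<open>simp add: covector_field_def\<close>)
  have inner: "smooth_on W (\<lambda>z. complex_of_real (pd w \<tau> z \<bullet> b))" for w b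
    by (intro smooth_on_of_real smooth_on_inner_left smooth_on_pd W \<tau>(1))
  have dinner: "pd v (\<lambda>z. complex_of_real (pd w \<tau> z \<bullet> b)) y = complex_of_real (pd v (pd w \<tau>) y \<bullet> b)" for v w b
    by (rule pd_linear_compose[OF bounded_linear_compose[OF bounded_linear_of_real bounded_linear_inner_left]
          smooth_on_differentiable[OF smooth_on_pd[OF \<tau>(1)] W]])
  have *: "pd v (\<lambda>z. pullback \<tau> \<theta> z w) y =
    (\<Sum>b\<in>Basis. \<theta> (\<tau> y) b * complex_of_real (pd v (pd w \<tau>) y \<bullet> b)) +
    (\<Sum>b\<in>Basis. pd (pd v \<tau> y) (\<lambda>z. \<theta> z b) (\<tau> y) * complex_of_real (pd w \<tau> y \<bullet> b))" for v w
  proof -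
    have "pd v (\<lambda>z. pullback \<tau> \<theta> z w) y = pd v (\<lambda>z. \<Sum>b\<in>Basis. \<theta> (\<tau> z) b * complex_of_real (pd w \<tau> z \<bullet> b)) y"
      by (rule fun_cong[OF frechet_derivative_cong_open[OF W]]) (use \<tau>(2) in \<open>auto intro: pullback_expand[OF \<theta>]\<close>)
    also have "\<dots> = (\<Sum>b\<in>Basis. pd v (\<lambda>z. \<theta> (\<tau> z) b * complex_of_real (pd w \<tau> z \<bullet> b)) y)"
      by (intro pd_sum differentiable_mult d\<theta>\<tau> smooth_on_differentiable[OF inner W])
    also have "\<dots> = (\<Sum>b\<in>Basis. \<theta> (\<tau> y) b * complex_of_real (pd v (pd w \<tau>) y \<bullet> b)
        + pd (pd v \<tau> y) (\<lambda>z. \<theta> z b) (\<tau> y) * complex_of_real (pd w \<tau> y \<bullet> b))"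
      by (simp only: pd_mult[OF d\<theta>\<tau> smooth_on_differentiable[OF inner W]] dinner pd_compose[OF d\<tau> d\<theta>])
    finally show ?thesis by (simp add: sum.distrib)
  qed
  show ?thesis
  proof (cases "length vs = 2")
    case True
    then obtain v w where vs: "vs = [v, w]" by (auto simp: numeral_2_eq_2 length_Suc_conv)
    have "d_covector (pullback \<tau> \<theta>) y vs =
      (\<Sum>b\<in>Basis. pd (pd v \<tau> y) (\<lambda>z. \<theta> z b) (\<tau> y) * complex_of_real (pd w \<tau> y \<bullet> b)) -
      (\<Sum>b\<in>Basis. pd (pd w \<tau> y) (\<lambda>z. \<theta> z b) (\<tau> y) * complex_of_real (pd v \<tau> y \<bullet> b))"
      using pd_commute[OF W \<tau>(1), of v w] by (simp add: vs d_covector_eq *)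
    also have "\<dots> = d_covector \<theta> (\<tau> y) (map (\<lambda>v. pd v \<tau> y) vs)"
      by (simp add: vs d_covector_decomposition[OF S ty \<theta>] sum_fun_apply wedge_2 covector_def sum_subtractf)
    finally show ?thesis .
  next
    case False
    then show ?thesis by (auto simp: d_covector_eq split: list.splits)
  qed
qed

lemma d02_pullback:
  assumes W: "open W" "y \<in> W" and S: "open S" and \<tau>: "smooth_on W \<tau>" "\<tau> ` W \<subseteq> S" and \<theta>: "covector_field S \<theta>"
    and J: "\<And>v. pd (J' y v) \<tau> y = J (\<tau> y) (pd v \<tau> y)"
  shows "d02 J' (pullback \<tau> \<theta>) y vs = d02 J \<theta> (\<tau> y) (map (\<lambda>v. pd v \<tau> y) vs)"
  unfolding d02_def part_02_def by (auto simp: d_covector_pullback[OF W S \<tau> \<theta>] J split: list.splits)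

section \<open>Forms on almost complex manifolds\<close>

locale almost_complex_manifold =
  fixes M :: "'m topology" and A :: "('m, 'e::euclidean_space) chart set" and J :: "('m, 'e) endo_field"
  assumes manifold: "smooth_manifold M A" and almost_complex: "almost_complex_structure A J"
begin

text \<open>The inverse of the coordinate map. In terms of points of the manifold, overlaps and the cocycle condition become trivial.\<close>

definition point :: "('m, 'e) chart \<Rightarrow> 'e \<Rightarrow> 'm" where
  "point c = inv_into (fst c) (snd c)"

lemma chart:
  assumes "c \<in> A"
  shows "openin M (fst c)" "open (target c)"
    "homeomorphic_map (subtopology M (fst c)) (top_of_set (target c)) (snd c)" "inj_on (snd c) (fst c)"
proof -
  show "openin M (fst c)" "open (target c)" and
    h: "homeomorphic_map (subtopology M (fst c)) (top_of_set (target c)) (snd c)"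
    using manifold assms by (auto simp: smooth_manifold_def)
  have "fst c \<subseteq> topspace M" using \<open>openin M (fst c)\<close> by (rule openin_subset)
  then show "inj_on (snd c) (fst c)"
    using homeomorphic_imp_injective_map[OF h] by (simp add: topspace_subtopology inf.absorb2)
qed

lemma point:
  assumes "c \<in> A"
  shows "y \<in> target c \<Longrightarrow> point c y \<in> fst c" "y \<in> target c \<Longrightarrow> snd c (point c y) = y"
    "p \<in> fst c \<Longrightarrow> point c (snd c p) = p" "p \<in> fst c \<Longrightarrow> snd c p \<in> target c"
  using chart(4)[OF assms] by (auto simp: point_def target_def inv_into_into f_inv_into_f inv_into_f_f)

lemma overlap_iff: "c \<in> A \<Longrightarrow> y \<in> overlap c c' \<longleftrightarrow> y \<in> target c \<and> point c y \<in> fst c'"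
  using point[of c] by (auto simp: overlap_def target_def)

lemma transition_eq: "transition c c' y = snd c' (point c y)"
  by (simp add: transition_def point_def)

lemma open_chart_image:
  assumes c: "c \<in> A" and U: "openin M U" "U \<subseteq> fst c"
  shows "open (snd c ` U)"
proof -
  have "openin (subtopology M (fst c)) U" using U by (simp add: openin_open_subtopology[OF chart(1)[OF c]])
  then have "openin (top_of_set (target c)) (snd c ` U)"
    using homeomorphic_imp_open_map[OF chart(3)[OF c]] by (simp add: open_map_def)
  then show ?thesis using openin_open_eq[OF chart(2)[OF c]] by blast
qed

lemma open_overlap: "c \<in> A \<Longrightarrow> c' \<in> A \<Longrightarrow> open (overlap c c')"
  unfolding overlap_def by (rule open_chart_image) (auto intro: chart(1))

lemma smooth_transition: "c \<in> A \<Longrightarrow> c' \<in> A \<Longrightarrow> smooth_on (overlap c c') (transition c c')"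
  using manifold by (simp add: smooth_manifold_def)

lemma overlap_subset: "overlap c c' \<subseteq> target c"
  by (auto simp: overlap_def target_def)

lemma transition_in_target:
  "c \<in> A \<Longrightarrow> c' \<in> A \<Longrightarrow> y \<in> overlap c c' \<Longrightarrow> transition c c' y \<in> target c'"
  by (auto simp: overlap_iff transition_eq point)

lemma cocycle:
  assumes "c \<in> A" "c' \<in> A" "c'' \<in> A" "y \<in> overlap c c'"
  shows "transition c c' y \<in> overlap c' c'' \<longleftrightarrow> y \<in> overlap c c''"
    "transition c' c'' (transition c c' y) = transition c c'' y"
  using assms by (auto simp: overlap_iff transition_eq point)

lemma overlap_self: "c \<in> A \<Longrightarrow> overlap c c = target c"
  by (auto simp: overlap_def target_def)

lemma transition_self: "c \<in> A \<Longrightarrow> y \<in> target c \<Longrightarrow> transition c c y = y"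
  by (simp add: transition_eq point)

lemma pd_transition_self:
  assumes "c \<in> A" "y \<in> target c"
  shows "pd v (transition c c) y = v"
proof -
  have "pd v (transition c c) y = pd v (\<lambda>z. z) y"
    by (rule fun_cong[OF frechet_derivative_cong_open[OF chart(2)[OF assms(1)] assms(2)]])
       (rule transition_self[OF assms(1)])
  also have "\<dots> = v" by (auto intro!: pd_eq derivative_eq_intros)
  finally show ?thesis .
qed

lemma pd_transition_cocycle:
  assumes c: "c \<in> A" "c' \<in> A" "c'' \<in> A" and y: "y \<in> overlap c c'" "y \<in> overlap c c''"
  shows "pd (pd v (transition c c') y) (transition c' c'') (transition c c' y) = pd v (transition c c'') y"
proof -
  let ?O = "overlap c c' \<inter> overlap c c''"
  have O: "open ?O" "y \<in> ?O" using y open_Int[OF open_overlap[OF c(1,2)] open_overlap[OF c(1,3)]] by auto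
  have 1: "transition c c' differentiable at y"
    by (rule smooth_on_differentiable[OF smooth_transition[OF c(1,2)] open_overlap[OF c(1,2)] y(1)])
  have 2: "transition c' c'' differentiable at (transition c c' y)"
    by (rule smooth_on_differentiable[OF smooth_transition[OF c(2,3)] open_overlap[OF c(2,3)]])
       (use cocycle(1)[OF c y(1)] y(2) in simp)
  have "pd v (transition c c'') y = pd v (\<lambda>z. transition c' c'' (transition c c' z)) y"
    by (rule fun_cong[OF frechet_derivative_cong_open[OF O]]) (use cocycle(2)[OF c] in auto)
  also have "\<dots> = pd (pd v (transition c c') y) (transition c' c'') (transition c c' y)"
    by (rule pd_compose[OF 1 2])
  finally show ?thesis by simp
qed

lemma complex_structure_field_J: "c \<in> A \<Longrightarrow> complex_structure_field (target c) (J c)"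
  using almost_complex by (auto simp: almost_complex_structure_def complex_structure_field_def complex_structure_def)

lemma complex_structure_J: "c \<in> A \<Longrightarrow> y \<in> target c \<Longrightarrow> complex_structure (J c y)"
  using complex_structure_field_J by (auto simp: complex_structure_field_def)

lemma pd_transition_J:
  "c \<in> A \<Longrightarrow> c' \<in> A \<Longrightarrow> y \<in> overlap c c' \<Longrightarrow>
    pd (J c y v) (transition c c') y = J c' (transition c c' y) (pd v (transition c c') y)"
  using almost_complex by (auto simp: almost_complex_structure_def)

text \<open>The part of the chart \<open>c'\<close> outside of the set with coordinates \<open>K\<close> in the chart \<open>c\<close>.\<close>

definition off_support :: "('m, 'e) chart \<Rightarrow> 'e set \<Rightarrow> ('m, 'e) chart \<Rightarrow> 'e set" where
  "off_support c K c' = {y \<in> target c'. point c' y \<notin> point c ` K}"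

text \<open>The set with coordinates \<open>K\<close> is compact in the manifold, hence closed, because manifolds are
  Hausdorff spaces.\<close>

lemma open_off_support:
  assumes c: "c \<in> A" "c' \<in> A" and K: "compact K" "K \<subseteq> target c"
  shows "open (off_support c K c')"
proof -
  obtain g where g: "homeomorphic_maps (subtopology M (fst c)) (top_of_set (target c)) (snd c) g"
    using chart(3)[OF c(1)] homeomorphic_map_maps by blast
  have top: "topspace (subtopology M (fst c)) = fst c"
    using openin_subset[OF chart(1)[OF c(1)]] by (simp add: topspace_subtopology inf.absorb2)
  have cont: "continuous_map (top_of_set (target c)) (subtopology M (fst c)) g"
    using g by (simp add: homeomorphic_maps_def)
  have gp: "g y = point c y" if "y \<in> target c" for y
  proof -
    have "g y \<in> fst c" using continuous_map_image_subset_topspace[OF cont] that top by auto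
    moreover have "snd c (g y) = y" using g that by (simp add: homeomorphic_maps_def)
    ultimately show ?thesis using point(3)[OF c(1)] by metis
  qed
  have "compactin (top_of_set (target c)) K" using K by (simp add: compactin_subtopology)
  then have "compactin (subtopology M (fst c)) (g ` K)" by (rule image_compactin[OF _ cont])
  then have "compactin M (g ` K)" by (simp add: compactin_subtopology)
  moreover have "g ` K = point c ` K" using gp K(2) by (intro image_cong refl) auto
  ultimately have "closedin M (point c ` K)"
    using manifold by (simp add: compactin_imp_closedin smooth_manifold_def)
  then have "openin M (fst c' - point c ` K)" using chart(1)[OF c(2)] by (rule openin_diff[rotated])
  then have "open (snd c' ` (fst c' - point c ` K))" by (rule open_chart_image[OF c(2)]) auto
  moreover have "snd c' ` (fst c' - point c ` K) = off_support c K c'"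
    using point[OF c(2)] by (force simp: off_support_def image_iff)
  ultimately show ?thesis by simp
qed

text \<open>The form that is given by \<open>\<theta>\<close> in the chart \<open>c\<close> and is zero outside of this chart.\<close>

definition extend_form :: "('m, 'e) chart \<Rightarrow> ('e \<Rightarrow> 'e \<Rightarrow> complex) \<Rightarrow> ('m, 'e) dform" where
  "extend_form c \<theta> = (\<lambda>c' y. if c' \<in> A \<and> y \<in> overlap c' c then wedge [pullback (transition c' c) \<theta> y] else 0)"

definition supported_field :: "('m, 'e) chart \<Rightarrow> 'e set \<Rightarrow> ('e \<Rightarrow> 'e \<Rightarrow> complex) \<Rightarrow> bool" where
  "supported_field c K \<theta> \<longleftrightarrow> compact K \<and> K \<subseteq> target c \<and> covector_field (target c) \<theta> \<and>
     (\<forall>y\<in>target c - K. \<forall>v. \<theta> y v = 0)"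

lemma covector_field_pullback_transition:
  assumes c: "c \<in> A" "c' \<in> A" and \<theta>: "covector_field (target c) \<theta>"
  shows "covector_field (overlap c' c) (pullback (transition c' c) \<theta>)"
  by (rule covector_field_pullback[OF open_overlap[OF c(2,1)] chart(2)[OF c(1)] smooth_transition[OF c(2,1)] _ \<theta>])
     (use transition_in_target[OF c(2,1)] in auto)

lemma extend_form_off_support:
  assumes c: "c \<in> A" "c' \<in> A" and \<theta>: "supported_field c K \<theta>" and y: "y \<in> off_support c K c'"
  shows "extend_form c \<theta> c' y = 0"
proof (cases "y \<in> overlap c' c")
  case True
  have "transition c' c y \<in> target c - K"
    using transition_in_target[OF c(2,1) True] y True point[OF c(1)] c
    by (auto simp: off_support_def overlap_iff transition_eq image_iff)
  then have "pullback (transition c' c) \<theta> y = (\<lambda>v. 0)"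
    using \<theta> by (auto simp: pullback_def supported_field_def)
  then show ?thesis by (auto simp: extend_form_def wedge_1 fun_eq_iff split: list.splits)
qed (simp add: extend_form_def)

lemma target_eq_Un_off_support:
  assumes c: "c \<in> A" "c' \<in> A" and K: "K \<subseteq> target c"
  shows "target c' = overlap c' c \<union> off_support c K c'"
  using overlap_subset[of c' c] point[OF c(1)] K c by (auto simp: off_support_def overlap_iff)

text \<open>Every chart is covered by two open sets: the overlap with \<open>c\<close>, on which the form is a
  pullback, and the complement of the support, on which it is zero.\<close>

lemma extend_form_in_dforms:
  assumes c: "c \<in> A" and \<theta>: "supported_field c K \<theta>"
    and type: "\<And>c' y. c' \<in> A \<Longrightarrow> y \<in> overlap c' c \<Longrightarrow> wedge [pullback (transition c' c) \<theta> y] \<in> forms_at (J c' y) p q"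
  shows "extend_form c \<theta> \<in> dforms A J p q"
  unfolding dforms_def
proof (intro CollectI conjI allI impI ballI)
  have K: "compact K" "K \<subseteq> target c" and cov: "covector_field (target c) \<theta>"
    using \<theta> by (auto simp: supported_field_def)
  show "extend_form c \<theta> c' y = 0" if "\<not> (c' \<in> A \<and> y \<in> target c')" for c' y
    using that overlap_subset[of c' c] by (auto simp: extend_form_def)
  show "extend_form c \<theta> c' y \<in> forms_at (J c' y) p q" if "c' \<in> A" "y \<in> target c'" for c' y
    using type[OF that(1)] zero_in_forms_at by (auto simp: extend_form_def)
  show "smooth_on (target c') (\<lambda>y. extend_form c \<theta> c' y vs)" if c': "c' \<in> A" for c' vs
  proof (cases "\<exists>v. vs = [v]")
    case False
    then have "extend_form c \<theta> c' y vs = 0" for y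
      by (auto simp: extend_form_def wedge_1 split: list.splits)
    then show ?thesis by (simp add: smooth_on_const chart(2)[OF c'])
  next
    case True
    then obtain v where vs: "vs = [v]" by blast
    note O = open_overlap[OF c' c] and N = open_off_support[OF c c' K]
    have "smooth_on (overlap c' c) (\<lambda>y. extend_form c \<theta> c' y vs)"
      using covector_field_pullback_transition[OF c c' cov] c'
      by (subst smooth_on_cong[OF O, of _ "\<lambda>y. pullback (transition c' c) \<theta> y v"])
         (auto simp: vs extend_form_def wedge_1 covector_field_def)
    moreover have "smooth_on (off_support c K c') (\<lambda>y. extend_form c \<theta> c' y vs)"
      using extend_form_off_support[OF c c' \<theta>] smooth_on_const[OF N, of 0]
      by (subst smooth_on_cong[OF N, of _ "\<lambda>y. 0"]) auto
    ultimately show ?thesis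
      unfolding target_eq_Un_off_support[OF c c' K(2)] by (rule smooth_on_Un[OF O N])
  qed
  show "extend_form c \<theta> c' y vs =
      extend_form c \<theta> c'' (transition c' c'' y) (map (\<lambda>v. pd v (transition c' c'') y) vs)"
    if c': "c' \<in> A" and c'': "c'' \<in> A" and y: "y \<in> overlap c' c''" for c' c'' y vs
  proof (cases "y \<in> overlap c' c")
    case True
    then have True': "transition c' c'' y \<in> overlap c'' c" using cocycle(1)[OF c' c'' c y] by simp
    have "pullback (transition c' c) \<theta> y v = pullback (transition c'' c) \<theta> (transition c' c'' y) (pd v (transition c' c'') y)" for v
      unfolding pullback_def pd_transition_cocycle[OF c' c'' c y True] cocycle(2)[OF c' c'' c y] ..
    then show ?thesis
      using True True' c' c'' by (auto simp: extend_form_def wedge_1 split: list.splits)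
  next
    case False
    then have "transition c' c'' y \<notin> overlap c'' c" using cocycle(1)[OF c' c'' c y] by simp
    with False show ?thesis by (simp add: extend_form_def)
  qed
qed

lemma extend_form_in_chart:
  assumes c: "c \<in> A" and y: "y \<in> target c"
  shows "extend_form c \<theta> c y = wedge [\<theta> y]"
proof -
  have "pullback (transition c c) \<theta> y = \<theta> y"
    by (simp add: pullback_def fun_eq_iff transition_self[OF assms] pd_transition_self[OF assms])
  then show ?thesis using assms by (simp add: extend_form_def overlap_self)
qed

lemma pullback_A10:
  assumes c: "c \<in> A" "c' \<in> A" and y: "y \<in> overlap c' c" and \<theta>: "covector_field (target c) \<theta>"
    and type: "\<And>z. z \<in> target c \<Longrightarrow> \<theta> z \<in> A10 (J c z)"
  shows "pullback (transition c' c) \<theta> y \<in> A10 (J c' y)"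
proof -
  have t: "transition c' c y \<in> target c" by (rule transition_in_target[OF c(2,1) y])
  show ?thesis
    using type[OF t] covector_field_pullback_transition[OF c \<theta>] y overlap_subset[of c' c]
    unfolding A10_iff[OF complex_structure_J[OF c(1) t]] A10_iff[OF complex_structure_J[OF c(2) subsetD[OF overlap_subset y]]]
    by (auto simp: covector_field_def pullback_def pd_transition_J[OF c(2,1) y])
qed

lemma pullback_A01:
  assumes c: "c \<in> A" "c' \<in> A" and y: "y \<in> overlap c' c" and \<theta>: "covector_field (target c) \<theta>"
    and type: "\<And>z. z \<in> target c \<Longrightarrow> \<theta> z \<in> A01 (J c z)"
  shows "pullback (transition c' c) \<theta> y \<in> A01 (J c' y)"
proof -
  have t: "transition c' c y \<in> target c" by (rule transition_in_target[OF c(2,1) y])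
  show ?thesis
    using type[OF t] covector_field_pullback_transition[OF c \<theta>] y overlap_subset[of c' c]
    unfolding A01_iff[OF complex_structure_J[OF c(1) t]] A01_iff[OF complex_structure_J[OF c(2) subsetD[OF overlap_subset y]]]
    by (auto simp: covector_field_def pullback_def pd_transition_J[OF c(2,1) y])
qed

lemma extend_form_10:
  assumes c: "c \<in> A" and \<theta>: "supported_field c K \<theta>" and type: "\<And>z. z \<in> target c \<Longrightarrow> \<theta> z \<in> A10 (J c z)"
  shows "extend_form c \<theta> \<in> dforms A J 1 0"
proof (rule extend_form_in_dforms[OF c \<theta>])
  fix c' y assume c': "c' \<in> A" "y \<in> overlap c' c"
  have "pullback (transition c' c) \<theta> y \<in> A10 (J c' y)"
    by (rule pullback_A10[OF c c' _ type]) (use \<theta> in \<open>auto simp: supported_field_def\<close>)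
  then show "wedge [pullback (transition c' c) \<theta> y] \<in> forms_at (J c' y) 1 0"
    unfolding forms_at_10 by blast
qed

lemma extend_form_01:
  assumes c: "c \<in> A" and \<theta>: "supported_field c K \<theta>" and type: "\<And>z. z \<in> target c \<Longrightarrow> \<theta> z \<in> A01 (J c z)"
  shows "extend_form c \<theta> \<in> dforms A J 0 1"
proof (rule extend_form_in_dforms[OF c \<theta>])
  fix c' y assume c': "c' \<in> A" "y \<in> overlap c' c"
  have "pullback (transition c' c) \<theta> y \<in> A01 (J c' y)"
    by (rule pullback_A01[OF c c' _ type]) (use \<theta> in \<open>auto simp: supported_field_def\<close>)
  then show "wedge [pullback (transition c' c) \<theta> y] \<in> forms_at (J c' y) 0 1"
    using wedge_in_forms_at[of "[]" _ "[pullback (transition c' c) \<theta> y]"] by simp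
qed

lemma ext_deriv_cong:
  assumes "open S" "y \<in> S" "\<And>z. z \<in> S \<Longrightarrow> \<omega> z = \<omega>' z"
  shows "ext_deriv \<omega> y = ext_deriv \<omega>' y"
proof
  fix vs
  have "pd v (\<lambda>z. \<omega> z ws) y = pd v (\<lambda>z. \<omega>' z ws) y" for v ws
    by (rule fun_cong[OF frechet_derivative_cong_open[OF assms(1,2)]]) (simp add: assms(3))
  then show "ext_deriv \<omega> y vs = ext_deriv \<omega>' y vs" by (simp add: ext_deriv_def)
qed

lemma ext_deriv_zero: "ext_deriv (\<lambda>z. 0) y = 0"
  by (auto simp: ext_deriv_def fun_eq_iff pd_const)

text \<open>In all charts the \<open>(0,2)\<close>-part of the derivative is the pullback of \<open>d02 (J c) \<theta>\<close>, so
  two fields with the same \<open>d02\<close> in the chart \<open>c\<close> have extensions with the same \<open>(0,2)\<close>-part.\<close>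

lemma d_part_extend_form:
  assumes c: "c \<in> A" and \<theta>: "supported_field c K \<theta>"
  shows "d_part A J 0 2 (extend_form c \<theta>) = (\<lambda>c' y.
    if c' \<in> A \<and> y \<in> overlap c' c then
      \<lambda>vs. d02 (J c) \<theta> (transition c' c y) (map (\<lambda>v. pd v (transition c' c) y) vs) else 0)"
proof (intro ext)
  fix c' y vs
  have K: "compact K" "K \<subseteq> target c" and cov: "covector_field (target c) \<theta>"
    using \<theta> by (auto simp: supported_field_def)
  consider "\<not> (c' \<in> A \<and> y \<in> target c')" | "c' \<in> A" "y \<in> overlap c' c"
    | "c' \<in> A" "y \<in> off_support c K c'" "y \<in> target c'" "y \<notin> overlap c' c"
    using target_eq_Un_off_support[OF c _ K(2)] by blast
  then show "d_part A J 0 2 (extend_form c \<theta>) c' y vs = (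
    if c' \<in> A \<and> y \<in> overlap c' c then
      \<lambda>vs. d02 (J c) \<theta> (transition c' c y) (map (\<lambda>v. pd v (transition c' c) y) vs) else 0) vs"
  proof cases
    case 1
    then show ?thesis using overlap_subset[of c' c] by (auto simp: d_part_def)
  next
    case 2
    note O = open_overlap[OF 2(1) c] and y = subsetD[OF overlap_subset 2(2)]
    have "ext_deriv (extend_form c \<theta> c') y = d_covector (pullback (transition c' c) \<theta>) y"
      unfolding d_covector_def by (rule ext_deriv_cong[OF O 2(2)]) (use 2(1) in \<open>simp add: extend_form_def\<close>)
    then have "d_part A J 0 2 (extend_form c \<theta>) c' y vs = d02 (J c') (pullback (transition c' c) \<theta>) y vs"
      using 2(1) y pq_part_02_d_covector[where J = "J c'", OF O 2(2) covector_field_pullback_transition[OF c 2(1) cov]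
        complex_structure_J[OF 2(1) y]] by (simp add: d_part_def)
    also have "\<dots> = d02 (J c) \<theta> (transition c' c y) (map (\<lambda>v. pd v (transition c' c) y) vs)"
      by (rule d02_pullback[where J' = "J c'" and J = "J c", OF O 2(2) chart(2)[OF c] smooth_transition[OF 2(1) c] _ cov pd_transition_J[OF 2(1) c 2(2)]])
         (use transition_in_target[OF 2(1) c] in auto)
    finally show ?thesis using 2 by simp
  next
    case 3
    have "ext_deriv (extend_form c \<theta> c') y = ext_deriv (\<lambda>z. 0) y"
      by (rule ext_deriv_cong[OF open_off_support[OF c 3(1) K] 3(2)]) (rule extend_form_off_support[OF c 3(1) \<theta>])
    then show ?thesis using 3 pq_part_zero[OF complex_structure_J[OF 3(1,3)]]
      by (simp add: d_part_def ext_deriv_zero)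
  qed
qed

section \<open>Consequences of maximal non-integrability\<close>

definition local_field :: "('m, 'e) chart \<Rightarrow> ('m, 'e) dform \<Rightarrow> 'e \<Rightarrow> 'e \<Rightarrow> complex" where
  "local_field c \<alpha> y v = \<alpha> c y [v]"

lemma local_field_10:
  assumes c: "c \<in> A" and \<alpha>: "\<alpha> \<in> dforms A J 1 0"
  shows "covector_field (target c) (local_field c \<alpha>)"
    "\<And>y. y \<in> target c \<Longrightarrow> local_field c \<alpha> y \<in> A10 (J c y)"
    "\<And>y. y \<in> target c \<Longrightarrow> \<alpha> c y = wedge [local_field c \<alpha> y]"
    "\<And>y. y \<in> target c \<Longrightarrow> mubar A J 1 0 \<alpha> c y = d02 (J c) (local_field c \<alpha>) y"
proof -
  have *: "local_field c \<alpha> y \<in> A10 (J c y) \<and> \<alpha> c y = wedge [local_field c \<alpha> y]" if y: "y \<in> target c" for y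
  proof -
    obtain \<gamma> where \<gamma>: "\<gamma> \<in> A10 (J c y)" "\<alpha> c y = wedge [\<gamma>]"
    proof -
      have "\<alpha> c y \<in> forms_at (J c y) 1 0" using \<alpha> c y unfolding dforms_def by blast
      then show thesis using that unfolding forms_at_10 by blast
    qed
    then have "local_field c \<alpha> y = \<gamma>" by (simp add: local_field_def[abs_def] wedge_1)
    then show ?thesis using \<gamma> by simp
  qed
  then show t: "\<And>y. y \<in> target c \<Longrightarrow> local_field c \<alpha> y \<in> A10 (J c y)"
    and w: "\<And>y. y \<in> target c \<Longrightarrow> \<alpha> c y = wedge [local_field c \<alpha> y]" by auto
  show cov: "covector_field (target c) (local_field c \<alpha>)"
    using t \<alpha> c by (auto simp: covector_field_def local_field_def dforms_def intro: linear_if_A10)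
  show "mubar A J 1 0 \<alpha> c y = d02 (J c) (local_field c \<alpha>) y" if y: "y \<in> target c" for y
  proof -
    have "ext_deriv (\<alpha> c) y = d_covector (local_field c \<alpha>) y"
      unfolding d_covector_def by (rule ext_deriv_cong[OF chart(2)[OF c] y]) (rule w)
    then show ?thesis
      using c y pq_part_02_d_covector[where J = "J c", OF chart(2)[OF c] y cov complex_structure_J[OF c y]]
      by (simp add: mubar_def d_part_def numeral_2_eq_2)
  qed
qed

lemma d02_diff:
  assumes S: "open S" "y \<in> S" and \<theta>: "covector_field S \<theta>" "covector_field S \<theta>'"
  shows "d02 j (\<lambda>z v. \<theta> z v - \<theta>' z v) y = d02 j \<theta> y - d02 j \<theta>' y"
proof -
  have "pd v (\<lambda>z. \<theta> z w - \<theta>' z w) y = pd v (\<lambda>z. \<theta> z w) y - pd v (\<lambda>z. \<theta>' z w) y" for v w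
    by (rule pd_eq, rule has_derivative_diff)
       (auto intro: pd_works covector_field_differentiable[OF \<theta>(1) S] covector_field_differentiable[OF \<theta>(2) S])
  then have "d_covector (\<lambda>z v. \<theta> z v - \<theta>' z v) y = d_covector \<theta> y - d_covector \<theta>' y"
    by (auto simp: d_covector_eq fun_eq_iff split: list.splits)
  moreover have "part_02 (j y) (a - b) = part_02 (j y) a - part_02 (j y) b" for a b
    by (auto simp: part_02_def fun_eq_iff diff_divide_distrib add_divide_distrib algebra_simps split: list.splits)
  ultimately show ?thesis by (simp add: d02_def)
qed

text \<open>Two forms with the same value at the point differ by a form that vanishes there, so the definite
  description has a unique solution as soon as there is one.\<close>

lemma mubar_at_eq:
  assumes c: "c \<in> A" and y: "y \<in> target c" and \<alpha>: "\<alpha> \<in> dforms A J 1 0"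
  shows "mubar_at A J c y (\<alpha> c y) = mubar A J 1 0 \<alpha> c y"
  unfolding mubar_at_def
proof (rule the_equality)
  fix b assume "\<exists>\<alpha>'\<in>dforms A J 1 0. \<alpha>' c y = \<alpha> c y \<and> mubar A J 1 0 \<alpha>' c y = b"
  then obtain \<alpha>' where \<alpha>': "\<alpha>' \<in> dforms A J 1 0" "\<alpha>' c y = \<alpha> c y" "mubar A J 1 0 \<alpha>' c y = b" by blast
  note l = local_field_10[OF c \<alpha>] and l' = local_field_10[OF c \<alpha>'(1)] and S = chart(2)[OF c]
  let ?\<theta> = "\<lambda>z v. local_field c \<alpha>' z v - local_field c \<alpha> z v"
  have "d02 (J c) ?\<theta> y = 0"
  proof (rule d02_eq_0_if_zero_at[OF S y complex_structure_field_J[OF c]])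
    show "covector_field (target c) ?\<theta>"
      using l(1) l'(1) S by (auto simp: covector_field_def intro: smooth_on_diff linear_compose_sub)
    then show "?\<theta> z \<in> A10 (J c z)" if "z \<in> target c" for z
      using l(2)[OF that] l'(2)[OF that] that
      unfolding A10_iff[OF complex_structure_J[OF c that]] by (auto simp: covector_field_def algebra_simps)
    show "?\<theta> y v = 0" for v using \<alpha>'(2) by (simp add: local_field_def)
  qed
  then have "d02 (J c) (local_field c \<alpha>') y = d02 (J c) (local_field c \<alpha>) y"
    using d02_diff[OF S y l'(1) l(1), of "J c"] by simp
  then show "b = mubar A J 1 0 \<alpha> c y" using l(4)[OF y] l'(4)[OF y] \<alpha>'(3) by simp
qed (use \<alpha> in blast)

lemma exists_form_with_value:
  assumes c: "c \<in> A" and y: "y \<in> target c" and a: "a \<in> forms_at (J c y) 1 0"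
  shows "\<exists>\<alpha>\<in>dforms A J 1 0. \<alpha> c y = a"
proof -
  obtain \<gamma> where \<gamma>: "a = wedge [\<gamma>]" "\<gamma> \<in> A10 (J c y)" using a unfolding forms_at_10 by blast
  note S = chart(2)[OF c]
  obtain r where r: "r > 0" "cball y r \<subseteq> target c" using S y open_contains_cball by blast
  obtain chi where chi: "smooth_on UNIV chi" "chi y = 1" "\<And>z. z \<notin> cball y r \<Longrightarrow> chi z = (0::complex)"
    using bump_function_exists[OF r(1), of y] by blast
  let ?\<theta> = "\<lambda>z v. chi z * proj10 (J c z) \<gamma> v"
  have cov: "covector_field (target c) ?\<theta>"
    by (rule covector_field_mult[OF S smooth_on_subset[OF chi(1)] covector_field_proj10[OF S complex_structure_field_J[OF c] linear_if_A10[OF \<gamma>(2)]]]) auto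
  then have sup: "supported_field c (cball y r) ?\<theta>"
    using r chi(3) by (auto simp: supported_field_def)
  have "?\<theta> z \<in> A10 (J c z)" if z: "z \<in> target c" for z
    using cov proj10_in_A10[OF complex_structure_J[OF c z] linear_if_A10[OF \<gamma>(2)]] z
    unfolding A10_iff[OF complex_structure_J[OF c z]] by (auto simp: covector_field_def)
  then have "extend_form c ?\<theta> \<in> dforms A J 1 0" by (rule extend_form_10[OF c sup])
  moreover have "extend_form c ?\<theta> c y = a"
    using proj10_fixes_A10[OF complex_structure_J[OF c y] \<gamma>(2)] chi(2)
    by (simp add: extend_form_in_chart[OF c y] \<gamma>(1))
  ultimately show ?thesis by blast
qed

text \<open>The hypothesis on the rank leaves no room: the image is contained in the space of \<open>(0,2)\<close>-forms at the point,
  whose dimension is at most \<open>n choose 2\<close>.\<close>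

lemma mubar_generates:
  assumes c: "c \<in> A" and y: "y \<in> target c"
    and rank: "(DIM('e) div 2) choose 2 \<le> fs.dim (mubar_at A J c y ` forms_at (J c y) 1 0)"
  obtains B :: "'e cform set" and \<alpha> where "finite B" "\<And>b. b \<in> B \<Longrightarrow> \<alpha> b \<in> dforms A J 1 0"
    "forms_at (J c y) 0 2 \<subseteq> fs.span ((\<lambda>b. d02 (J c) (local_field c (\<alpha> b)) y) ` B)"
proof -
  note Jy = complex_structure_J[OF c y]
  let ?X = "mubar_at A J c y ` forms_at (J c y) 1 0"
  have X: "\<exists>\<alpha>\<in>dforms A J 1 0. b = d02 (J c) (local_field c \<alpha>) y" if "b \<in> ?X" for b
  proof -
    from that obtain a where a: "a \<in> forms_at (J c y) 1 0" "b = mubar_at A J c y a" by blast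
    obtain \<alpha> where \<alpha>: "\<alpha> \<in> dforms A J 1 0" "\<alpha> c y = a" using exists_form_with_value[OF c y a(1)] by blast
    have "b = d02 (J c) (local_field c \<alpha>) y"
      using a(2) mubar_at_eq[OF c y \<alpha>(1)] \<alpha>(2) local_field_10(4)[OF c \<alpha>(1) y] by simp
    then show ?thesis using \<alpha>(1) by blast
  qed
  have X02: "?X \<subseteq> forms_at (J c y) 0 2"
  proof
    fix b assume "b \<in> ?X"
    then obtain \<alpha> where \<alpha>: "\<alpha> \<in> dforms A J 1 0" "b = d02 (J c) (local_field c \<alpha>) y" using X by blast
    show "b \<in> forms_at (J c y) 0 2"
      unfolding \<alpha>(2) by (rule d02_in_forms_at[where J = "J c", OF chart(2)[OF c] y local_field_10(1)[OF c \<alpha>(1)] Jy])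
  qed
  obtain B where B: "B \<subseteq> ?X" "fs.independent B" "card B = fs.dim ?X" using fs.basis_exists[of ?X] by metis
  obtain T where T: "finite T" "card T \<le> (DIM('e) div 2) choose 2" "forms_at (J c y) 0 2 \<subseteq> fs.span T"
    by (rule forms_at_02_spanned[OF Jy])
  have finB: "finite B"
    using fs.independent_span_bound[OF T(1) B(2)] B(1) X02 T(3) by blast
  have gen: "forms_at (J c y) 0 2 \<subseteq> fs.span B"
  proof
    fix x assume x: "x \<in> forms_at (J c y) 0 2"
    show "x \<in> fs.span B"
    proof (rule ccontr)
      assume nx: "x \<notin> fs.span B"
      then have ind: "fs.independent (insert x B)" using B(2) by (rule fs.independent_insertI)
      have "insert x B \<subseteq> fs.span T" using x B(1) X02 T(3) by blast
      then have "card (insert x B) \<le> card T" using fs.independent_span_bound[OF T(1) ind] by blast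
      moreover have "x \<notin> B" using nx fs.span_base by blast
      ultimately show False using finB B(3) T(2) rank by simp
    qed
  qed
  have "\<forall>b\<in>B. \<exists>\<alpha>. \<alpha> \<in> dforms A J 1 0 \<and> b = d02 (J c) (local_field c \<alpha>) y" using B(1) X by blast
  then obtain \<alpha> where \<alpha>: "\<And>b. b \<in> B \<Longrightarrow> \<alpha> b \<in> dforms A J 1 0" "\<And>b. b \<in> B \<Longrightarrow> b = d02 (J c) (local_field c (\<alpha> b)) y"
    by (metis (no_types))
  have "(\<lambda>b. d02 (J c) (local_field c (\<alpha> b)) y) ` B = B" using \<alpha>(2) by force
  then show thesis using that[OF finB \<alpha>(1)] gen by simp
qed

text \<open>For a field \<open>\<theta>\<close> with support in \<open>U\<close> there is a field \<open>\<phi>\<close> of type \<open>(1,0)\<close> with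
  the same support and \<open>d02\<close>, so \<open>mubar\<close> of its extension by zero is \<open>dbar\<close> of the extension of
  \<open>\<theta>\<close>. The neighbourhood \<open>U\<close> does not depend on \<open>\<theta>\<close>, which leaves room for an infinite
  dimensional space of closed forms.\<close>

lemma supported_01_forms_closed:
  assumes c: "c \<in> A" and y: "y \<in> target c"
    and rank: "(DIM('e) div 2) choose 2 \<le> fs.dim (mubar_at A J c y ` forms_at (J c y) 1 0)"
  obtains U where "open U" "y \<in> U" "U \<subseteq> target c"
    "\<And>K \<theta>. compact K \<Longrightarrow> K \<subseteq> U \<Longrightarrow> supported_field c K \<theta> \<Longrightarrow> (\<And>z. z \<in> target c \<Longrightarrow> \<theta> z \<in> A01 (J c z)) \<Longrightarrow>
      extend_form c \<theta> \<in> dforms A J 0 1 \<and> dbar A J 0 1 (extend_form c \<theta>) \<in> im_mubar A J 0 2"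
proof -
  note S = chart(2)[OF c]
  obtain B :: "'e cform set" and \<alpha> where B: "finite B" and \<alpha>: "\<And>b. b \<in> B \<Longrightarrow> \<alpha> b \<in> dforms A J 1 0"
    and gen: "forms_at (J c y) 0 2 \<subseteq> fs.span ((\<lambda>b. d02 (J c) (local_field c (\<alpha> b)) y) ` B)"
    by (rule mubar_generates[OF assms]) (rule that)
  have cov: "covector_field (target c) (local_field c (\<alpha> b))" if "b \<in> B" for b
    by (rule local_field_10(1)[OF c \<alpha>[OF that]])
  have type: "local_field c (\<alpha> b) z \<in> A10 (J c z)" if "b \<in> B" "z \<in> target c" for b z
    by (rule local_field_10(2)[OF c \<alpha>[OF that(1)] that(2)])
  show thesis
  proof (rule mubar_onto_locally[OF S y complex_structure_field_J[OF c] B, of "\<lambda>b. local_field c (\<alpha> b)"])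
    fix U assume U: "open U" "y \<in> U" "U \<subseteq> target c"
    and ex: "\<And>K \<theta>. closed K \<Longrightarrow> K \<subseteq> U \<Longrightarrow> covector_field (target c) \<theta> \<Longrightarrow> (\<And>y v. y \<in> target c - K \<Longrightarrow> \<theta> y v = 0) \<Longrightarrow>
       \<exists>\<phi>. covector_field (target c) \<phi> \<and> (\<forall>y\<in>target c. \<phi> y \<in> A10 (J c y)) \<and> (\<forall>y\<in>target c - K. \<forall>v. \<phi> y v = 0) \<and>
         (\<forall>y\<in>target c. d02 (J c) \<phi> y = d02 (J c) \<theta> y)"
  show thesis
  proof (rule that[OF U])
    fix K \<theta> assume K: "compact K" "K \<subseteq> U" and \<theta>: "supported_field c K \<theta>"
      and type01: "\<And>z. z \<in> target c \<Longrightarrow> \<theta> z \<in> A01 (J c z)"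
    obtain \<phi> where \<phi>: "covector_field (target c) \<phi>" "\<forall>y\<in>target c. \<phi> y \<in> A10 (J c y)" "\<forall>y\<in>target c - K. \<forall>v. \<phi> y v = 0"
      "\<forall>y\<in>target c. d02 (J c) \<phi> y = d02 (J c) \<theta> y"
      using ex[OF compact_imp_closed[OF K(1)] K(2)] \<theta> unfolding supported_field_def by blast
    have s\<phi>: "supported_field c K \<phi>" using \<phi> \<theta> by (simp add: supported_field_def)
    have "extend_form c \<phi> \<in> dforms A J 1 0" using \<phi>(2) by (intro extend_form_10[OF c s\<phi>]) auto
    moreover have "dbar A J 0 1 (extend_form c \<theta>) = mubar A J 1 0 (extend_form c \<phi>)"
    proof -
      have "d_part A J 0 2 (extend_form c \<theta>) = d_part A J 0 2 (extend_form c \<phi>)"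
        unfolding d_part_extend_form[OF c \<theta>] d_part_extend_form[OF c s\<phi>]
        using \<phi>(4) transition_in_target[OF _ c] by (intro ext) simp
      then show ?thesis by (simp add: dbar_def mubar_def numeral_2_eq_2)
    qed
    ultimately show "extend_form c \<theta> \<in> dforms A J 0 1 \<and> dbar A J 0 1 (extend_form c \<theta>) \<in> im_mubar A J 0 2"
      using extend_form_01[OF c \<theta> type01] by (simp add: im_mubar_def)
  qed
  qed (use cov type gen in auto)
qed

lemma dbar_function:
  assumes c: "c \<in> A" and f: "f \<in> dforms A J 0 0"
  shows "smooth_on (target c) (\<lambda>z. f c z [])"
    "\<And>y. y \<in> target c \<Longrightarrow> dbar A J 0 0 f c y = wedge [proj01 (J c y) (\<lambda>v. pd v (\<lambda>z. f c z []) y)]"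
proof -
  note S = chart(2)[OF c]
  show sm: "smooth_on (target c) (\<lambda>z. f c z [])" using f c by (simp add: dforms_def)
  fix y assume y: "y \<in> target c"
  have "ext_deriv (f c) y = wedge [\<lambda>v. pd v (\<lambda>z. f c z []) y]"
  proof
    fix vs :: "'e list"
    have z: "pd v (\<lambda>z. f c z ws) y = 0" if "ws \<noteq> []" for v ws
    proof -
      have "pd v (\<lambda>z. f c z ws) y = pd v (\<lambda>z. 0) y"
      proof (rule fun_cong[OF frechet_derivative_cong_open[OF S y]])
        fix x assume "x \<in> target c"
        then have "f c x \<in> forms_at (J c x) 0 0" using f c unfolding dforms_def by blast
        then show "f c x ws = 0" by (rule forms_at_length) (use that in simp)
      qed
      then show ?thesis by (simp add: pd_const)
    qed
    consider "vs = []" | v where "vs = [v]" | u v ws where "vs = u # v # ws" by (metis list.exhaust)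
    then show "ext_deriv (f c) y vs = wedge [\<lambda>v. pd v (\<lambda>z. f c z []) y] vs"
    proof cases
      case 3
      have "take i vs @ drop (Suc i) vs \<noteq> []" if "i < length vs" for i using 3 that by (cases i) auto
      then show ?thesis using 3 z by (simp add: ext_deriv_def wedge_1 del: take_Suc_Cons drop_Suc_Cons cong: sum.cong_simp)
    qed (simp_all add: ext_deriv_def wedge_1)
  qed
  then show "dbar A J 0 0 f c y = wedge [proj01 (J c y) (\<lambda>v. pd v (\<lambda>z. f c z []) y)]"
    using c y pq_part_01[OF complex_structure_J[OF c y] linear_pd[OF smooth_on_differentiable[OF sm S y]]]
    by (simp add: dbar_def d_part_def)
qed

section \<open>Dolbeault cohomology in bidegree (0,1)\<close>

lemma zero_in_dforms: "0 \<in> dforms A J p q"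
  by (auto simp: dforms_def zero_in_forms_at smooth_on_const chart)

lemma d_part_zero: "d_part A J r s 0 = 0"
proof (intro ext)
  fix c y vs
  show "d_part A J r s 0 c y vs = 0 c y vs"
    using pq_part_zero[OF complex_structure_J, of c y r s] ext_deriv_zero[of y]
    by (auto simp: d_part_def zero_fun_def[symmetric])
qed

lemma mubar_zero: "mubar A J p q 0 = 0" and dbar_zero: "dbar A J p q 0 = 0"
  by (auto simp: mubar_def dbar_def d_part_zero)

lemma zero_in_ker_mubar: "0 \<in> ker_mubar A J p q"
  by (simp add: ker_mubar_def zero_in_dforms mubar_zero)

lemma mubar_class_eq: "mubar_class A J p q \<omega> = (\<lambda>h. h + \<omega>) ` im_mubar A J p q"
  by (auto simp: mubar_class_def a_r_coset_def' ker_mubar_space_def)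

lemma mubar_class_zero: "mubar_class A J p q 0 = im_mubar A J p q"
  by (simp add: mubar_class_eq)

lemma zero_H_mubar: "\<zero>\<^bsub>H_mubar A J p q\<^esub> = im_mubar A J p q"
  by (simp add: H_mubar_def quotient_space_def)

lemma zero_class_in_ker_dbar: "im_mubar A J p q \<in> ker_dbar A J p q"
  unfolding ker_dbar_def
  by (rule CollectI, rule exI[of _ 0]) (simp add: mubar_class_zero zero_in_ker_mubar dbar_zero zero_H_mubar)

lemma dforms_diff:
  assumes "\<alpha> \<in> dforms A J p q" "\<beta> \<in> dforms A J p q"
  shows "\<alpha> - \<beta> \<in> dforms A J p q"
  using assms unfolding dforms_def
  by (auto simp: chart(2) intro!: fs.subspace_diff[OF subspace_forms_at] smooth_on_diff)

lemma mubar_10_diff: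
  assumes "\<alpha> \<in> dforms A J 1 0" "\<beta> \<in> dforms A J 1 0"
  shows "mubar A J 1 0 (\<alpha> - \<beta>) = mubar A J 1 0 \<alpha> - mubar A J 1 0 \<beta>"
proof (intro ext)
  fix c y vs
  show "mubar A J 1 0 (\<alpha> - \<beta>) c y vs = (mubar A J 1 0 \<alpha> - mubar A J 1 0 \<beta>) c y vs"
  proof (cases "c \<in> A \<and> y \<in> target c")
    case True
    then have c: "c \<in> A" and y: "y \<in> target c" by auto
    have "local_field c (\<alpha> - \<beta>) = (\<lambda>z v. local_field c \<alpha> z v - local_field c \<beta> z v)"
      by (simp add: local_field_def fun_eq_iff)
    then have "mubar A J 1 0 (\<alpha> - \<beta>) c y = mubar A J 1 0 \<alpha> c y - mubar A J 1 0 \<beta> c y"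
      unfolding local_field_10(4)[OF c assms(1) y] local_field_10(4)[OF c assms(2) y]
        local_field_10(4)[OF c dforms_diff[OF assms] y]
      using d02_diff[OF chart(2)[OF c] y local_field_10(1)[OF c assms(1)] local_field_10(1)[OF c assms(2)], of "J c"] by simp
    then show ?thesis by simp
  next
    case False
    then show ?thesis by (auto simp: mubar_def d_part_def)
  qed
qed

lemma im_mubar_02: "im_mubar A J 0 2 = mubar A J 1 0 ` dforms A J 1 0"
  by (simp add: im_mubar_def)

lemma im_mubar_02_diff: "a \<in> im_mubar A J 0 2 \<Longrightarrow> b \<in> im_mubar A J 0 2 \<Longrightarrow> a - b \<in> im_mubar A J 0 2"
  unfolding im_mubar_02 using mubar_10_diff dforms_diff by (smt (verit) imageE image_eqI)

lemma mubar_class_02: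
  assumes "b \<in> im_mubar A J 0 2"
  shows "mubar_class A J 0 2 b = im_mubar A J 0 2"
proof -
  have "0 \<in> im_mubar A J 0 2"
    unfolding im_mubar_02 by (rule image_eqI[of _ _ 0]) (simp_all only: mubar_zero zero_in_dforms)
  then have m: "- b \<in> im_mubar A J 0 2" using im_mubar_02_diff[OF _ assms, of 0] by simp
  show ?thesis
    unfolding mubar_class_eq
  proof (intro equalityI subsetI)
    fix a assume "a \<in> (\<lambda>h. h + b) ` im_mubar A J 0 2"
    then obtain h where "h \<in> im_mubar A J 0 2" "a = h - (- b)" by auto
    then show "a \<in> im_mubar A J 0 2" using im_mubar_02_diff m by blast
  next
    fix a assume "a \<in> im_mubar A J 0 2"
    then have "a - b \<in> im_mubar A J 0 2" by (rule im_mubar_02_diff[OF _ assms])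
    then show "a \<in> (\<lambda>h. h + b) ` im_mubar A J 0 2" by (rule rev_image_eqI) simp
  qed
qed

lemma im_mubar_01: "im_mubar A J 0 1 = {0}"
  by (simp add: im_mubar_def)

lemma mubar_class_01: "mubar_class A J 0 1 \<omega> = {\<omega>}"
  by (simp add: mubar_class_eq im_mubar_01[unfolded One_nat_def])

lemma ker_mubar_0: "ker_mubar A J 0 q = dforms A J 0 q"
  by (simp add: ker_mubar_def mubar_def)

lemma im_dbar_01: "im_dbar A J 0 1 = {{dbar A J 0 0 f} | f. f \<in> dforms A J 0 0}"
  by (simp add: im_dbar_def ker_mubar_0 mubar_class_01[unfolded One_nat_def])

lemma closed_01_class:
  assumes "\<omega> \<in> dforms A J 0 1" "dbar A J 0 1 \<omega> \<in> im_mubar A J 0 2"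
  shows "{\<omega>} \<in> ker_dbar A J 0 1"
  unfolding ker_dbar_def
proof (rule CollectI, rule exI[of _ \<omega>], intro conjI)
  show "mubar_class A J 0 (1 + 1) (dbar A J 0 1 \<omega>) = \<zero>\<^bsub>H_mubar A J 0 (1 + 1)\<^esub>"
    using mubar_class_02[OF assms(2)] by (simp add: zero_H_mubar numeral_2_eq_2)
qed (use assms in \<open>auto simp: mubar_class_01[unfolded One_nat_def] ker_mubar_0\<close>)

lemma dforms_above_dim:
  assumes "DIM('e) < p + q" "\<omega> \<in> dforms A J p q"
  shows "\<omega> = 0"
proof (intro ext)
  fix c y vs
  show "\<omega> c y vs = 0 c y vs"
  proof (cases "c \<in> A \<and> y \<in> target c")
    case True
    then have "\<omega> c y \<in> forms_at (J c y) p q" using assms(2) unfolding dforms_def by blast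
    then show ?thesis using forms_at_eq_0_above_dim[OF assms(1), of "J c y"] by simp
  next
    case False
    then have "\<omega> c y = 0" using assms(2) unfolding dforms_def by blast
    then show ?thesis by simp
  qed
qed

text \<open>In total degree well above the dimension all spaces of forms are zero. Therefore the zero class belongs to all but
  finitely many of the summands of the cohomology, without which the direct sum would have no elements.\<close>

lemma images_above_dim:
  assumes "DIM('e) + 2 \<le> p + q"
  shows "im_mubar A J p q = {0}" "im_dbar A J p q = {{0}}"
proof -
  show m: "im_mubar A J p q = {0}"
  proof (cases "2 \<le> q")
    case True
    then have "DIM('e) < (p + 1) + (q - 2)" using assms by linarith
    then have "dforms A J (p + 1) (q - 2) = {0}" using dforms_above_dim zero_in_dforms by blast
    then show ?thesis using True by (simp add: im_mubar_def mubar_zero)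
  qed (simp add: im_mubar_def)
  show "im_dbar A J p q = {{0}}"
  proof (cases "1 \<le> q")
    case True
    then have "DIM('e) < p + (q - 1)" using assms by linarith
    then have "ker_mubar A J p (q - 1) = {0}"
      using dforms_above_dim zero_in_ker_mubar unfolding ker_mubar_def by blast
    then show ?thesis using True m by (simp add: im_dbar_def dbar_zero mubar_class_zero)
  next
    case False
    then show ?thesis using m by (simp add: im_dbar_def zero_H_mubar)
  qed
qed

lemma H_Dol_pq_simps:
  "carrier (H_Dol_pq A J p q) = (\<lambda>X. im_dbar A J p q +>\<^bsub>H_mubar A J p q\<^esub> X) ` ker_dbar A J p q"
  "\<zero>\<^bsub>H_Dol_pq A J p q\<^esub> = im_dbar A J p q"
  "C \<oplus>\<^bsub>H_Dol_pq A J p q\<^esub> D = (\<Union>X\<in>C. \<Union>Y\<in>D. {X \<oplus>\<^bsub>H_mubar A J p q\<^esub> Y})"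
  "a \<odot>\<^bsub>H_Dol_pq A J p q\<^esub> C = (\<Union>X\<in>C. im_dbar A J p q +>\<^bsub>H_mubar A J p q\<^esub> (a \<odot>\<^bsub>H_mubar A J p q\<^esub> X))"
  by (simp_all add: H_Dol_pq_def quotient_space_def a_r_coset_def' set_add_def')

lemma H_mubar_coset: "W +>\<^bsub>H_mubar A J p q\<^esub> X = (\<Union>w\<in>W. {w \<oplus>\<^bsub>H_mubar A J p q\<^esub> X})"
  by (simp add: a_r_coset_def')

lemma H_mubar_add: "X \<oplus>\<^bsub>H_mubar A J p q\<^esub> Y = (\<Union>x\<in>X. \<Union>y\<in>Y. {x + y})"
  by (simp add: H_mubar_def quotient_space_def set_add_def' ker_mubar_space_def)

lemma H_mubar_01_smult: "a \<odot>\<^bsub>H_mubar A J 0 1\<^esub> {\<omega>} = {\<lambda>c y. cscale a (\<omega> c y)}"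
  by (simp add: H_mubar_def quotient_space_def a_r_coset_def' ker_mubar_space_def im_mubar_01[unfolded One_nat_def])

lemma H_Dol_simps:
  "carrier (H_Dol A J) = {f. (\<forall>p q. f (p, q) \<in> carrier (H_Dol_pq A J p q)) \<and> finite {i. f i \<noteq> im_dbar A J (fst i) (snd i)}}"
  "\<zero>\<^bsub>H_Dol A J\<^esub> (p, q) = im_dbar A J p q"
  "(f \<oplus>\<^bsub>H_Dol A J\<^esub> g) (p, q) = f (p, q) \<oplus>\<^bsub>H_Dol_pq A J p q\<^esub> g (p, q)"
  "(a \<odot>\<^bsub>H_Dol A J\<^esub> f) (p, q) = a \<odot>\<^bsub>H_Dol_pq A J p q\<^esub> f (p, q)"
  by (auto simp: H_Dol_def direct_sum_def H_Dol_pq_simps case_prod_unfold)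

text \<open>The argument \<open>(v, y)\<close> consists of a tangent vector and the coordinates of a point.\<close>

definition chart_values :: "('m, 'e) chart \<Rightarrow> ('m, 'e) dform \<Rightarrow> 'e \<times> 'e \<Rightarrow> complex" where
  "chart_values c \<omega> = (\<lambda>(v, y). \<omega> c y [v])"

lemma chart_values_linear:
  "chart_values c (\<omega> + \<omega>') = chart_values c \<omega> + chart_values c \<omega>'"
  "chart_values c (\<lambda>c y. cscale a (\<omega> c y)) = fscale a (chart_values c \<omega>)"
  by (auto simp: chart_values_def cscale_def fscale_def)

text \<open>Only the summand of bidegree \<open>(0,1)\<close> of a finite generating set is kept. Its classes are cosets of
  singletons, as there are no boundaries of \<open>mubar\<close> in this bidegree, so a linear combination of classes can be read
  as a linear combination of representatives modulo \<open>dbar\<close> of functions. The values in one chart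
  suffice for what follows.\<close>

lemma finite_dimensional_imp_closed_01_spanned:
  assumes fin: "finite_dimensional (H_Dol A J)"
  obtains \<Omega> where "finite \<Omega>"
    "\<And>\<omega>. \<omega> \<in> dforms A J 0 1 \<Longrightarrow> dbar A J 0 1 \<omega> \<in> im_mubar A J 0 2 \<Longrightarrow>
       chart_values c \<omega> \<in> fs.span (\<Omega> \<union> chart_values c ` dbar A J 0 0 ` dforms A J 0 0)"
proof -
  obtain S where S: "finite S" "S \<subseteq> carrier (H_Dol A J)" "carrier (H_Dol A J) \<subseteq> linear_span (H_Dol A J) S"
    using fin by (auto simp: finite_dimensional_def)
  have "\<exists>\<omega>. s (0, 1) = im_dbar A J 0 1 +>\<^bsub>H_mubar A J 0 1\<^esub> {\<omega>}" if "s \<in> S" for s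
  proof -
    have "s (0, 1) \<in> carrier (H_Dol_pq A J 0 1)" using S(2) that H_Dol_simps(1) by blast
    then obtain X where X: "X \<in> ker_dbar A J 0 1" "s (0, 1) = im_dbar A J 0 1 +>\<^bsub>H_mubar A J 0 1\<^esub> X"
      unfolding H_Dol_pq_simps by blast
    then obtain \<omega> where "X = mubar_class A J 0 1 \<omega>" unfolding ker_dbar_def by blast
    then have "X = {\<omega>}" using mubar_class_01 by simp
    then show ?thesis using X(2) by blast
  qed
  then obtain w where w: "\<And>s. s \<in> S \<Longrightarrow> s (0, 1) = im_dbar A J 0 1 +>\<^bsub>H_mubar A J 0 1\<^esub> {w s}" by metis
  let ?D = "chart_values c ` dbar A J 0 0 ` dforms A J 0 0"
  let ?\<Omega> = "chart_values c ` w ` S"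
  let ?G = "fs.span (?\<Omega> \<union> ?D)"
  have coset: "X \<in> im_dbar A J 0 1 +>\<^bsub>H_mubar A J 0 1\<^esub> {\<omega>} \<longleftrightarrow> (\<exists>f\<in>dforms A J 0 0. X = {dbar A J 0 0 f + \<omega>})" for X \<omega>
    unfolding H_mubar_coset im_dbar_01 by (auto simp: H_mubar_add)
  have D: "chart_values c (dbar A J 0 0 f) \<in> ?G" if "f \<in> dforms A J 0 0" for f
    using that by (intro fs.span_base) auto
  define good where "good X \<longleftrightarrow> (\<exists>\<omega>. X = {\<omega>} \<and> chart_values c \<omega> \<in> ?G)" for X
  have coset_good: "good X" if "X \<in> im_dbar A J 0 1 +>\<^bsub>H_mubar A J 0 1\<^esub> {\<omega>}" "chart_values c \<omega> \<in> ?G" for X \<omega>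
    using that D unfolding coset good_def by (auto simp: chart_values_linear intro!: fs.span_add)
  have inv: "\<forall>X\<in>z (0, 1). good X" if "z \<in> linear_span (H_Dol A J) S" for z
    using that
  proof (induction rule: linear_span.induct)
    case zero
    show ?case
      unfolding H_Dol_simps im_dbar_01 good_def using D by blast
  next
    case (incl s)
    have "chart_values c (w s) \<in> ?G" using incl by (intro fs.span_base) auto
    then show ?case using coset_good unfolding w[OF incl] by blast
  next
    case (add x y)
    show ?case
    proof
      fix X assume "X \<in> (x \<oplus>\<^bsub>H_Dol A J\<^esub> y) (0, 1)"
      then obtain Y Z where YZ: "Y \<in> x (0, 1)" "Z \<in> y (0, 1)" "X = Y \<oplus>\<^bsub>H_mubar A J 0 1\<^esub> Z"
        unfolding H_Dol_simps H_Dol_pq_simps by (elim UN_E singletonE)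
      obtain a where a: "Y = {a}" "chart_values c a \<in> ?G"
        using bspec[OF add.IH(1) YZ(1)] unfolding good_def by (elim exE conjE)
      obtain b where b: "Z = {b}" "chart_values c b \<in> ?G"
        using bspec[OF add.IH(2) YZ(2)] unfolding good_def by (elim exE conjE)
      have "X = {a + b}" by (simp add: YZ(3) a(1) b(1) H_mubar_add)
      moreover have "chart_values c (a + b) \<in> ?G"
        unfolding chart_values_linear by (rule fs.span_add[OF a(2) b(2)])
      ultimately show "good X" unfolding good_def by (intro exI[of _ "a + b"] conjI)
    qed
  next
    case (smult x a)
    show ?case
    proof
      fix X assume "X \<in> (a \<odot>\<^bsub>H_Dol A J\<^esub> x) (0, 1)"
      then obtain Y where Y: "Y \<in> x (0, 1)" "X \<in> im_dbar A J 0 1 +>\<^bsub>H_mubar A J 0 1\<^esub> (a \<odot>\<^bsub>H_mubar A J 0 1\<^esub> Y)"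
        unfolding H_Dol_simps H_Dol_pq_simps by (elim UN_E)
      obtain b where b: "Y = {b}" "chart_values c b \<in> ?G"
        using bspec[OF smult.IH Y(1)] unfolding good_def by (elim exE conjE)
      show "good X"
        by (rule coset_good[OF Y(2)[unfolded b(1) H_mubar_01_smult]]) (simp add: chart_values_linear fs.span_scale b(2))
    qed
  qed
  have "chart_values c \<omega> \<in> ?G" if \<omega>: "\<omega> \<in> dforms A J 0 1" "dbar A J 0 1 \<omega> \<in> im_mubar A J 0 2" for \<omega>
  proof -
    \<comment> \<open>The class of \<open>\<omega>\<close> in bidegree \<open>(0,1)\<close> and the zero class, as the coset of the class of the zero form, elsewhere.\<close>
    define z where "z = (\<lambda>(p, q). im_dbar A J p q +>\<^bsub>H_mubar A J p q\<^esub> (if (p, q) = (0, 1) then {\<omega>} else im_mubar A J p q))"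
    have "z (p, q) \<in> carrier (H_Dol_pq A J p q)" for p q
      using closed_01_class[OF \<omega>] zero_class_in_ker_dbar unfolding z_def H_Dol_pq_simps by auto
    moreover have "finite {i. z i \<noteq> im_dbar A J (fst i) (snd i)}"
    proof (rule finite_subset)
      show "{i. z i \<noteq> im_dbar A J (fst i) (snd i)} \<subseteq> {..DIM('e) + 2} \<times> {..DIM('e) + 2}"
      proof
        fix i assume "i \<in> {i. z i \<noteq> im_dbar A J (fst i) (snd i)}"
        moreover obtain p q where i: "i = (p, q)" by (cases i)
        ultimately have ne: "z (p, q) \<noteq> im_dbar A J p q" by simp
        have "z (p, q) = im_dbar A J p q" if "DIM('e) + 2 \<le> p + q"
        proof -
          have "(p, q) \<noteq> (0, 1)" using that by auto
          then have "z (p, q) = im_dbar A J p q +>\<^bsub>H_mubar A J p q\<^esub> im_mubar A J p q"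
            unfolding z_def by (simp only: prod.case if_False)
          then show ?thesis unfolding images_above_dim[OF that] H_mubar_coset H_mubar_add by simp
        qed
        then have "p + q < DIM('e) + 2" using ne by linarith
        then show "i \<in> {..DIM('e) + 2} \<times> {..DIM('e) + 2}" by (simp add: i)
      qed
    qed simp
    ultimately have "z \<in> carrier (H_Dol A J)" by (simp add: H_Dol_simps)
    then have "\<forall>X\<in>z (0, 1). good X" using S(3) inv by blast
    moreover have "{dbar A J 0 0 0 + \<omega>} \<in> z (0, 1)"
      using zero_in_dforms coset unfolding z_def by auto
    ultimately have "good {\<omega>}" by (simp add: dbar_zero)
    then show ?thesis unfolding good_def by blast
  qed
  then show thesis using that[of ?\<Omega>] S(1) by blast
qed

section \<open>Jets and dbar\<close>

text \<open>The operator \<open>dbar\<close> on functions that are defined in one chart only; unlike \<^const>\<open>dbar\<close> it applies to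
  the representatives of jets.\<close>

definition dbar_in_chart :: "('m, 'e) chart \<Rightarrow> ('e \<Rightarrow> complex) \<Rightarrow> 'e \<times> 'e \<Rightarrow> complex" where
  "dbar_in_chart c f = (\<lambda>(v, y). if y \<in> target c then proj01 (J c y) (\<lambda>v. pd v f y) v else 0)"

lemma dbar_in_chart_linear:
  assumes c: "c \<in> A" and f: "smooth_on (target c) f" and g: "smooth_on (target c) g"
  shows "dbar_in_chart c (f + g) = dbar_in_chart c f + dbar_in_chart c g"
    "dbar_in_chart c (f - g) = dbar_in_chart c f - dbar_in_chart c g"
    "dbar_in_chart c (fscale a f) = fscale a (dbar_in_chart c f)"
proof -
  have df: "f differentiable at y" and dg: "g differentiable at y" if "y \<in> target c" for y
    using smooth_on_differentiable[OF f chart(2)[OF c] that] smooth_on_differentiable[OF g chart(2)[OF c] that] by auto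
  have minus: "pd v (f - g) y = pd v f y - pd v g y" if "y \<in> target c" for v y
    unfolding fun_diff_def by (rule pd_eq, rule has_derivative_diff) (auto intro: pd_works df dg that)
  show "dbar_in_chart c (f - g) = dbar_in_chart c f - dbar_in_chart c g"
  proof
    fix i :: "'e \<times> 'e"
    show "dbar_in_chart c (f - g) i = (dbar_in_chart c f - dbar_in_chart c g) i"
      by (cases i) (simp add: dbar_in_chart_def proj01_def minus diff_divide_distrib add_divide_distrib right_diff_distrib)
  qed
  have plus: "pd v (f + g) y = pd v f y + pd v g y" if "y \<in> target c" for v y
    unfolding plus_fun_def by (rule pd_add[OF df[OF that] dg[OF that]])
  show "dbar_in_chart c (f + g) = dbar_in_chart c f + dbar_in_chart c g"
  proof
    fix i :: "'e \<times> 'e"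
    show "dbar_in_chart c (f + g) i = (dbar_in_chart c f + dbar_in_chart c g) i"
      by (cases i) (simp add: dbar_in_chart_def proj01_def plus add_divide_distrib distrib_left)
  qed
  have scale: "pd v (fscale a f) y = a * pd v f y" if "y \<in> target c" for v y
    unfolding fscale_def by (rule pd_cmult[OF df[OF that]])
  show "dbar_in_chart c (fscale a f) = fscale a (dbar_in_chart c f)"
  proof
    fix i :: "'e \<times> 'e"
    show "dbar_in_chart c (fscale a f) i = fscale a (dbar_in_chart c f) i"
      by (cases i) (simp add: dbar_in_chart_def proj01_def scale fscale_apply algebra_simps)
  qed
qed

lemma chart_values_dbar:
  assumes c: "c \<in> A" and f: "f \<in> dforms A J 0 0"
  shows "chart_values c (dbar A J 0 0 f) = dbar_in_chart c (\<lambda>y. f c y [])"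
proof
  fix i :: "'e \<times> 'e"
  obtain v y where i: "i = (v, y)" by (cases i)
  show "chart_values c (dbar A J 0 0 f) i = dbar_in_chart c (\<lambda>y. f c y []) i"
  proof (cases "y \<in> target c")
    case True
    then show ?thesis by (simp add: i chart_values_def dbar_in_chart_def dbar_function(2)[OF c f] wedge_1)
  next
    case False
    then show ?thesis by (simp add: i chart_values_def dbar_in_chart_def dbar_def d_part_def)
  qed
qed

text \<open>The arguments are those of \<^const>\<open>chart_values\<close>. Constant tangent vectors \<open>v\<close> suffice, since
  the coefficients of a field of covectors are its values on them.\<close>

definition flat_fields :: "('m, 'e) chart \<Rightarrow> 'e \<Rightarrow> nat \<Rightarrow> ('e \<times> 'e \<Rightarrow> complex) set" where
  "flat_fields c y k = {F. \<forall>v. smooth_on (target c) (\<lambda>z. F (v, z)) \<and> vanishes_to_order y k (\<lambda>z. F (v, z))}"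

lemma subspace_flat_fields:
  assumes c: "c \<in> A" and y: "y \<in> target c"
  shows "fs.subspace (flat_fields c y k)"
  unfolding flat_fields_def using chart(2)[OF c] y
  by (intro fs.subspaceI)
     (auto simp: fscale_def vanishes_to_order_zero
       intro!: smooth_on_const smooth_on_add smooth_on_mult vanishes_to_order_add vanishes_to_order_mult)

text \<open>Differential operators of order one lower the order of vanishing by at most one.\<close>

lemma dbar_in_chart_flat:
  assumes c: "c \<in> A" and y: "y \<in> target c" and f: "f \<in> flat_functions (target c) y (Suc k)"
  shows "dbar_in_chart c f \<in> flat_fields c y k"
  unfolding flat_fields_def
proof (intro CollectI allI conjI)
  fix v
  note S = chart(2)[OF c]
  have sm: "smooth_on (target c) f" and van: "\<And>v. vanishes_to_order y k (pd v f)"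
    using f by (auto simp: flat_functions_def)
  let ?h = "\<lambda>z. (1/2) * (pd v f z + \<i> * (\<Sum>b\<in>Basis. complex_of_real (J c z v \<bullet> b) * pd b f z))"
  have Jv: "smooth_on (target c) (\<lambda>z. complex_of_real (J c z v \<bullet> b))" for b
    using complex_structure_field_J[OF c]
    by (intro smooth_on_of_real smooth_on_inner_left S) (simp add: complex_structure_field_def)
  have eq: "dbar_in_chart c f (v, z) = ?h z" if "z \<in> target c" for z
    using that pd_expand_basis[OF smooth_on_differentiable[OF sm S that], of "J c z v"]
    by (simp add: dbar_in_chart_def proj01_def scaleR_conv_of_real)
  show "smooth_on (target c) (\<lambda>z. dbar_in_chart c f (v, z))"
    by (subst smooth_on_cong[OF S eq], assumption)
       (intro smooth_on_mult smooth_on_add smooth_on_sum smooth_on_const S smooth_on_pd sm Jv finite_Basis)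
  show "vanishes_to_order y k (\<lambda>z. dbar_in_chart c f (v, z))"
    by (subst vanishes_to_order_cong[OF S y eq], assumption)
       (intro vanishes_to_order_mult[OF S y] vanishes_to_order_add[OF S y] vanishes_to_order_sum[OF S y] van
         smooth_on_mult smooth_on_add smooth_on_sum smooth_on_const S smooth_on_pd sm Jv finite_Basis)
qed

lemma dbar_in_chart_span:
  assumes c: "c \<in> A" and T: "T \<subseteq> smooth_functions (target c)" and t: "t \<in> fs.span T"
  shows "smooth_on (target c) t \<and> dbar_in_chart c t \<in> fs.span (dbar_in_chart c ` T)"
  using t
proof (induction rule: fs.span_induct)
  case base
  note S = chart(2)[OF c]
  let ?X = "{x. smooth_on (target c) x \<and> dbar_in_chart c x \<in> fs.span (dbar_in_chart c ` T)}"
  show ?case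
  proof (rule fs.subspaceI)
    have sm: "smooth_on (target c) 0" using smooth_on_const[OF S, of 0] by (simp add: zero_fun_def)
    then have "dbar_in_chart c 0 = 0" using dbar_in_chart_linear(2)[OF c sm sm] by simp
    then show "0 \<in> ?X" by (simp add: sm fs.span_zero)
  next
    fix f g assume f: "f \<in> ?X" and g: "g \<in> ?X"
    have "smooth_on (target c) (f + g)"
      unfolding plus_fun_def using f g by (intro smooth_on_add[OF S]) auto
    moreover have "dbar_in_chart c (f + g) = dbar_in_chart c f + dbar_in_chart c g"
      using f g by (intro dbar_in_chart_linear(1)[OF c]) auto
    ultimately show "f + g \<in> ?X" using f g by (simp add: fs.span_add)
  next
    fix a f assume f: "f \<in> ?X"
    have "smooth_on (target c) (fscale a f)"
      unfolding fscale_def using f by (intro smooth_on_mult[OF S smooth_on_const[OF S]]) auto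
    moreover have "dbar_in_chart c (fscale a f) = fscale a (dbar_in_chart c f)"
      using f by (intro dbar_in_chart_linear(3)[OF c, of f f]) auto
    ultimately show "fscale a f \<in> ?X" using f by (simp add: fs.span_scale)
  qed
next
  case (step t)
  then show ?case using T by (auto simp: smooth_functions_def intro: fs.span_base)
qed

text \<open>Fix a bump function \<open>chi\<close> and two covectors \<open>\<beta> b\<close> of type \<open>(0,1)\<close> at the point that are dual to two
  vectors. The forms \<open>chi * t * proj01 (\<beta> b)\<close>, where \<open>t\<close> runs through a basis of the \<open>k\<close>-jets, are closed, and they are independent modulo
  fields that are flat to order \<open>k\<close>. On the other hand they are
  combinations of the finitely many given classes and of forms \<open>dbar f\<close>, and modulo flat fields
  the latter depend only on the \<open>(k + 1)\<close>-jet of \<open>f\<close>.\<close>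

lemma infinite_dimensional:
  assumes c: "c \<in> A" and y: "y \<in> target c" and dim: "4 \<le> DIM('e)"
    and rank: "(DIM('e) div 2) choose 2 \<le> fs.dim (mubar_at A J c y ` forms_at (J c y) 1 0)"
  shows "\<not> finite_dimensional (H_Dol A J)"
proof
  assume "finite_dimensional (H_Dol A J)"
  then obtain \<Omega> where \<Omega>: "finite \<Omega>" and closed_span: "\<And>\<omega>. \<omega> \<in> dforms A J 0 1 \<Longrightarrow> dbar A J 0 1 \<omega> \<in> im_mubar A J 0 2 \<Longrightarrow>
       chart_values c \<omega> \<in> fs.span (\<Omega> \<union> chart_values c ` dbar A J 0 0 ` dforms A J 0 0)"
    using finite_dimensional_imp_closed_01_spanned[of c] by blast
  note S = chart(2)[OF c] and Jf = complex_structure_field_J[OF c] and Jy = complex_structure_J[OF c y]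
  obtain U where U: "open U" "y \<in> U" "U \<subseteq> target c" and
    closed: "\<And>K \<theta>. compact K \<Longrightarrow> K \<subseteq> U \<Longrightarrow> supported_field c K \<theta> \<Longrightarrow> (\<And>z. z \<in> target c \<Longrightarrow> \<theta> z \<in> A01 (J c z)) \<Longrightarrow>
      extend_form c \<theta> \<in> dforms A J 0 1 \<and> dbar A J 0 1 (extend_form c \<theta>) \<in> im_mubar A J 0 2"
    using supported_01_forms_closed[OF c y rank] by blast
  obtain r where r: "r > 0" "cball y r \<subseteq> U" using U open_contains_cball by blast
  obtain chi where chi: "smooth_on UNIV chi" "chi y = 1" "\<And>z. z \<notin> cball y r \<Longrightarrow> chi z = (0::complex)"
    using bump_function_exists[OF r(1), of y] by blast
  have chiS: "smooth_on (target c) chi" by (rule smooth_on_subset[OF chi(1)]) simp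
  obtain B :: "'e set" and \<beta> where B: "finite B" "2 * card B = DIM('e)" "\<And>b. b \<in> B \<Longrightarrow> \<beta> b \<in> A01 (J c y)"
    "\<And>b b'. b \<in> B \<Longrightarrow> b' \<in> B \<Longrightarrow> \<beta> b b' = (if b = b' then 1 else 0)"
    "\<And>\<alpha>. \<alpha> \<in> A01 (J c y) \<Longrightarrow> \<alpha> = (\<lambda>v. \<Sum>b\<in>B. \<alpha> b * \<beta> b v)"
    by (rule complex_frame[OF Jy]) (rule that)
  have "2 \<le> card B" using B(2) dim by simp
  then obtain P where P: "P \<subseteq> B" "card P = 2" using obtain_subset_with_card_n by metis
  then have finP: "finite P" by (simp add: card_ge_0_finite)
  obtain T where T: "\<And>k. finite (T k)" "\<And>k. T k \<subseteq> smooth_functions (target c)"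
    "\<And>k. independent_modulo fscale (flat_functions (target c) y k) (T k) id"
    "\<And>k g. g \<in> smooth_functions (target c) \<Longrightarrow> \<exists>t\<in>fs.span (T k). g - t \<in> flat_functions (target c) y k"
    "\<And>k. k + 1 \<le> card (T k)" "\<And>k. card (T k) \<le> (k + 1) ^ DIM('e)"
    by (rule jet_spaces[OF S y]) (rule that)
  have Tsm: "smooth_on (target c) t" if "t \<in> T k" for t k
    using T(2) that by (auto simp: smooth_functions_def)
  let ?e = "\<lambda>b z. proj01 (J c z) (\<beta> b)"
  have e: "covector_field (target c) (?e b)" if "b \<in> P" for b
    using B(3) P(1) that by (intro covector_field_proj01[OF S Jf] linear_if_A01) auto
  let ?\<theta> = "\<lambda>t b z v. (chi z * t z) * ?e b z v"
  let ?F = "\<lambda>(t, b). chart_values c (extend_form c (?\<theta> t b))"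
  have F: "?F (t, b) (v, z) = ?\<theta> t b z v" if "z \<in> target c" for t b v z
    by (simp add: chart_values_def extend_form_in_chart[OF c that] wedge_1)
  have F_span: "?F (t, b) \<in> fs.span (\<Omega> \<union> chart_values c ` dbar A J 0 0 ` dforms A J 0 0)"
    if t: "t \<in> T k" and b: "b \<in> P" for t b k
  proof -
    have cov: "covector_field (target c) (?\<theta> t b)"
      by (rule covector_field_mult[OF S smooth_on_mult[OF S chiS Tsm[OF t]] e[OF b]])
    have "supported_field c (cball y r) (?\<theta> t b)"
      using cov r U(3) chi(3) by (auto simp: supported_field_def)
    moreover have "?\<theta> t b z \<in> A01 (J c z)" if z: "z \<in> target c" for z
    proof -
      have "?e b z \<in> A01 (J c z)"
        using B(3) P(1) b by (intro proj01_in_A01[OF complex_structure_J[OF c z]] linear_if_A01) auto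
      then show ?thesis
        using cov z unfolding A01_iff[OF complex_structure_J[OF c z]] by (auto simp: covector_field_def)
    qed
    ultimately show ?thesis using closed[of "cball y r" "?\<theta> t b"] r(2) closed_span by simp
  qed
  \<comment> \<open>The inequality between the dimensions of jet spaces, with \<open>card \<Omega>\<close> in the role of the dimension of the cohomology.\<close>
  have double: "2 * card (T k) \<le> card \<Omega> + card (T (k + 1))" for k
  proof -
    note W = subspace_flat_fields[OF c y, of k]
    let ?T' = "\<Omega> \<union> dbar_in_chart c ` T (k + 1)"
    have approx: "\<exists>s\<in>fs.span ?T'. F - s \<in> flat_fields c y k"
      if "F \<in> fs.span (\<Omega> \<union> chart_values c ` dbar A J 0 0 ` dforms A J 0 0)" for F
      using that
    proof (induction rule: fs.span_induct)
      case base
      show ?case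
      proof (rule fs.subspaceI)
        show "0 \<in> {F. \<exists>s\<in>fs.span ?T'. F - s \<in> flat_fields c y k}"
          by (intro CollectI bexI[of _ 0]) (simp_all add: fs.span_zero fs.subspace_0[OF W])
      next
        fix F G assume "F \<in> {F. \<exists>s\<in>fs.span ?T'. F - s \<in> flat_fields c y k}" "G \<in> {F. \<exists>s\<in>fs.span ?T'. F - s \<in> flat_fields c y k}"
        then obtain s s' where s: "s \<in> fs.span ?T'" "F - s \<in> flat_fields c y k" "s' \<in> fs.span ?T'" "G - s' \<in> flat_fields c y k"
          by blast
        have "(F + G) - (s + s') \<in> flat_fields c y k"
          using fs.subspace_add[OF W s(2,4)] by (simp add: algebra_simps)
        then show "F + G \<in> {F. \<exists>s\<in>fs.span ?T'. F - s \<in> flat_fields c y k}" using fs.span_add[OF s(1,3)] by blast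
      next
        fix a F assume "F \<in> {F. \<exists>s\<in>fs.span ?T'. F - s \<in> flat_fields c y k}"
        then obtain s where s: "s \<in> fs.span ?T'" "F - s \<in> flat_fields c y k" by blast
        have "fscale a F - fscale a s \<in> flat_fields c y k"
          using fs.subspace_scale[OF W s(2), of a] by (simp add: fs.scale_right_diff_distrib)
        then show "fscale a F \<in> {F. \<exists>s\<in>fs.span ?T'. F - s \<in> flat_fields c y k}" using fs.span_scale[OF s(1)] by blast
      qed
    next
      case (step F)
      show ?case
      proof (cases "F \<in> \<Omega>")
        case True
        then have "F \<in> fs.span ?T'" by (intro fs.span_base) simp
        moreover have "F - F \<in> flat_fields c y k" using fs.subspace_0[OF W] by simp
        ultimately show ?thesis by blast
      next
        case False
        then obtain f where f: "f \<in> dforms A J 0 0" "F = chart_values c (dbar A J 0 0 f)" using step by blast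
        let ?f = "\<lambda>z. f c z []"
        have fsm: "smooth_on (target c) ?f" by (rule dbar_function(1)[OF c f(1)])
        then obtain t where t: "t \<in> fs.span (T (k + 1))" "?f - t \<in> flat_functions (target c) y (k + 1)"
          using T(4)[of ?f "k + 1"] by (auto simp: smooth_functions_def)
        note st = dbar_in_chart_span[OF c T(2) t(1)]
        have "dbar_in_chart c t \<in> fs.span ?T'" using st fs.span_mono[of "dbar_in_chart c ` T (k + 1)" ?T'] by blast
        moreover have "dbar_in_chart c ?f - dbar_in_chart c t \<in> flat_fields c y k"
          using dbar_in_chart_flat[OF c y, of "?f - t" k] t(2) dbar_in_chart_linear(2)[OF c fsm conjunct1[OF st]] by simp
        ultimately show ?thesis unfolding f(2) chart_values_dbar[OF c f(1)] by blast
      qed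
    qed
    have "card (T k \<times> P) \<le> card ?T'"
    proof (rule fs.card_le_if_independent_modulo[OF W, where b = ?F])
      show "finite (T k \<times> P)" "finite ?T'" using T(1) finP \<Omega> by auto
      show "\<exists>s\<in>fs.span ?T'. ?F i - s \<in> flat_fields c y k" if i: "i \<in> T k \<times> P" for i
      proof -
        obtain t b where tb: "i = (t, b)" "t \<in> T k" "b \<in> P" using i by blast
        show ?thesis unfolding tb(1) by (rule approx[OF F_span[OF tb(2,3)]])
      qed
      show "independent_modulo fscale (flat_fields c y k) (T k \<times> P) ?F"
        unfolding independent_modulo_def
      proof (intro allI impI)
        fix a assume in_flat: "(\<Sum>i\<in>T k \<times> P. fscale (a i) (?F i)) \<in> flat_fields c y k"
        let ?g = "\<lambda>b z. \<Sum>t\<in>T k. a (t, b) * t z"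
        \<comment> \<open>The matrix of the chosen covectors in the chosen directions; it is the identity at the point.\<close>
        let ?A = "\<lambda>b' b z. chi z * ?e b z b'"
        have g_smooth: "smooth_on (target c) (?g b)" for b
          by (intro smooth_on_sum smooth_on_mult smooth_on_const S T(1)) (rule Tsm)
        have "vanishes_to_order y k (?g b)" if b: "b \<in> P" for b
        proof (rule vanishes_to_order_linear_system[OF S y finP _ _ _ _ b, where A = ?A and g = ?g])
          show "smooth_on (target c) (?A b' b)" if "b \<in> P" for b' b
            using e[OF that] by (intro smooth_on_mult S chiS) (simp add: covector_field_def)
          show "?A b' b y = (if b' = b then 1 else 0)" if "b' \<in> P" "b \<in> P" for b' b
            using B(3,4) P(1) that by (simp add: chi(2) proj01_fixes_A01[OF Jy] subset_iff)
          fix b' assume b': "b' \<in> P"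
          have eq: "(\<Sum>i\<in>T k \<times> P. fscale (a i) (?F i)) (b', z) = (\<Sum>b\<in>P. ?A b' b z * ?g b z)" if z: "z \<in> target c" for z
          proof -
            have "(\<Sum>i\<in>T k \<times> P. fscale (a i) (?F i)) (b', z) = (\<Sum>i\<in>T k \<times> P. a i * ?\<theta> (fst i) (snd i) z b')"
              by (simp only: sum_fun_apply fscale_apply) (rule sum.cong[OF refl], use F[OF z] in force)
            also have "\<dots> = (\<Sum>t\<in>T k. \<Sum>b\<in>P. a (t, b) * ?\<theta> t b z b')"
              by (simp add: sum.cartesian_product')
            also have "\<dots> = (\<Sum>b\<in>P. \<Sum>t\<in>T k. a (t, b) * ?\<theta> t b z b')" by (rule sum.swap)
            also have "\<dots> = (\<Sum>b\<in>P. ?A b' b z * ?g b z)"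
              by (simp add: sum_distrib_left mult_ac)
            finally show ?thesis .
          qed
          have van: "vanishes_to_order y k (\<lambda>z. (\<Sum>i\<in>T k \<times> P. fscale (a i) (?F i)) (b', z))"
            by (rule conjunct2[OF spec[OF in_flat[unfolded flat_fields_def mem_Collect_eq]]])
          show "vanishes_to_order y k (\<lambda>z. \<Sum>b\<in>P. ?A b' b z * ?g b z)"
            by (rule iffD1[OF vanishes_to_order_cong[OF S y] van]) (rule eq)
        qed (rule g_smooth)
        then have "(\<Sum>t\<in>T k. fscale (a (t, b)) (id t)) \<in> flat_functions (target c) y k" if "b \<in> P" for b
          using that g_smooth by (simp add: flat_functions_def fscale_linear_combination)
        then have z: "\<forall>t\<in>T k. a (t, b) = 0" if "b \<in> P" for b
          by (rule mp[OF spec[OF T(3)[of k, unfolded independent_modulo_def], of "\<lambda>t. a (t, b)"]]) (rule that)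
        show "\<forall>i\<in>T k \<times> P. a i = 0" using z by auto
      qed
    qed
    also have "\<dots> \<le> card \<Omega> + card (dbar_in_chart c ` T (k + 1))" by (rule card_Un_le)
    also have "\<dots> \<le> card \<Omega> + card (T (k + 1))" using card_image_le[OF T(1)] by simp
    finally show ?thesis using P(2) by (simp add: card_cartesian_product)
  qed
  show False by (rule no_exponential_below_polynomial[OF double T(5) T(6)])
qed

end

theorem theorem2:
  fixes M :: "'m topology"
    and A :: "('m, 'e::euclidean_space) chart set"
    and J :: "('m, 'e) endo_field"
    and x :: 'm
  assumes "smooth_manifold M A"
    and "almost_complex_structure A J"
    and "DIM('e) = 4 \<or> DIM('e) = 6"
    and "x \<in> topspace M"
    and "maximally_nonintegrable_at A J x"
  shows "\<not> finite_dimensional (H_Dol A J)"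
proof -
  interpret almost_complex_manifold M A J using assms(1,2) by unfold_locales
  obtain c where c: "c \<in> A" "x \<in> fst c" and
    dim: "vector_space.dim cscale (mubar_at A J c (snd c x) ` forms_at (J c (snd c x)) 1 0) =
        min (DIM('e) div 2) ((DIM('e) div 2) choose 2)"
    using assms(5) unfolding maximally_nonintegrable_at_def by blast
  have "min (DIM('e) div 2) ((DIM('e) div 2) choose 2) = (DIM('e) div 2) choose 2"
    using assms(3)
  proof
    assume "DIM('e) = 4" then show ?thesis by (simp add: choose_two)
  next
    assume "DIM('e) = 6" then show ?thesis by (simp add: choose_two)
  qed
  then have rank: "(DIM('e) div 2) choose 2 \<le> fs.dim (mubar_at A J c (snd c x) ` forms_at (J c (snd c x)) 1 0)"
    unfolding dim[unfolded cscale_eq_fscale] by linarith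
  have "4 \<le> DIM('e)" using assms(3) by linarith
  then show ?thesis by (rule infinite_dimensional[OF c(1) point(4)[OF c] _ rank])
qed

end
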